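(* Let $K,N\to\infty$ with fixed $p_r$ and fixed ratio $\kappa=N/K$. The deterministic equivalent $\bar\gamma_k$ of the uplink SINR $\gamma_k$ between the $k$th terminal in the $l$th cell and its base station (zero-forcing reception under delayed channels, defined in the context), i.e. the deterministic approximation such that $\gamma_k-\bar\gamma_k\to0$ almost surely as $N\to\infty$, is given by $$\bar\gamma_k=\frac{\alpha^2\hat\beta_{llk}(\kappa-1)}{\alpha^2C\hat\beta_{llk}(\kappa-1)+\sum_{i=1}^L\frac1K\mathrm{Tr}\,\tilde D_{li}},$$ where $C=\sum_{i\neq l}(\beta_{lik}/\beta_{llk})^2$ and $\tilde D_{li}$ is the $K\times K$ diagonal matrix with $j$th diagonal element $\beta_{lij}-\alpha^2\hat\beta_{lij}$.
   Context: Setting: the uplink of a cellular network with $L$ cells, each with one $N$-antenna base station and $K$ single-antenna terminals, $N\ge K$, all terminals sharing the same time-frequency resource. $p_r$ is the average transmit power of each terminal; the noise at the base stations has unit-variance circularly symmetric complex Gaussian entries. $\mathcal{CN}(0,\Sigma)$ denotes the circularly symmetric complex Gaussian law. The channel at symbol $n$ from terminal $j$ of cell $i$ to base station $l$ is $g_{lij}[n]=\sqrt{\beta_{lij}}\,h_{lij}[n]\in\mathbb C^N$, with large-scale fading coefficient $\beta_{lij}$ and $h_{lij}[n]\sim\mathcal{CN}(0,I_N)$. Training: all cells reuse the same $K$ orthogonal pilot sequences of length $\tau\ge K$; $p_{\mathrm{tr}}=\tau p_r$. The MMSE estimate of $g_{lij}[n]$ is $\hat g_{lij}[n]=\beta_{lij}\big(\tfrac1{p_{\mathrm{tr}}}+\sum_{i'=1}^L\beta_{li'j}\big)^{-1}\big(\sum_{i'=1}^L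 g_{li'j}[n]+\tfrac1{\sqrt{p_{\mathrm{tr}}}}\tilde z_{lj}[n]\big)$, with $\tilde z_{lj}[n]\sim\mathcal{CN}(0,I_N)$ independent of the channels. With $\hat\beta_{lij}=\beta_{lij}^2/\big(\sum_{i'=1}^L\beta_{li'j}+1/p_{\mathrm{tr}}\big)$, one has $\hat g_{lij}[n]\sim\mathcal{CN}(0,\hat\beta_{lij}I_N)$, and the estimation error $\tilde g_{lij}[n]=g_{lij}[n]-\hat g_{lij}[n]\sim\mathcal{CN}(0,(\beta_{lij}-\hat\beta_{lij})I_N)$ is independent of $\hat g_{lij}[n]$. Delayed channel: $g_{lij}[n]=\alpha g_{lij}[n-1]+e_{lij}[n]$ with $e_{lij}[n]\sim\mathcal{CN}(0,(1-\alpha^2)\beta_{lij}I_N)$ independent of $g_{lij}[n-1]$, where $\alpha=J_0(2\pi f_DT_s)$ is the temporal correlation parameter ($J_0$ the zeroth-order Bessel function of the first kind, $f_D$ the maximum Doppler shift, $T_s$ the channel sampling period). Thus $g_{lij}[n]=\alpha\hat g_{lij}[n-1]+\tilde e_{lij}[n]$, where $\tilde e_{lij}[n]=\alpha\tilde g_{lij}[n-1]+e_{lij}[n]\sim\mathcal{CN}(0,(\beta_{lij}-\alpha^2\hat\beta_{lij})I_N)$ is independent of $\hat g_{lij}[n-1]$. Let $\hat G_{li}[n]$ and $\tilde E_{li}[n]$ be the $N\times K$ matrices with $j$th columns $\hat g_{lij}[n]$ and $\tilde e_{lij}[n]$; then $\hat G_{li}[n]=\hat G_{ll}[n]D_i$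 with $D_i=\mathrm{diag}(\beta_{li1}/\beta_{ll1},\dots,\beta_{liK}/\beta_{llK})$. SINR: the received signal at base station $l$ is multiplied by $\alpha^{-1}\hat G_{ll}^\dagger[n-1]$ ($\dagger$ is the pseudo-inverse). With $[A]_k$ the $k$th row of $A$ and $\|\cdot\|$ the Euclidean norm, $$\gamma_k=\frac{\alpha^2p_r}{\alpha^2p_r\sum_{i\ne l}\big\|[\hat G_{ll}^\dagger[n-1]]_k\hat G_{li}[n-1]\big\|^2+p_r\sum_{i=1}^L\big\|[\hat G_{ll}^\dagger[n-1]]_k\tilde E_{li}[n]\big\|^2+\big\|[\hat G_{ll}^\dagger[n-1]]_k\big\|^2}.$$
   Formalization: The formal theorem additionally assumes that the coefficients β_{lij} are uniformly bounded over i, j and, only when L=1 or κ=1, that Σ_i (1/K) Tr D̃_{li} is bounded away from 0; without these the stated convergence can fail. *)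

theory Defs
  imports
    "HOL-Probability.Probability"
    "Jordan_Normal_Form.Schur_Decomposition"
begin

unbundle no vec_syntax
unbundle no inner_syntax

definition bessel_J0 :: "real \<Rightarrow> real" where
  "bessel_J0 x = (\<Sum>r. (-1) ^ r / (fact r)\<^sup>2 * (x / 2) ^ (2 * r))"

(* The law CN(0, v) on the complex plane: real and imaginary part are independent and centred
   with variance v/2 each.  Scaling a standard pair, instead of using normal_density 0 (sqrt (v/2)),
   makes v = 0 the point mass at 0 rather than the null measure. *)
definition complex_normal :: "real \<Rightarrow> complex measure" where
  "complex_normal v =
     distr (density lborel std_normal_density \<Otimes>\<^sub>M density lborel std_normal_density) borel
       (\<lambda>(x, y). complex_of_real (sqrt (v / 2)) * Complex x y)"

(* Moore-Penrose pseudo-inverse, by the four Penrose conditions. *)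
definition is_pseudo_inverse :: "complex mat \<Rightarrow> complex mat \<Rightarrow> bool" where
  "is_pseudo_inverse A X \<longleftrightarrow>
     X \<in> carrier_mat (dim_col A) (dim_row A) \<and>
     A * X * A = A \<and> X * A * X = X \<and>
     mat_adjoint (A * X) = A * X \<and> mat_adjoint (X * A) = X * A"

definition pseudo_inverse :: "complex mat \<Rightarrow> complex mat" where
  "pseudo_inverse A = (THE X. is_pseudo_inverse A X)"

definition row_mult :: "complex vec \<Rightarrow> complex mat \<Rightarrow> complex vec" where
  "row_mult v A = Matrix.vec (dim_col A) (\<lambda>j. v \<bullet> Matrix.col A j)"

definition norm_vec :: "complex vec \<Rightarrow> real" where
  "norm_vec v = sqrt (\<Sum>a<dim_vec v. (cmod (v $ a))\<^sup>2)"

definition mat_trace :: "real mat \<Rightarrow> real" where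
  "mat_trace A = sum_list (diag_mat A)"

(* Conventions: l and i are cells (l the base station, i the cell of the terminal), j and k are
   terminals, both counted from 0; n is the symbol time.  The arguments h, z, e of the functions
   below are realisations (the sample point already applied) of the fading vectors, the
   pilot noise and the innovations. *)
type_synonym fading = "nat \<Rightarrow> nat \<Rightarrow> nat \<Rightarrow> int \<Rightarrow> complex vec"  (* l i j n *)
type_synonym pilot_noise = "nat \<Rightarrow> nat \<Rightarrow> int \<Rightarrow> complex vec"    (* l j n *)
type_synonym large_scale = "nat \<Rightarrow> nat \<Rightarrow> nat \<Rightarrow> real"           (* l i j *)

definition channel :: "large_scale \<Rightarrow> fading \<Rightarrow> fading" where
  "channel \<beta> h l i j n = complex_of_real (sqrt (\<beta> l i j)) \<cdot>\<^sub>v h l i j n"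

definition beta_hat :: "large_scale \<Rightarrow> nat \<Rightarrow> real \<Rightarrow> large_scale" where
  "beta_hat \<beta> L ptr l i j = (\<beta> l i j)\<^sup>2 / ((\<Sum>i'<L. \<beta> l i' j) + 1 / ptr)"

definition channel_est ::
  "large_scale \<Rightarrow> nat \<Rightarrow> nat \<Rightarrow> real \<Rightarrow> fading \<Rightarrow> pilot_noise \<Rightarrow> fading" where
  "channel_est \<beta> L N ptr h z l i j n =
     Matrix.vec N (\<lambda>a. complex_of_real (\<beta> l i j * inverse (1 / ptr + (\<Sum>i'<L. \<beta> l i' j))) *
       ((\<Sum>i'<L. channel \<beta> h l i' j n $ a) + complex_of_real (1 / sqrt ptr) * z l j n $ a))"

definition est_error ::
  "large_scale \<Rightarrow> nat \<Rightarrow> nat \<Rightarrow> real \<Rightarrow> fading \<Rightarrow> pilot_noise \<Rightarrow> fading" where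
  "est_error \<beta> L N ptr h z l i j n =
     channel \<beta> h l i j n - channel_est \<beta> L N ptr h z l i j n"

definition delay_error ::
  "large_scale \<Rightarrow> nat \<Rightarrow> nat \<Rightarrow> real \<Rightarrow> real \<Rightarrow> fading \<Rightarrow> pilot_noise \<Rightarrow> fading \<Rightarrow> fading" where
  "delay_error \<beta> L N ptr \<alpha> h z e l i j n =
     complex_of_real \<alpha> \<cdot>\<^sub>v est_error \<beta> L N ptr h z l i j (n - 1) + e l i j n"

definition est_mat ::
  "large_scale \<Rightarrow> nat \<Rightarrow> nat \<Rightarrow> nat \<Rightarrow> real \<Rightarrow> fading \<Rightarrow> pilot_noise \<Rightarrow>
     nat \<Rightarrow> nat \<Rightarrow> int \<Rightarrow> complex mat" where
  "est_mat \<beta> L K N ptr h z l i n =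
     Matrix.mat N K (\<lambda>(a, j). channel_est \<beta> L N ptr h z l i j n $ a)"

definition delay_error_mat ::
  "large_scale \<Rightarrow> nat \<Rightarrow> nat \<Rightarrow> nat \<Rightarrow> real \<Rightarrow> real \<Rightarrow> fading \<Rightarrow> pilot_noise \<Rightarrow> fading \<Rightarrow>
     nat \<Rightarrow> nat \<Rightarrow> int \<Rightarrow> complex mat" where
  "delay_error_mat \<beta> L K N ptr \<alpha> h z e l i n =
     Matrix.mat N K (\<lambda>(a, j). delay_error \<beta> L N ptr \<alpha> h z e l i j n $ a)"

definition zf_sinr ::
  "large_scale \<Rightarrow> nat \<Rightarrow> nat \<Rightarrow> nat \<Rightarrow> real \<Rightarrow> real \<Rightarrow> real \<Rightarrow> fading \<Rightarrow> pilot_noise \<Rightarrow> fading \<Rightarrow>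
     nat \<Rightarrow> nat \<Rightarrow> int \<Rightarrow> real" where
  "zf_sinr \<beta> L K N pr ptr \<alpha> h z e l k n =
     (let r = Matrix.row (pseudo_inverse (est_mat \<beta> L K N ptr h z l l (n - 1))) k
      in \<alpha>\<^sup>2 * pr /
         (\<alpha>\<^sup>2 * pr * (\<Sum>i\<in>{..<L} - {l}.
             (norm_vec (row_mult r (est_mat \<beta> L K N ptr h z l i (n - 1))))\<^sup>2)
          + pr * (\<Sum>i<L. (norm_vec (row_mult r (delay_error_mat \<beta> L K N ptr \<alpha> h z e l i n)))\<^sup>2)
          + (norm_vec r)\<^sup>2))"

definition D_tilde :: "large_scale \<Rightarrow> nat \<Rightarrow> nat \<Rightarrow> real \<Rightarrow> real \<Rightarrow> nat \<Rightarrow> nat \<Rightarrow> real mat" where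
  "D_tilde \<beta> L K ptr \<alpha> l i = mat_diag K (\<lambda>j. \<beta> l i j - \<alpha>\<^sup>2 * beta_hat \<beta> L ptr l i j)"

definition zf_sinr_det ::
  "large_scale \<Rightarrow> nat \<Rightarrow> nat \<Rightarrow> real \<Rightarrow> real \<Rightarrow> real \<Rightarrow> nat \<Rightarrow> nat \<Rightarrow> real" where
  "zf_sinr_det \<beta> L K \<kappa> ptr \<alpha> l k =
     (let C = (\<Sum>i\<in>{..<L} - {l}. (\<beta> l i k / \<beta> l l k)\<^sup>2)
      in \<alpha>\<^sup>2 * beta_hat \<beta> L ptr l l k * (\<kappa> - 1) /
         (\<alpha>\<^sup>2 * C * beta_hat \<beta> L ptr l l k * (\<kappa> - 1)
          + (\<Sum>i<L. 1 / real K * mat_trace (D_tilde \<beta> L K ptr \<alpha> l i))))"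

(* The scalar randomness at base station l that enters the SINR at time n: entry a of
   h_{lij}[n-1], of the pilot noise z_{lj}[n-1], and of the innovation e_{lij}[n]. *)
datatype source = Fading nat nat nat | Pilot_noise nat nat | Innovation nat nat nat

definition sources :: "nat \<Rightarrow> nat \<Rightarrow> nat \<Rightarrow> source set" where
  "sources L K N =
     {Fading i j a | i j a. i < L \<and> j < K \<and> a < N} \<union>
     {Pilot_noise j a | j a. j < K \<and> a < N} \<union>
     {Innovation i j a | i j a. i < L \<and> j < K \<and> a < N}"

fun source_val :: "fading \<Rightarrow> pilot_noise \<Rightarrow> fading \<Rightarrow> nat \<Rightarrow> int \<Rightarrow> source \<Rightarrow> complex" where
  "source_val h z e l n (Fading i j a) = h l i j (n - 1) $ a"
| "source_val h z e l n (Pilot_noise j a) = z l j (n - 1) $ a"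
| "source_val h z e l n (Innovation i j a) = e l i j n $ a"

fun source_variance :: "large_scale \<Rightarrow> real \<Rightarrow> nat \<Rightarrow> source \<Rightarrow> real" where
  "source_variance \<beta> \<alpha> l (Fading i j a) = 1"
| "source_variance \<beta> \<alpha> l (Pilot_noise j a) = 1"
| "source_variance \<beta> \<alpha> l (Innovation i j a) = (1 - \<alpha>\<^sup>2) * \<beta> l i j"

(* A random vector with law CN(0, v I_N) is one with independent CN(0, v) entries, so the laws of
   all the vectors and their mutual independence are a single independence statement on entries. *)
definition delayed_uplink ::
  "'a measure \<Rightarrow> large_scale \<Rightarrow> nat \<Rightarrow> nat \<Rightarrow> nat \<Rightarrow> real \<Rightarrow>
     ('a \<Rightarrow> fading) \<Rightarrow> ('a \<Rightarrow> pilot_noise) \<Rightarrow> ('a \<Rightarrow> fading) \<Rightarrow> nat \<Rightarrow> int \<Rightarrow> bool" where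
  "delayed_uplink M \<beta> L K N \<alpha> h z e l n \<longleftrightarrow>
     prob_space M \<and>
     (\<forall>\<omega>\<in>space M. \<forall>j<K.
        z \<omega> l j (n - 1) \<in> carrier_vec N \<and>
        (\<forall>i<L. h \<omega> l i j (n - 1) \<in> carrier_vec N \<and> h \<omega> l i j n \<in> carrier_vec N \<and>
           e \<omega> l i j n \<in> carrier_vec N \<and>
           channel \<beta> (h \<omega>) l i j n =
             complex_of_real \<alpha> \<cdot>\<^sub>v channel \<beta> (h \<omega>) l i j (n - 1) + e \<omega> l i j n)) \<and>
     prob_space.indep_vars M (\<lambda>_. borel) (\<lambda>s \<omega>. source_val (h \<omega>) (z \<omega>) (e \<omega>) l n s)
       (sources L K N) \<and>
     (\<forall>s\<in>sources L K N.
        distr M borel (\<lambda>\<omega>. source_val (h \<omega>) (z \<omega>) (e \<omega>) l n s) =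
          complex_normal (source_variance \<beta> \<alpha> l s))"

end

theory Submission
  imports Defs
begin

text \<open>Let \<open>r\<close> be the \<open>k\<close>-th row of the pseudo-inverse of the estimated channel matrix \<open>G\<close>. Almost surely
  \<open>G\<close> has full column rank, so \<open>r\<close> applied to the estimate of cell \<open>i\<close> gives exactly
  \<open>\<beta>\<^sub>l\<^sub>i\<^sub>k / \<beta>\<^sub>l\<^sub>l\<^sub>k\<close> in position \<open>k\<close> and 0 elsewhere, while \<open>1 / \<parallel>r\<parallel>\<^sup>2\<close> is the squared distance of column \<open>k\<close> of
  \<open>G\<close> to the span of the other \<open>K - 1\<close> columns; it concentrates around \<open>N - K + 1\<close> times the entry variance.
  For each fixed cell \<open>i\<close> the delay errors are independent of \<open>G\<close> (jointly Gaussian and uncorrelated), hence,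
  given \<open>G\<close>, \<open>\<parallel>r E\<^sub>i\<parallel>\<^sup>2 / \<parallel>r\<parallel>\<^sup>2\<close> is a weighted sum of \<open>K\<close> independent exponentials and concentrates around the
  trace of its variances. Both concentration statements come from one moment generating function: that of a
  Gaussian quadratic form that is diagonal up to an orthonormal family. The resulting tails are exponential in
  \<open>K\<close>, so they are summable and Borel--Cantelli applies although the systems for different sizes need not be
  related to each other.\<close>


section \<open>Bessel function\<close>

text \<open>The target moves with the size of the system: neither \<open>beta_hat\<close> at growing
  pilot length nor the normalised traces need converge. The SINR and its equivalent are therefore
  compared as quotients whose numerators and denominators approach each other, which requires a
  positive lower bound for the denominators of the equivalent. Dividing the SINR through by
  \<open>pr\<close>, \<open>K\<close> and the squared norm of the row makes the interference a
  constant multiple of 1 / (K |r|^2) and turns the noise into 1 / (pr K), which vanishes. The row is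
  a nonlinear function of \<open>G\<close>; conditioning removes this obstacle. The projection of
  column \<open>k\<close> is a quadratic form once the other columns are fixed, and the delay errors
  enter through one once all of \<open>G\<close> is fixed. Delay errors of different cells share
  pilot residuals and are in general dependent, but a separate estimate for each of the finitely
  many cells suffices. The Bessel bound supplies |\<alpha>| \<le> 1, without which the innovation
  variance (1 - \<alpha>^2) \<beta> would be negative.\<close>

lemma bessel_series_converges:
  fixes t :: real
  shows "summable (\<lambda>r. ((-1) ^ r / (fact r)\<^sup>2) * t ^ r)"
proof (rule summable_comparison_test'[where N = 0 and g = "\<lambda>r. inverse (fact r) * \<bar>t\<bar> ^ r"])
  show "summable (\<lambda>r. inverse (fact r) * \<bar>t\<bar> ^ r)"
    by (rule summable_exp)
  fix r :: nat
  have "1 \<le> (fact r :: real)" by (rule fact_ge_1)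
  then have "inverse ((fact r)\<^sup>2) \<le> inverse (fact r :: real)"
    by (intro le_imp_inverse_le) (auto simp: power2_eq_square)
  then show "norm (((-1) ^ r / (fact r)\<^sup>2) * t ^ r) \<le> inverse (fact r) * \<bar>t\<bar> ^ r"
    by (simp add: abs_mult power_abs divide_inverse mult_right_mono)
qed

text \<open>With \<open>t = (x / 2)\<^sup>2\<close>, Bessel's equation becomes \<open>t f'' + f' + f = 0\<close>, and the energy
  \<open>f\<^sup>2 + t f'\<^sup>2\<close> has derivative \<open>- f'\<^sup>2\<close>.\<close>

lemma abs_bessel_J0_le_1: "\<bar>bessel_J0 x\<bar> \<le> 1"
proof -
  define c :: "nat \<Rightarrow> real" where "c r = (-1) ^ r / (fact r)\<^sup>2" for r
  define f where "f t = (\<Sum>r. c r * t ^ r)" for t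
  define f1 where "f1 t = (\<Sum>r. diffs c r * t ^ r)" for t
  define f2 where "f2 t = (\<Sum>r. diffs (diffs c) r * t ^ r)" for t
  have s: "summable (\<lambda>r. c r * t ^ r)" for t
    using bessel_series_converges[of t] by (simp add: c_def)
  have s1: "summable (\<lambda>r. diffs c r * t ^ r)" for t
    by (rule termdiff_converges_all[OF s])
  have s2: "summable (\<lambda>r. diffs (diffs c) r * t ^ r)" for t
    by (rule termdiff_converges_all[OF s1])
  have d: "(f has_real_derivative f1 t) (at t)" for t
    unfolding f_def f1_def by (rule termdiffs_strong_converges_everywhere[OF s])
  have d1: "(f1 has_real_derivative f2 t) (at t)" for t
    unfolding f1_def f2_def by (rule termdiffs_strong_converges_everywhere[OF s1])
  have ode: "t * f2 t + f1 t + f t = 0" for t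
  proof -
    have a: "(\<lambda>r. c r * t ^ r) sums f t" "(\<lambda>r. diffs c r * t ^ r) sums f1 t"
      using summable_sums[OF s] summable_sums[OF s1] by (auto simp: f_def f1_def)
    \<comment> \<open>Multiplication by \<open>t\<close> shifts the index: the coefficient of
      \<open>t ^ r\<close> in \<open>t * f2 t\<close> is \<open>r * diffs c r\<close>, and the term
      for \<open>r = 0\<close> vanishes.\<close>
    have "(\<lambda>r. t * (diffs (diffs c) r * t ^ r)) sums (t * f2 t)"
      using summable_sums[OF s2] by (auto simp: f2_def intro: sums_mult)
    then have "(\<lambda>r. real (Suc r) * diffs c (Suc r) * t ^ Suc r) sums (t * f2 t)"
      by (simp add: diffs_def ac_simps)
    then have "(\<lambda>r. real r * diffs c r * t ^ r) sums (t * f2 t)"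
      by (subst (asm) sums_Suc_iff) simp
    from sums_add[OF sums_add[OF this a(2)] a(1)]
    have "(\<lambda>r. real r * diffs c r * t ^ r + diffs c r * t ^ r + c r * t ^ r) sums
      (t * f2 t + f1 t + f t)" .
    moreover have "real r * diffs c r * t ^ r + diffs c r * t ^ r + c r * t ^ r = 0" for r
    proof -
      \<comment> \<open>The recurrence of the Bessel coefficients, which is the equation read off at
        \<open>t ^ r\<close>.\<close>
      have "c (Suc r) * (real (Suc r))\<^sup>2 = - c r"
        by (simp add: c_def power_mult_distrib field_simps del: of_nat_Suc)
      then have "real r * diffs c r + diffs c r + c r = 0"
        by (simp add: diffs_def power2_eq_square algebra_simps)
      then show ?thesis
        by (metis distrib_right mult_zero_left)
    qed
    ultimately show ?thesis
      using sums_unique2[OF _ sums_zero] by auto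
  qed
  have f0: "f 0 = 1"
    using powser_zero[of c] by (simp add: f_def c_def)
  define t where "t = (x / 2)\<^sup>2"
  have "(f t)\<^sup>2 + t * (f1 t)\<^sup>2 \<le> (f 0)\<^sup>2 + 0 * (f1 0)\<^sup>2"
  proof (rule DERIV_nonpos_imp_nonincreasing[where f = "\<lambda>t. (f t)\<^sup>2 + t * (f1 t)\<^sup>2"])
    show "0 \<le> t" by (simp add: t_def)
    fix y
    have "((\<lambda>t. (f t)\<^sup>2 + t * (f1 t)\<^sup>2) has_real_derivative
        2 * f y * f1 y + ((f1 y)\<^sup>2 + y * (2 * f1 y * f2 y))) (at y)"
      by (auto intro!: derivative_eq_intros d d1 simp: power2_eq_square)
    moreover have "2 * f y * f1 y + ((f1 y)\<^sup>2 + y * (2 * f1 y * f2 y)) =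
        2 * f1 y * (y * f2 y + f1 y + f y) - (f1 y)\<^sup>2"
      by (simp add: power2_eq_square algebra_simps)
    ultimately show "\<exists>z. ((\<lambda>t. (f t)\<^sup>2 + t * (f1 t)\<^sup>2) has_real_derivative z) (at y) \<and> z \<le> 0"
      by (intro exI[of _ "- (f1 y)\<^sup>2"]) (simp add: ode)
  qed
  moreover have "0 \<le> t * (f1 t)\<^sup>2" by (simp add: t_def)
  ultimately have "(f t)\<^sup>2 \<le> 1" by (simp add: f0)
  moreover have "bessel_J0 x = f t"
    by (simp add: bessel_J0_def f_def c_def t_def power_mult)
  ultimately show ?thesis
    by (simp add: abs_square_le_1)
qed

section \<open>Circularly symmetric complex Gaussian law\<close>

abbreviation std_normal :: "real measure" where
  "std_normal \<equiv> density lborel (\<lambda>x. ennreal (std_normal_density x))"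

lemma prob_space_std_normal: "prob_space std_normal"
  by (rule prob_space_normal_density) simp

lemma nn_integral_std_normal:
  assumes [measurable]: "f \<in> borel_measurable borel"
  shows "(\<integral>\<^sup>+x. f x \<partial>std_normal) = (\<integral>\<^sup>+x. ennreal (std_normal_density x) * f x \<partial>lborel)"
  by (rule nn_integral_density) auto

lemma std_normal_density_rotation:
  fixes a b :: real
  assumes "a\<^sup>2 + b\<^sup>2 = 1"
  shows "std_normal_density (a * x - b * y) * std_normal_density (b * x + a * y) =
    std_normal_density x * std_normal_density y"
proof -
  have "(a * x - b * y)\<^sup>2 + (b * x + a * y)\<^sup>2 = (a\<^sup>2 + b\<^sup>2) * (x\<^sup>2 + y\<^sup>2)"
    by (simp add: power2_eq_square algebra_simps)
  then show ?thesis
    using assms by (simp add: std_normal_density_def mult_exp_exp add_divide_distrib[symmetric])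
qed

text \<open>Two affine substitutions on the line and two exchanges of integrals replace a planar
  change of variables: u = a x + b y at fixed y, then v = (y - b u) / a at fixed u. The Jacobians 1
  / |a| and |a| cancel; the division is the reason for \<open>a \<noteq> 0\<close>.\<close>

lemma nn_integral_std_normal_rotation:
  fixes a b :: real
  assumes ab: "a\<^sup>2 + b\<^sup>2 = 1" and a: "a \<noteq> 0"
    and f [measurable]: "(\<lambda>(x, y). f x y) \<in> borel_measurable (borel \<Otimes>\<^sub>M borel)"
  shows "(\<integral>\<^sup>+x. \<integral>\<^sup>+y. f (a * x + b * y) (a * y - b * x) \<partial>std_normal \<partial>std_normal) =
    (\<integral>\<^sup>+x. \<integral>\<^sup>+y. f x y \<partial>std_normal \<partial>std_normal)"
proof -
  let ?\<phi> = std_normal_density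
  let ?g = "\<lambda>x y. ennreal (?\<phi> x * ?\<phi> y)"
  have [measurable]: "(\<lambda>x. f (u x) (w x)) \<in> borel_measurable N"
    if [measurable]: "u \<in> borel_measurable N" "w \<in> borel_measurable N" for u w and N :: "'z measure"
    using measurable_compose[OF measurable_Pair[OF that] f] by simp
  have dens: "(\<integral>\<^sup>+x. \<integral>\<^sup>+y. h x y \<partial>std_normal \<partial>std_normal) =
      (\<integral>\<^sup>+x. \<integral>\<^sup>+y. ?g x y * h x y \<partial>lborel \<partial>lborel)"
    if [measurable]: "(\<lambda>(x, y). h x y) \<in> borel_measurable (borel \<Otimes>\<^sub>M borel)" for h :: "real \<Rightarrow> real \<Rightarrow> ennreal"
  proof -
    have [measurable]: "h x \<in> borel_measurable borel" for x
      using measurable_compose[OF measurable_Pair1' that, of x] by simp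
    have "(\<lambda>x. \<integral>\<^sup>+y. ennreal (?\<phi> y) * h x y \<partial>lborel) \<in> borel_measurable borel"
      by measurable
    then show ?thesis
      by (simp add: nn_integral_density ennreal_mult'' nn_integral_cmult[symmetric] mult.assoc)
  qed
  have "(\<integral>\<^sup>+x. \<integral>\<^sup>+y. f (a * x + b * y) (a * y - b * x) \<partial>std_normal \<partial>std_normal) =
      (\<integral>\<^sup>+x. \<integral>\<^sup>+y. ?g x y * f (a * x + b * y) (a * y - b * x) \<partial>lborel \<partial>lborel)"
    by (rule dens) measurable
  also have "\<dots> = (\<integral>\<^sup>+y. \<integral>\<^sup>+x. ?g x y * f (a * x + b * y) (a * y - b * x) \<partial>lborel \<partial>lborel)"
    by (rule lborel_pair.Fubini') measurable
  also have "\<dots> = (\<integral>\<^sup>+y. \<integral>\<^sup>+u. ennreal \<bar>1 / a\<bar> * (?g (- (b * y / a) + 1 / a * u) y *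
      f u (y / a - b * u / a)) \<partial>lborel \<partial>lborel)"
  proof (rule nn_integral_cong)
    fix y
    have e: "a * (- (b * y / a) + 1 / a * u) + b * y = u"
      "a * y - b * (- (b * y / a) + 1 / a * u) = y / a - b * u / a" for u
    proof -
      show "a * (- (b * y / a) + 1 / a * u) + b * y = u" using a by (simp add: field_simps)
      have "a * y - b * (- (b * y / a) + 1 / a * u) = (a\<^sup>2 + b\<^sup>2) * y / a - b * u / a"
        using a by (simp add: field_simps power2_eq_square)
      then show "a * y - b * (- (b * y / a) + 1 / a * u) = y / a - b * u / a" by (simp add: ab)
    qed
    show "(\<integral>\<^sup>+x. ?g x y * f (a * x + b * y) (a * y - b * x) \<partial>lborel) =
      (\<integral>\<^sup>+u. ennreal \<bar>1 / a\<bar> * (?g (- (b * y / a) + 1 / a * u) y * f u (y / a - b * u / a)) \<partial>lborel)"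
    proof (subst nn_integral_real_affine[where c = "1 / a" and t = "- (b * y / a)"])
      show "1 / a \<noteq> 0" using a by simp
      show "ennreal \<bar>1 / a\<bar> * (\<integral>\<^sup>+u. ?g (- (b * y / a) + 1 / a * u) y *
          f (a * (- (b * y / a) + 1 / a * u) + b * y) (a * y - b * (- (b * y / a) + 1 / a * u)) \<partial>lborel) =
        (\<integral>\<^sup>+u. ennreal \<bar>1 / a\<bar> * (?g (- (b * y / a) + 1 / a * u) y * f u (y / a - b * u / a)) \<partial>lborel)"
        unfolding e by (rule nn_integral_cmult[symmetric]) measurable
    qed measurable
  qed
  also have "\<dots> = (\<integral>\<^sup>+u. \<integral>\<^sup>+y. ennreal \<bar>1 / a\<bar> * (?g (- (b * y / a) + 1 / a * u) y *
      f u (y / a - b * u / a)) \<partial>lborel \<partial>lborel)"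
    by (rule lborel_pair.Fubini') measurable
  also have "\<dots> = (\<integral>\<^sup>+u. \<integral>\<^sup>+v. ?g u v * f u v \<partial>lborel \<partial>lborel)"
  proof (rule nn_integral_cong)
    fix u
    \<comment> \<open>After the second substitution the density product is the one of the rotated
      point (a u - b v, b u + a v).\<close>
    have e: "- (b * (b * u + a * v) / a) + 1 / a * u = a * u - b * v"
      "(b * u + a * v) / a - b * u / a = v" for v
    proof -
      have "- (b * (b * u + a * v) / a) + 1 / a * u = ((a\<^sup>2 + b\<^sup>2 - b\<^sup>2) * u - a * b * v) / a"
        unfolding ab using a by (simp add: field_simps power2_eq_square)
      then show "- (b * (b * u + a * v) / a) + 1 / a * u = a * u - b * v"
        using a by (simp add: field_simps power2_eq_square)
      show "(b * u + a * v) / a - b * u / a = v" using a by (simp add: field_simps)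
    qed
    have c: "ennreal \<bar>a\<bar> * (ennreal \<bar>1 / a\<bar> * z) = z" for z
      using a by (simp add: mult.assoc[symmetric] ennreal_mult'[symmetric] abs_mult[symmetric])
    show "(\<integral>\<^sup>+y. ennreal \<bar>1 / a\<bar> * (?g (- (b * y / a) + 1 / a * u) y *
      f u (y / a - b * u / a)) \<partial>lborel) = (\<integral>\<^sup>+v. ?g u v * f u v \<partial>lborel)"
    proof (subst nn_integral_real_affine[where c = a and t = "b * u"])
      show "a \<noteq> 0" by (rule a)
      show "ennreal \<bar>a\<bar> * (\<integral>\<^sup>+v. ennreal \<bar>1 / a\<bar> * (?g (- (b * (b * u + a * v) / a) + 1 / a * u) (b * u + a * v) *
          f u ((b * u + a * v) / a - b * u / a)) \<partial>lborel) = (\<integral>\<^sup>+v. ?g u v * f u v \<partial>lborel)"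
        unfolding e std_normal_density_rotation[OF ab]
        by (subst nn_integral_cmult[symmetric], measurable) (simp only: c)
    qed measurable
  qed
  also have "\<dots> = (\<integral>\<^sup>+x. \<integral>\<^sup>+y. f x y \<partial>std_normal \<partial>std_normal)"
    by (rule dens[symmetric]) measurable
  finally show ?thesis .
qed


text \<open>The half turn; it lets a negative scaling factor be replaced by its absolute
  value.\<close>

lemma nn_integral_std_normal_symmetric:
  assumes f [measurable]: "(\<lambda>(x, y). f x y) \<in> borel_measurable (borel \<Otimes>\<^sub>M borel)"
  shows "(\<integral>\<^sup>+x. \<integral>\<^sup>+y. f (- x) (- y) \<partial>std_normal \<partial>std_normal) =
    (\<integral>\<^sup>+x. \<integral>\<^sup>+y. f x y \<partial>std_normal \<partial>std_normal)"
  using nn_integral_std_normal_rotation[OF _ _ f, of "-1" 0] by simp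

lemma mgf_std_normal:
  "(\<integral>\<^sup>+x. ennreal (exp (a * x)) \<partial>std_normal) = ennreal (exp (a\<^sup>2 / 2))"
proof -
  have "(\<integral>\<^sup>+x. ennreal (exp (a * x)) \<partial>std_normal) =
      (\<integral>\<^sup>+x. ennreal (exp (a\<^sup>2 / 2)) * ennreal (normal_density a 1 x) \<partial>lborel)"
  proof (subst nn_integral_std_normal, measurable, intro nn_integral_cong)
    fix x
    have "std_normal_density x * exp (a * x) = exp (a\<^sup>2 / 2) * normal_density a 1 x"
      by (simp add: normal_density_def mult_exp_exp power2_eq_square field_simps)
    then show "ennreal (std_normal_density x) * ennreal (exp (a * x)) =
        ennreal (exp (a\<^sup>2 / 2)) * ennreal (normal_density a 1 x)"
      by (simp add: ennreal_mult''[symmetric])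
  qed
  also have "\<dots> = ennreal (exp (a\<^sup>2 / 2)) * (\<integral>\<^sup>+x. ennreal (normal_density a 1 x) \<partial>lborel)"
    by (rule nn_integral_cmult) simp
  also have "(\<integral>\<^sup>+x. ennreal (normal_density a 1 x) \<partial>lborel) = 1"
    using prob_space.emeasure_space_1[OF prob_space_normal_density[of 1 a]]
    by (simp add: emeasure_density)
  finally show ?thesis by simp
qed

text \<open>The weight turns the standard density into \<open>\<sigma>\<close> times the centred
  normal density of variance 1 / (1 - x).\<close>

lemma mgf_square_std_normal:
  assumes "x < 1"
  shows "(\<integral>\<^sup>+y. ennreal (exp (x * y\<^sup>2 / 2)) \<partial>std_normal) = ennreal (1 / sqrt (1 - x))"
proof -
  define \<sigma> where "\<sigma> = 1 / sqrt (1 - x)"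
  have \<sigma>: "\<sigma> > 0" "\<sigma>\<^sup>2 = 1 / (1 - x)"
    using assms by (auto simp: \<sigma>_def power_divide)
  have "(\<integral>\<^sup>+y. ennreal (exp (x * y\<^sup>2 / 2)) \<partial>std_normal) =
      (\<integral>\<^sup>+y. ennreal \<sigma> * ennreal (normal_density 0 \<sigma> y) \<partial>lborel)"
  proof (subst nn_integral_std_normal, measurable, intro nn_integral_cong)
    fix y
    have "std_normal_density y * exp (x * y\<^sup>2 / 2) = \<sigma> * normal_density 0 \<sigma> y"
      using \<sigma> assms
      by (simp add: normal_density_def mult_exp_exp real_sqrt_mult real_sqrt_divide) (simp add: field_simps \<sigma>_def)
    then show "ennreal (std_normal_density y) * ennreal (exp (x * y\<^sup>2 / 2)) =
        ennreal \<sigma> * ennreal (normal_density 0 \<sigma> y)"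
      using \<sigma> by (simp add: ennreal_mult''[symmetric])
  qed
  also have "\<dots> = ennreal \<sigma> * (\<integral>\<^sup>+y. ennreal (normal_density 0 \<sigma> y) \<partial>lborel)"
    by (rule nn_integral_cmult) simp
  also have "(\<integral>\<^sup>+y. ennreal (normal_density 0 \<sigma> y) \<partial>lborel) = 1"
    using prob_space.emeasure_space_1[OF prob_space_normal_density[OF \<sigma>(1), of 0]]
    by (simp add: emeasure_density)
  finally show ?thesis by (simp add: \<sigma>_def)
qed

section \<open>The law CN(0, v): scaling, transforms, absence of atoms, rotation and
  regression\<close>

lemma measurable_Complex [measurable]:
  assumes [measurable]: "f \<in> borel_measurable M" "g \<in> borel_measurable M"
  shows "(\<lambda>x. Complex (f x) (g x)) \<in> borel_measurable M"
  unfolding Complex_eq by measurable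

lemma sets_complex_normal [simp, measurable_cong]: "sets (complex_normal v) = sets borel"
  and space_complex_normal [simp]: "space (complex_normal v) = UNIV"
  by (auto simp: complex_normal_def)

lemma prob_space_complex_normal: "prob_space (complex_normal v)"
proof -
  interpret pair_prob_space std_normal std_normal
    by (intro pair_prob_space.intro pair_sigma_finite.intro prob_space_std_normal
        prob_space_imp_sigma_finite)
  show ?thesis
    unfolding complex_normal_def by (rule prob_space_distr) measurable
qed

lemma nn_integral_complex_normal:
  assumes [measurable]: "f \<in> borel_measurable borel"
  shows "(\<integral>\<^sup>+\<xi>. f \<xi> \<partial>complex_normal v) =
    (\<integral>\<^sup>+x. \<integral>\<^sup>+y. f (complex_of_real (sqrt (v / 2)) * Complex x y) \<partial>std_normal \<partial>std_normal)"
proof -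
  interpret pair_prob_space std_normal std_normal
    by (intro pair_prob_space.intro pair_sigma_finite.intro prob_space_std_normal
        prob_space_imp_sigma_finite)
  have "(\<integral>\<^sup>+\<xi>. f \<xi> \<partial>complex_normal v) =
    (\<integral>\<^sup>+z. f (case z of (x, y) \<Rightarrow> complex_of_real (sqrt (v / 2)) * Complex x y) \<partial>(std_normal \<Otimes>\<^sub>M std_normal))"
    unfolding complex_normal_def by (rule nn_integral_distr) measurable
  then show ?thesis
    by (simp add: sigma_finite_measure.nn_integral_fst[symmetric]
        prob_space_imp_sigma_finite prob_space_std_normal)
qed

lemma nn_integral_complex_normal_scale:
  assumes [measurable]: "f \<in> borel_measurable borel"
  shows "(\<integral>\<^sup>+\<xi>. f (complex_of_real c * \<xi>) \<partial>complex_normal v) = (\<integral>\<^sup>+\<xi>. f \<xi> \<partial>complex_normal (c\<^sup>2 * v))"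
proof (cases "c \<ge> 0")
  case True
  then have e: "complex_of_real c * (complex_of_real (sqrt (v / 2)) * z) = complex_of_real (sqrt (c\<^sup>2 * v / 2)) * z" for z
    by (simp add: real_sqrt_mult real_sqrt_divide)
  show ?thesis
    by (simp add: nn_integral_complex_normal e)
next
  case False
  then have e: "complex_of_real c * (complex_of_real (sqrt (v / 2)) * Complex x y) =
      complex_of_real (sqrt (c\<^sup>2 * v / 2)) * Complex (- x) (- y)" for x y
    by (simp add: real_sqrt_mult real_sqrt_divide complex_eq_iff)
  show ?thesis
    by (simp add: nn_integral_complex_normal e)
      (rule nn_integral_std_normal_symmetric[where f = "\<lambda>x y. f (complex_of_real (sqrt (c\<^sup>2 * v / 2)) * Complex x y)"], measurable)
qed

lemma nn_integral_complex_normal_0: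
  assumes [measurable]: "f \<in> borel_measurable borel"
  shows "(\<integral>\<^sup>+\<xi>. f \<xi> \<partial>complex_normal 0) = f 0"
  using prob_space.emeasure_space_1[OF prob_space_std_normal]
  by (simp add: nn_integral_complex_normal)

text \<open>The factor 2 compensates the variance v / 2 of each real coordinate. At
  \<open>v = 1\<close> the right side is exp(|c|^2), so the exponential of a square becomes an
  average of exponentials of linear terms; the quadratic forms below rest on this.\<close>

lemma mgf_complex_normal:
  assumes "v \<ge> 0"
  shows "(\<integral>\<^sup>+\<xi>. ennreal (exp (2 * Re (c * \<xi>))) \<partial>complex_normal v) = ennreal (exp (v * (cmod c)\<^sup>2))"
proof -
  define k where "k = sqrt (v / 2)"
  have k: "k\<^sup>2 = v / 2" using assms by (simp add: k_def)
  have e: "2 * Re (c * (complex_of_real k * Complex x y)) = 2 * k * Re c * x + (- (2 * k * Im c)) * y" for x y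
    by (simp add: algebra_simps)
  have "(\<integral>\<^sup>+\<xi>. ennreal (exp (2 * Re (c * \<xi>))) \<partial>complex_normal v) =
    (\<integral>\<^sup>+x. \<integral>\<^sup>+y. ennreal (exp (2 * Re (c * (complex_of_real k * Complex x y)))) \<partial>std_normal \<partial>std_normal)"
    unfolding k_def by (rule nn_integral_complex_normal) measurable
  also have "\<dots> = (\<integral>\<^sup>+x. \<integral>\<^sup>+y. ennreal (exp (2 * k * Re c * x)) * ennreal (exp ((- (2 * k * Im c)) * y)) \<partial>std_normal \<partial>std_normal)"
    by (simp only: e exp_add ennreal_mult''[OF exp_ge_zero])
  also have "\<dots> = ennreal (exp ((2 * k * Re c)\<^sup>2 / 2)) * ennreal (exp ((- (2 * k * Im c))\<^sup>2 / 2))"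
    by (subst nn_integral_cmult, measurable, subst nn_integral_multc, measurable) (simp only: mgf_std_normal)
  also have "\<dots> = ennreal (exp (v * (cmod c)\<^sup>2))"
    by (simp add: ennreal_mult''[symmetric] mult_exp_exp cmod_power2 power_mult_distrib k algebra_simps)
  finally show ?thesis .
qed

lemma borel_measurable_cis [measurable]:
  assumes [measurable]: "f \<in> borel_measurable M"
  shows "(\<lambda>x. cis (f x)) \<in> borel_measurable M"
  unfolding cis_conv_exp by measurable

text \<open>The counterpart with exp(-|c|^2), needed for quadratic forms with a negative
  parameter.\<close>

lemma char_complex_normal:
  assumes "v \<ge> 0"
  shows "(\<integral>\<xi>. cis (2 * Re (c * \<xi>)) \<partial>complex_normal v) = complex_of_real (exp (- v * (cmod c)\<^sup>2))"
proof -
  interpret pair_prob_space std_normal std_normal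
    by (intro pair_prob_space.intro pair_sigma_finite.intro prob_space_std_normal
        prob_space_imp_sigma_finite)
  define k where "k = sqrt (v / 2)"
  have k: "k\<^sup>2 = v / 2" using assms by (simp add: k_def)
  have char: "(\<integral>x. iexp (t * x) \<partial>std_normal) = complex_of_real (exp (- (t\<^sup>2) / 2))" for t
    using fun_cong[OF char_std_normal_distribution, of t] by (simp only: char_def)
  have e: "cis (2 * Re (c * (complex_of_real k * Complex x y))) =
      iexp (2 * k * Re c * x) * iexp ((- (2 * k * Im c)) * y)" for x y
    by (simp add: cis_conv_exp mult_exp_exp algebra_simps)
  have "(\<integral>\<xi>. cis (2 * Re (c * \<xi>)) \<partial>complex_normal v) =
    (\<integral>z. (case z of (x, y) \<Rightarrow> iexp (2 * k * Re c * x) * iexp ((- (2 * k * Im c)) * y)) \<partial>(std_normal \<Otimes>\<^sub>M std_normal))"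
    unfolding complex_normal_def k_def[symmetric]
    by (subst integral_distr, measurable) (auto simp only: e intro!: Bochner_Integration.integral_cong split: prod.split)
  also have "\<dots> = (\<integral>x. \<integral>y. iexp (2 * k * Re c * x) * iexp ((- (2 * k * Im c)) * y) \<partial>std_normal \<partial>std_normal)"
  proof (rule integral_fst[symmetric])
    show "integrable (std_normal \<Otimes>\<^sub>M std_normal)
      (\<lambda>(x, y). iexp (2 * k * Re c * x) * iexp ((- (2 * k * Im c)) * y))"
      by (rule P.integrable_const_bound[where B = 1]) (auto simp: norm_mult)
  qed
  also have "\<dots> = (\<integral>x. iexp (2 * k * Re c * x) \<partial>std_normal) * (\<integral>y. iexp ((- (2 * k * Im c)) * y) \<partial>std_normal)"
    by simp
  also have "\<dots> = complex_of_real (exp (- ((2 * k * Re c)\<^sup>2) / 2)) * complex_of_real (exp (- ((- (2 * k * Im c))\<^sup>2) / 2))"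
    by (simp only: char)
  also have "\<dots> = complex_of_real (exp (- v * (cmod c)\<^sup>2))"
    unfolding of_real_mult[symmetric] mult_exp_exp
    by (simp add: cmod_power2 power_mult_distrib k algebra_simps)
  finally show ?thesis .
qed

text \<open>For \<open>v > 0\<close> the squared modulus is exponential with mean \<open>v\<close>;
  here it is the sum of two independent squares, each contributing 1 / sqrt (1 - x v).\<close>

lemma mgf_square_complex_normal:
  assumes "v \<ge> 0" "x * v < 1"
  shows "(\<integral>\<^sup>+\<xi>. ennreal (exp (x * (cmod \<xi>)\<^sup>2)) \<partial>complex_normal v) = ennreal (1 / (1 - x * v))"
proof -
  define k where "k = sqrt (v / 2)"
  have k: "k\<^sup>2 = v / 2" using assms by (simp add: k_def)
  have "x * (cmod (complex_of_real k * Complex a b))\<^sup>2 = x * v * a\<^sup>2 / 2 + x * v * b\<^sup>2 / 2" for a b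
    by (simp add: norm_mult power_mult_distrib k cmod_power2 algebra_simps)
  then have "(\<integral>\<^sup>+\<xi>. ennreal (exp (x * (cmod \<xi>)\<^sup>2)) \<partial>complex_normal v) =
    (\<integral>\<^sup>+a. \<integral>\<^sup>+b. ennreal (exp (x * v * a\<^sup>2 / 2)) * ennreal (exp (x * v * b\<^sup>2 / 2)) \<partial>std_normal \<partial>std_normal)"
    by (simp add: nn_integral_complex_normal k_def[symmetric] exp_add ennreal_mult'')
  also have "\<dots> = ennreal (1 / sqrt (1 - x * v)) * ennreal (1 / sqrt (1 - x * v))"
    using mgf_square_std_normal[OF assms(2)] by (simp add: nn_integral_cmult nn_integral_multc)
  also have "\<dots> = ennreal (1 / (1 - x * v))"
    using assms by (simp add: ennreal_mult''[symmetric])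
  finally show ?thesis .
qed

text \<open>Already the imaginary part meets a prescribed value with probability 0. The induction on
  leading minors uses this to exclude the one bad value of a corner entry.\<close>

lemma emeasure_complex_normal_singleton:
  assumes "v > 0"
  shows "emeasure (complex_normal v) {z} = 0"
proof -
  define k where "k = sqrt (v / 2)"
  have k: "k > 0" using assms by (simp add: k_def)
  have "emeasure (complex_normal v) {z} = (\<integral>\<^sup>+\<xi>. indicator {z} \<xi> \<partial>complex_normal v)"
    by simp
  also have "\<dots> = (\<integral>\<^sup>+x. \<integral>\<^sup>+y. indicator {z} (complex_of_real k * Complex x y) \<partial>std_normal \<partial>std_normal)"
    by (subst nn_integral_complex_normal) (auto simp: k_def)
  also have "\<dots> \<le> (\<integral>\<^sup>+x. \<integral>\<^sup>+y. indicator {Im z / k} y \<partial>std_normal \<partial>std_normal)"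
    using k by (intro nn_integral_mono) (auto simp: indicator_def complex_eq_iff field_simps)
  also have "(\<integral>\<^sup>+y. indicator {Im z / k} y \<partial>std_normal) = 0"
    by (simp add: emeasure_density)
  finally show ?thesis by simp
qed

text \<open>A real rotation acts separately on the pair of real parts and on the pair of imaginary
  parts, so exchanging the two middle integrals reduces the claim to two planar rotations.\<close>

lemma nn_integral_complex_normal_rotation:
  fixes a b :: real
  assumes ab: "a\<^sup>2 + b\<^sup>2 = 1" and a: "a \<noteq> 0"
    and f: "(\<lambda>(\<xi>, \<eta>). f \<xi> \<eta>) \<in> borel_measurable (borel \<Otimes>\<^sub>M borel)"
  shows "(\<integral>\<^sup>+\<xi>. \<integral>\<^sup>+\<eta>. f (complex_of_real a * \<xi> + complex_of_real b * \<eta>)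
      (complex_of_real a * \<eta> - complex_of_real b * \<xi>) \<partial>complex_normal v \<partial>complex_normal v) =
    (\<integral>\<^sup>+\<xi>. \<integral>\<^sup>+\<eta>. f \<xi> \<eta> \<partial>complex_normal v \<partial>complex_normal v)"
proof -
  interpret N: prob_space "complex_normal v" by (rule prob_space_complex_normal)
  interpret pair_prob_space std_normal std_normal
    by (intro pair_prob_space.intro pair_sigma_finite.intro prob_space_std_normal
        prob_space_imp_sigma_finite)
  have [measurable]: "(\<lambda>x. f (u x) (w x)) \<in> borel_measurable N"
    if [measurable]: "u \<in> borel_measurable N" "w \<in> borel_measurable N" for u w and N :: "'z measure"
    using measurable_compose[OF measurable_Pair[OF that] f] by simp
  define k where "k = sqrt (v / 2)"
  define g where "g x1 y1 x2 y2 = f (complex_of_real k * Complex x1 y1) (complex_of_real k * Complex x2 y2)"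
    for x1 y1 x2 y2
  have [measurable]: "(\<lambda>x. g (u1 x) (u2 x) (u3 x) (u4 x)) \<in> borel_measurable N"
    if [measurable]: "u1 \<in> borel_measurable N" "u2 \<in> borel_measurable N"
      "u3 \<in> borel_measurable N" "u4 \<in> borel_measurable N" for u1 u2 u3 u4 and N :: "'z measure"
    unfolding g_def by measurable
  have e: "f (complex_of_real a * (complex_of_real k * Complex x1 y1) + complex_of_real b * (complex_of_real k * Complex x2 y2))
      (complex_of_real a * (complex_of_real k * Complex x2 y2) - complex_of_real b * (complex_of_real k * Complex x1 y1)) =
      g (a * x1 + b * x2) (a * y1 + b * y2) (a * x2 - b * x1) (a * y2 - b * y1)" for x1 x2 y1 y2
    unfolding g_def by (rule arg_cong2[where f = f]) (auto simp: complex_eq_iff algebra_simps)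
  have "(\<integral>\<^sup>+\<xi>. \<integral>\<^sup>+\<eta>. f (complex_of_real a * \<xi> + complex_of_real b * \<eta>)
      (complex_of_real a * \<eta> - complex_of_real b * \<xi>) \<partial>complex_normal v \<partial>complex_normal v) =
      (\<integral>\<^sup>+x1. \<integral>\<^sup>+y1. \<integral>\<^sup>+x2. \<integral>\<^sup>+y2. g (a * x1 + b * x2) (a * y1 + b * y2) (a * x2 - b * x1) (a * y2 - b * y1)
        \<partial>std_normal \<partial>std_normal \<partial>std_normal \<partial>std_normal)"
    by (subst nn_integral_complex_normal, measurable, subst nn_integral_complex_normal, measurable)
      (simp only: k_def[symmetric] e)
  also have "\<dots> = (\<integral>\<^sup>+x1. \<integral>\<^sup>+x2. \<integral>\<^sup>+y1. \<integral>\<^sup>+y2. g (a * x1 + b * x2) (a * y1 + b * y2) (a * x2 - b * x1) (a * y2 - b * y1)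
        \<partial>std_normal \<partial>std_normal \<partial>std_normal \<partial>std_normal)"
    by (rule nn_integral_cong, rule Fubini') measurable
  also have "\<dots> = (\<integral>\<^sup>+x1. \<integral>\<^sup>+x2. \<integral>\<^sup>+y1. \<integral>\<^sup>+y2. g (a * x1 + b * x2) y1 (a * x2 - b * x1) y2
        \<partial>std_normal \<partial>std_normal \<partial>std_normal \<partial>std_normal)"
    by (rule nn_integral_cong, rule nn_integral_cong, rule nn_integral_std_normal_rotation[OF ab a]) measurable
  also have "\<dots> = (\<integral>\<^sup>+x1. \<integral>\<^sup>+x2. \<integral>\<^sup>+y1. \<integral>\<^sup>+y2. g x1 y1 x2 y2
        \<partial>std_normal \<partial>std_normal \<partial>std_normal \<partial>std_normal)"
    by (rule nn_integral_std_normal_rotation[OF ab a,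
          where f = "\<lambda>p q. \<integral>\<^sup>+y1. \<integral>\<^sup>+y2. g p y1 q y2 \<partial>std_normal \<partial>std_normal"]) measurable
  also have "\<dots> = (\<integral>\<^sup>+x1. \<integral>\<^sup>+y1. \<integral>\<^sup>+x2. \<integral>\<^sup>+y2. g x1 y1 x2 y2
        \<partial>std_normal \<partial>std_normal \<partial>std_normal \<partial>std_normal)"
    by (rule nn_integral_cong, rule Fubini') measurable
  also have "\<dots> = (\<integral>\<^sup>+x1. \<integral>\<^sup>+y1. \<integral>\<^sup>+\<eta>. f (complex_of_real k * Complex x1 y1) \<eta> \<partial>complex_normal v \<partial>std_normal \<partial>std_normal)"
    unfolding g_def k_def
    by (rule nn_integral_cong, rule nn_integral_cong, rule nn_integral_complex_normal[symmetric]) measurable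
  also have "\<dots> = (\<integral>\<^sup>+\<xi>. \<integral>\<^sup>+\<eta>. f \<xi> \<eta> \<partial>complex_normal v \<partial>complex_normal v)"
    unfolding k_def by (rule nn_integral_complex_normal[symmetric]) measurable
  finally show ?thesis .
qed

text \<open>The sum and its regression residual are independent: after normalisation to unit
  variance they are multiples of the two coordinates rotated by (sqrt b, sqrt s) / sqrt (b +
  s).\<close>

lemma nn_integral_complex_normal_regression:
  fixes b s :: real
  assumes b: "b > 0" and s: "s > 0"
    and f: "(\<lambda>(\<xi>, \<eta>). f \<xi> \<eta>) \<in> borel_measurable (borel \<Otimes>\<^sub>M borel)"
  shows "(\<integral>\<^sup>+\<xi>. \<integral>\<^sup>+\<eta>. f (\<xi> + \<eta>) (\<xi> - complex_of_real (b / (b + s)) * (\<xi> + \<eta>))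
      \<partial>complex_normal s \<partial>complex_normal b) =
    (\<integral>\<^sup>+w. \<integral>\<^sup>+u. f w u \<partial>complex_normal (b * s / (b + s)) \<partial>complex_normal (b + s))"
proof -
  interpret N: prob_space "complex_normal v" for v by (rule prob_space_complex_normal)
  have [measurable]: "(\<lambda>x. f (u x) (w x)) \<in> borel_measurable N"
    if [measurable]: "u \<in> borel_measurable N" "w \<in> borel_measurable N" for u w and N :: "'z measure"
    using measurable_compose[OF measurable_Pair[OF that] f] by simp
  define r where "r = sqrt (b + s)"
  define A where "A = sqrt b / r"
  define B where "B = sqrt s / r"
  \<comment> \<open>The residual is a negative multiple of the second rotated coordinate; its
    variance is \<open>c\<^sup>2\<close>.\<close>
  define c where "c = - (sqrt b * sqrt s / r)"
  have r: "r > 0" "r\<^sup>2 = b + s" using b s by (auto simp: r_def)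
  have A: "A\<^sup>2 + B\<^sup>2 = 1" "A \<noteq> 0"
    using b s r by (auto simp: A_def B_def power_divide add_divide_distrib[symmetric])
  have rA: "r * A = sqrt b" "r * B = sqrt s" using r by (auto simp: A_def B_def)
  have cA: "c * A = - (b * sqrt s / (b + s))" "c * B = - (s * sqrt b / (b + s))"
    using r b s by (auto simp: c_def A_def B_def field_simps power2_eq_square[symmetric])
  have e1: "complex_of_real (sqrt b) * \<xi> + complex_of_real (sqrt s) * \<eta> =
      complex_of_real r * (complex_of_real A * \<xi> + complex_of_real B * \<eta>)" for \<xi> \<eta>
    by (simp add: rA[symmetric] algebra_simps)
  have e2: "complex_of_real (sqrt b) * \<xi> - complex_of_real (b / (b + s)) * (complex_of_real (sqrt b) * \<xi> + complex_of_real (sqrt s) * \<eta>) =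
      complex_of_real c * (complex_of_real A * \<eta> - complex_of_real B * \<xi>)" for \<xi> \<eta>
  proof -
    have "sqrt b - b / (b + s) * sqrt b = - (c * B)"
      unfolding cA using b s by (simp add: field_simps)
    moreover have "- (b / (b + s) * sqrt s) = c * A"
      by (simp add: cA)
    ultimately have "complex_of_real (sqrt b - b / (b + s) * sqrt b) * \<xi> + complex_of_real (- (b / (b + s) * sqrt s)) * \<eta> =
       complex_of_real (- (c * B)) * \<xi> + complex_of_real (c * A) * \<eta>" by simp
    then show ?thesis
      by (simp add: algebra_simps)
  qed
  have "(\<integral>\<^sup>+\<xi>. \<integral>\<^sup>+\<eta>. f (\<xi> + \<eta>) (\<xi> - complex_of_real (b / (b + s)) * (\<xi> + \<eta>))
      \<partial>complex_normal s \<partial>complex_normal b) =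
    (\<integral>\<^sup>+\<xi>. \<integral>\<^sup>+\<eta>. f (complex_of_real (sqrt b) * \<xi> + complex_of_real (sqrt s) * \<eta>)
      (complex_of_real (sqrt b) * \<xi> - complex_of_real (b / (b + s)) * (complex_of_real (sqrt b) * \<xi> + complex_of_real (sqrt s) * \<eta>))
      \<partial>complex_normal 1 \<partial>complex_normal 1)"
  proof -
    have scale: "(\<integral>\<^sup>+\<xi>. g \<xi> \<partial>complex_normal v) = (\<integral>\<^sup>+\<xi>. g (complex_of_real (sqrt v) * \<xi>) \<partial>complex_normal 1)"
      if "v \<ge> 0" "g \<in> borel_measurable borel" for v and g :: "complex \<Rightarrow> ennreal"
      using that by (subst nn_integral_complex_normal_scale) auto
    show ?thesis
      by (rule trans[OF scale[of b]], use b in simp, measurable, rule nn_integral_cong,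
          rule trans[OF scale[of s]], use s in simp, measurable)
  qed
  also have "\<dots> = (\<integral>\<^sup>+\<xi>. \<integral>\<^sup>+\<eta>. f (complex_of_real r * (complex_of_real A * \<xi> + complex_of_real B * \<eta>))
      (complex_of_real c * (complex_of_real A * \<eta> - complex_of_real B * \<xi>)) \<partial>complex_normal 1 \<partial>complex_normal 1)"
    by (simp only: e2, simp only: e1)
  also have "\<dots> = (\<integral>\<^sup>+\<xi>. \<integral>\<^sup>+\<eta>. f (complex_of_real r * \<xi>) (complex_of_real c * \<eta>) \<partial>complex_normal 1 \<partial>complex_normal 1)"
    by (rule nn_integral_complex_normal_rotation[OF A, where f = "\<lambda>\<xi> \<eta>. f (complex_of_real r * \<xi>) (complex_of_real c * \<eta>)"]) measurable
  also have "\<dots> = (\<integral>\<^sup>+\<xi>. \<integral>\<^sup>+\<eta>. f (complex_of_real r * \<xi>) \<eta> \<partial>complex_normal (c\<^sup>2 * 1) \<partial>complex_normal 1)"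
    by (rule nn_integral_cong, rule nn_integral_complex_normal_scale) measurable
  also have "\<dots> = (\<integral>\<^sup>+\<xi>. \<integral>\<^sup>+\<eta>. f \<xi> \<eta> \<partial>complex_normal (c\<^sup>2 * 1) \<partial>complex_normal (r\<^sup>2 * 1))"
    by (rule nn_integral_complex_normal_scale) measurable
  also have "c\<^sup>2 * 1 = b * s / (b + s)"
    using b s by (simp add: c_def power_divide power_mult_distrib r)
  finally show ?thesis by (simp add: r)
qed

text \<open>The regression lemma with an integrand that ignores the residual. Zero variances are
  point masses at 0 and are treated apart, since that lemma asks for positive variances.\<close>

lemma nn_integral_complex_normal_add:
  assumes v: "v \<ge> 0" and u: "u \<ge> 0" and f [measurable]: "f \<in> borel_measurable borel"
  shows "(\<integral>\<^sup>+\<xi>. \<integral>\<^sup>+\<eta>. f (\<xi> + \<eta>) \<partial>complex_normal u \<partial>complex_normal v) =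
    (\<integral>\<^sup>+w. f w \<partial>complex_normal (v + u))"
proof (cases "u = 0 \<or> v = 0")
  case True
  interpret prob_space "complex_normal u" by (rule prob_space_complex_normal)
  have "(\<lambda>\<xi>. \<integral>\<^sup>+\<eta>. f (\<xi> + \<eta>) \<partial>complex_normal u) \<in> borel_measurable borel"
    by measurable
  then show ?thesis
    using True by (auto simp: nn_integral_complex_normal_0)
next
  case False
  then show ?thesis
    using nn_integral_complex_normal_regression[of v u "\<lambda>w _. f w"] u v
      prob_space.emeasure_space_1[OF prob_space_complex_normal]
    by simp
qed

text \<open>Here \<open>\<xi> + \<eta>\<close> plays the role of the pilot observation and \<open>\<alpha> \<xi> + \<epsilon>\<close> that of the delayed channel.\<close>

lemma nn_integral_complex_normal_prediction:
  fixes b s d \<alpha> :: real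
  assumes b: "b > 0" and s: "s > 0" and d: "d \<ge> 0" and \<alpha>: "\<alpha> \<noteq> 0"
    and f: "(\<lambda>(\<xi>, \<eta>). f \<xi> \<eta>) \<in> borel_measurable (borel \<Otimes>\<^sub>M borel)"
  shows "(\<integral>\<^sup>+\<xi>. \<integral>\<^sup>+\<eta>. \<integral>\<^sup>+\<epsilon>. f (\<xi> + \<eta>) (complex_of_real \<alpha> * (\<xi> - complex_of_real (b / (b + s)) * (\<xi> + \<eta>)) + \<epsilon>)
      \<partial>complex_normal d \<partial>complex_normal s \<partial>complex_normal b) =
    (\<integral>\<^sup>+w. \<integral>\<^sup>+u. f w u \<partial>complex_normal (\<alpha>\<^sup>2 * (b * s / (b + s)) + d) \<partial>complex_normal (b + s))"
proof -
  interpret N: prob_space "complex_normal v" for v by (rule prob_space_complex_normal)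
  have [measurable]: "(\<lambda>x. f (u x) (w x)) \<in> borel_measurable N"
    if [measurable]: "u \<in> borel_measurable N" "w \<in> borel_measurable N" for u w and N :: "'z measure"
    using measurable_compose[OF measurable_Pair[OF that] f] by simp
  have "(\<integral>\<^sup>+\<xi>. \<integral>\<^sup>+\<eta>. \<integral>\<^sup>+\<epsilon>. f (\<xi> + \<eta>) (complex_of_real \<alpha> * (\<xi> - complex_of_real (b / (b + s)) * (\<xi> + \<eta>)) + \<epsilon>)
      \<partial>complex_normal d \<partial>complex_normal s \<partial>complex_normal b) =
    (\<integral>\<^sup>+w. \<integral>\<^sup>+u. \<integral>\<^sup>+\<epsilon>. f w (complex_of_real \<alpha> * u + \<epsilon>) \<partial>complex_normal d
      \<partial>complex_normal (b * s / (b + s)) \<partial>complex_normal (b + s))"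
    by (rule nn_integral_complex_normal_regression[OF b s,
          where f = "\<lambda>w u. \<integral>\<^sup>+\<epsilon>. f w (complex_of_real \<alpha> * u + \<epsilon>) \<partial>complex_normal d"]) measurable
  also have "\<dots> = (\<integral>\<^sup>+w. \<integral>\<^sup>+u. \<integral>\<^sup>+\<epsilon>. f w (u + \<epsilon>) \<partial>complex_normal d
      \<partial>complex_normal (\<alpha>\<^sup>2 * (b * s / (b + s))) \<partial>complex_normal (b + s))"
    by (rule nn_integral_cong, rule nn_integral_complex_normal_scale) measurable
  also have "\<dots> = (\<integral>\<^sup>+w. \<integral>\<^sup>+u. f w u \<partial>complex_normal (\<alpha>\<^sup>2 * (b * s / (b + s)) + d) \<partial>complex_normal (b + s))"
    using b s d \<alpha> by (intro nn_integral_cong[OF nn_integral_complex_normal_add]) auto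
  finally show ?thesis .
qed

section \<open>Quadratic forms in independent Gaussians\<close>

lemma product_prob_space_complex_normal: "product_prob_space (\<lambda>s. complex_normal (v s))"
  by (intro product_prob_spaceI prob_space_complex_normal)

lemma sets_PiM_complex_normal [measurable_cong]:
  "sets (PiM I (\<lambda>s. complex_normal (v s))) = sets (PiM I (\<lambda>_. borel))"
  by (rule sets_PiM_cong) auto

lemma mgf_linear_PiM_complex_normal:
  assumes "finite S" and v: "\<And>s. s \<in> S \<Longrightarrow> v s \<ge> 0"
  shows "(\<integral>\<^sup>+\<xi>. ennreal (exp (2 * Re (\<Sum>s\<in>S. c s * \<xi> s))) \<partial>PiM S (\<lambda>s. complex_normal (v s))) =
    ennreal (exp (\<Sum>s\<in>S. v s * (cmod (c s))\<^sup>2))"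
proof -
  interpret product_prob_space "\<lambda>s. complex_normal (v s)"
    by (rule product_prob_space_complex_normal)
  have "ennreal (exp (2 * Re (\<Sum>s\<in>S. c s * \<xi> s))) = (\<Prod>s\<in>S. ennreal (exp (2 * Re (c s * \<xi> s))))" for \<xi>
    using assms(1) by (simp add: sum_distrib_left exp_sum prod_ennreal del: times_complex.sel)
  then have "(\<integral>\<^sup>+\<xi>. ennreal (exp (2 * Re (\<Sum>s\<in>S. c s * \<xi> s))) \<partial>PiM S (\<lambda>s. complex_normal (v s))) =
      (\<integral>\<^sup>+\<xi>. (\<Prod>s\<in>S. ennreal (exp (2 * Re (c s * \<xi> s)))) \<partial>PiM S (\<lambda>s. complex_normal (v s)))"
    by (simp only:)
  also have "\<dots> = (\<Prod>s\<in>S. \<integral>\<^sup>+\<xi>. ennreal (exp (2 * Re (c s * \<xi>))) \<partial>complex_normal (v s))"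
    using assms(1) by (intro product_nn_integral_prod) auto
  also have "\<dots> = (\<Prod>s\<in>S. ennreal (exp (v s * (cmod (c s))\<^sup>2)))"
    using v by (intro prod.cong refl mgf_complex_normal)
  also have "\<dots> = ennreal (exp (\<Sum>s\<in>S. v s * (cmod (c s))\<^sup>2))"
    using assms(1) by (simp add: exp_sum prod_ennreal)
  finally show ?thesis .
qed

lemma char_linear_PiM_complex_normal:
  assumes "finite S" and v: "\<And>s. s \<in> S \<Longrightarrow> v s \<ge> 0"
  shows "(\<integral>\<xi>. cis (2 * Re (\<Sum>s\<in>S. c s * \<xi> s)) \<partial>PiM S (\<lambda>s. complex_normal (v s))) =
    complex_of_real (exp (- (\<Sum>s\<in>S. v s * (cmod (c s))\<^sup>2)))"
proof -
  interpret product_prob_space "\<lambda>s. complex_normal (v s)"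
    by (rule product_prob_space_complex_normal)
  have cis_sum: "cis (\<Sum>s\<in>S. g s) = (\<Prod>s\<in>S. cis (g s))" for g
    using assms(1) by (simp add: cis_conv_exp sum_distrib_left exp_sum)
  have "integrable (complex_normal u) (\<lambda>\<xi>. cis (2 * Re (c s * \<xi>)))" for s u
    by (rule finite_measure.integrable_const_bound[where B = 1])
      (auto simp: prob_space.finite_measure prob_space_complex_normal)
  then have "(\<integral>\<xi>. (\<Prod>s\<in>S. cis (2 * Re (c s * \<xi> s))) \<partial>PiM S (\<lambda>s. complex_normal (v s))) =
      (\<Prod>s\<in>S. \<integral>\<xi>. cis (2 * Re (c s * \<xi>)) \<partial>complex_normal (v s))"
    using assms(1) by (intro product_integral_prod)
  also have "\<dots> = (\<Prod>s\<in>S. complex_of_real (exp (- v s * (cmod (c s))\<^sup>2)))"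
    using v by (intro prod.cong refl char_complex_normal)
  also have "\<dots> = complex_of_real (exp (- (\<Sum>s\<in>S. v s * (cmod (c s))\<^sup>2)))"
    using assms(1) by (simp add: exp_sum sum_negf[symmetric] del: of_real_exp)
  finally show ?thesis
    by (simp add: sum_distrib_left cis_sum del: times_complex.sel)
qed

lemma mgf_weighted_squares_PiM_complex_normal:
  assumes T: "finite T" and d: "\<And>t. t \<in> T \<Longrightarrow> x * d t < 1"
  shows "(\<integral>\<^sup>+\<eta>. ennreal (exp (x * (\<Sum>t\<in>T. d t * (cmod (\<eta> t))\<^sup>2))) \<partial>PiM T (\<lambda>_. complex_normal 1)) =
    ennreal (\<Prod>t\<in>T. 1 / (1 - x * d t))"
proof -
  interpret product_prob_space "\<lambda>s. complex_normal 1"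
    by (rule product_prob_space_complex_normal)
  have "ennreal (exp (x * (\<Sum>t\<in>T. d t * (cmod (\<eta> t))\<^sup>2))) =
      (\<Prod>t\<in>T. ennreal (exp (x * d t * (cmod (\<eta> t))\<^sup>2)))" for \<eta>
    using T by (simp add: sum_distrib_left exp_sum prod_ennreal mult.assoc)
  moreover have "(\<integral>\<^sup>+\<eta>. (\<Prod>t\<in>T. ennreal (exp (x * d t * (cmod (\<eta> t))\<^sup>2))) \<partial>PiM T (\<lambda>_. complex_normal 1)) =
      (\<Prod>t\<in>T. \<integral>\<^sup>+\<xi>. ennreal (exp (x * d t * (cmod \<xi>)\<^sup>2)) \<partial>complex_normal 1)"
    using T by (intro product_nn_integral_prod) auto
  moreover have "\<dots> = (\<Prod>t\<in>T. ennreal (1 / (1 - x * d t)))"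
    using d by (intro prod.cong refl) (simp add: mgf_square_complex_normal)
  moreover have "\<dots> = ennreal (\<Prod>t\<in>T. 1 / (1 - x * d t))"
    using d by (intro prod_ennreal) (simp add: less_imp_le)
  ultimately show ?thesis by simp
qed

text \<open>\<open>exp (x |a|\<^sup>2)\<close> is the Gaussian average of \<open>exp (2 \<surd>x Re (a \<eta>))\<close> (of a character if \<open>x < 0\<close>);
  after exchanging the two averages, only the quadratic form in \<open>\<eta>\<close> remains, which the
  hypothesis diagonalises.\<close>

lemma mgf_quadratic_PiM_complex_normal:
  fixes u :: "'t \<Rightarrow> 's \<Rightarrow> complex" and x :: real
  assumes S: "finite S" and T: "finite T" and v: "\<And>s. s \<in> S \<Longrightarrow> v s \<ge> 0"
    and d: "\<And>t. t \<in> T \<Longrightarrow> x * d t < 1"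
    and orth: "\<And>\<eta>. (\<Sum>s\<in>S. v s * (cmod (\<Sum>t\<in>T. \<eta> t * u t s))\<^sup>2) = (\<Sum>t\<in>T. d t * (cmod (\<eta> t))\<^sup>2)"
  shows "(\<integral>\<^sup>+\<xi>. ennreal (exp (x * (\<Sum>t\<in>T. (cmod (\<Sum>s\<in>S. u t s * \<xi> s))\<^sup>2)))
      \<partial>PiM S (\<lambda>s. complex_normal (v s))) = ennreal (\<Prod>t\<in>T. 1 / (1 - x * d t))"
proof -
  let ?P = "PiM S (\<lambda>s. complex_normal (v s))" and ?Q = "PiM T (\<lambda>_. complex_normal 1)"
  let ?a = "\<lambda>\<xi> t. \<Sum>s\<in>S. u t s * \<xi> s"
  interpret P: product_prob_space "\<lambda>s. complex_normal (v s)"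
    by (rule product_prob_space_complex_normal)
  interpret Q: product_prob_space "\<lambda>_. complex_normal 1"
    by (rule product_prob_space_complex_normal)
  interpret P: prob_space ?P by (intro prob_space_PiM prob_space_complex_normal)
  interpret Q: prob_space ?Q by (intro prob_space_PiM prob_space_complex_normal)
  interpret PQ: pair_prob_space ?P ?Q ..
  define r where "r = sqrt \<bar>x\<bar>"
  have r: "r\<^sup>2 = \<bar>x\<bar>" by (simp add: r_def)
  have swap: "(\<Sum>t\<in>T. complex_of_real r * ?a \<xi> t * \<eta> t) =
      (\<Sum>s\<in>S. (complex_of_real r * (\<Sum>t\<in>T. \<eta> t * u t s)) * \<xi> s)" for \<xi> \<eta>
    unfolding sum_distrib_left sum_distrib_right by (subst sum.swap) (simp add: ac_simps)
  have A: "(\<Sum>t\<in>T. 1 * (cmod (complex_of_real r * ?a \<xi> t))\<^sup>2) = \<bar>x\<bar> * (\<Sum>t\<in>T. (cmod (?a \<xi> t))\<^sup>2)" for \<xi>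
    by (simp only: norm_mult power_mult_distrib norm_of_real power2_abs r mult_1 sum_distrib_left[where r = "\<bar>x\<bar>"])
  have B: "(\<Sum>s\<in>S. v s * (cmod (complex_of_real r * (\<Sum>t\<in>T. \<eta> t * u t s)))\<^sup>2) =
      \<bar>x\<bar> * (\<Sum>t\<in>T. d t * (cmod (\<eta> t))\<^sup>2)" for \<eta>
    unfolding orth[symmetric] sum_distrib_left[where r = "\<bar>x\<bar>"]
    by (simp only: norm_mult power_mult_distrib norm_of_real power2_abs r mult.left_commute)
  have [measurable]: "(\<lambda>z. Re (\<Sum>t\<in>T. complex_of_real r * ?a (fst z) t * snd z t)) \<in>
      borel_measurable (?P \<Otimes>\<^sub>M ?Q)"
    by measurable
  show ?thesis
  proof (cases "x \<ge> 0")
    case True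
    have "(\<integral>\<^sup>+\<xi>. ennreal (exp (x * (\<Sum>t\<in>T. (cmod (?a \<xi> t))\<^sup>2))) \<partial>?P) =
        (\<integral>\<^sup>+\<xi>. \<integral>\<^sup>+\<eta>. ennreal (exp (2 * Re (\<Sum>t\<in>T. complex_of_real r * ?a \<xi> t * \<eta> t))) \<partial>?Q \<partial>?P)"
      by (simp only: mgf_linear_PiM_complex_normal[OF T zero_le_one] A abs_of_nonneg[OF True])
    also have "\<dots> = (\<integral>\<^sup>+\<eta>. \<integral>\<^sup>+\<xi>. ennreal (exp (2 * Re (\<Sum>t\<in>T. complex_of_real r * ?a \<xi> t * \<eta> t))) \<partial>?P \<partial>?Q)"
      by (rule PQ.Fubini'[symmetric]) measurable
    also have "\<dots> = (\<integral>\<^sup>+\<eta>. ennreal (exp (x * (\<Sum>t\<in>T. d t * (cmod (\<eta> t))\<^sup>2))) \<partial>?Q)"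
      by (simp only: swap mgf_linear_PiM_complex_normal[OF S v] B abs_of_nonneg[OF True])
    finally show ?thesis
      by (simp only: mgf_weighted_squares_PiM_complex_normal[OF T d])
  next
    \<comment> \<open>For negative \<open>x\<close> the kernel is a character of modulus 1, so
      Fubini for Bochner integrals applies; both real exponentials are bounded by 1.\<close>
    case False
    have m: "(\<lambda>\<xi>. exp (x * (\<Sum>t\<in>T. (cmod (?a \<xi> t))\<^sup>2))) \<in> borel_measurable ?P"
      "(\<lambda>\<eta>. exp (x * (\<Sum>t\<in>T. d t * (cmod (\<eta> t))\<^sup>2))) \<in> borel_measurable ?Q"
      by measurable
    have nonneg: "(\<Sum>t\<in>T. d t * (cmod (\<eta> t))\<^sup>2) \<ge> 0" for \<eta>
      unfolding orth[symmetric] by (intro sum_nonneg mult_nonneg_nonneg v) auto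
    have i1: "integrable ?P (\<lambda>\<xi>. exp (x * (\<Sum>t\<in>T. (cmod (?a \<xi> t))\<^sup>2)))"
      using False m by (intro P.integrable_const_bound[where B = 1])
        (auto intro!: mult_nonpos_nonneg sum_nonneg)
    have i2: "integrable ?Q (\<lambda>\<eta>. exp (x * (\<Sum>t\<in>T. d t * (cmod (\<eta> t))\<^sup>2)))"
      using False m nonneg by (intro Q.integrable_const_bound[where B = 1])
        (auto intro!: mult_nonpos_nonneg)
    have x: "- (\<bar>x\<bar> * y) = x * y" for y using False by simp
    have "complex_of_real (\<integral>\<xi>. exp (x * (\<Sum>t\<in>T. (cmod (?a \<xi> t))\<^sup>2)) \<partial>?P) =
        (\<integral>\<xi>. complex_of_real (exp (x * (\<Sum>t\<in>T. (cmod (?a \<xi> t))\<^sup>2))) \<partial>?P)"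
      by (rule integral_complex_of_real[symmetric])
    also have "\<dots> = (\<integral>\<xi>. \<integral>\<eta>. cis (2 * Re (\<Sum>t\<in>T. complex_of_real r * ?a \<xi> t * \<eta> t)) \<partial>?Q \<partial>?P)"
      by (simp only: char_linear_PiM_complex_normal[OF T zero_le_one] A x)
    also have "\<dots> = (\<integral>\<eta>. \<integral>\<xi>. cis (2 * Re (\<Sum>t\<in>T. complex_of_real r * ?a \<xi> t * \<eta> t)) \<partial>?P \<partial>?Q)"
    proof (rule PQ.Fubini_integral[symmetric])
      show "integrable (?P \<Otimes>\<^sub>M ?Q) (\<lambda>(\<xi>, \<eta>). cis (2 * Re (\<Sum>t\<in>T. complex_of_real r * ?a \<xi> t * \<eta> t)))"
        by (rule PQ.P.integrable_const_bound[where B = 1]) (auto simp: split_beta' simp del: Re_sum)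
    qed
    also have "\<dots> = (\<integral>\<eta>. complex_of_real (exp (x * (\<Sum>t\<in>T. d t * (cmod (\<eta> t))\<^sup>2))) \<partial>?Q)"
      by (simp only: swap char_linear_PiM_complex_normal[OF S v] B x)
    also have "\<dots> = complex_of_real (\<integral>\<eta>. exp (x * (\<Sum>t\<in>T. d t * (cmod (\<eta> t))\<^sup>2)) \<partial>?Q)"
      by (rule integral_complex_of_real)
    finally have "(\<integral>\<xi>. exp (x * (\<Sum>t\<in>T. (cmod (?a \<xi> t))\<^sup>2)) \<partial>?P) =
        (\<integral>\<eta>. exp (x * (\<Sum>t\<in>T. d t * (cmod (\<eta> t))\<^sup>2)) \<partial>?Q)"
      unfolding of_real_eq_iff .
    then have "(\<integral>\<^sup>+\<xi>. ennreal (exp (x * (\<Sum>t\<in>T. (cmod (?a \<xi> t))\<^sup>2))) \<partial>?P) =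
        (\<integral>\<^sup>+\<eta>. ennreal (exp (x * (\<Sum>t\<in>T. d t * (cmod (\<eta> t))\<^sup>2))) \<partial>?Q)"
      using i1 i2 by (simp add: nn_integral_eq_integral)
    then show ?thesis
      by (simp only: mgf_weighted_squares_PiM_complex_normal[OF T d])
  qed
qed

text \<open>The constant 2 is that of the bound |ln (1 + z) - z| \<le> 2 z^2 for |z| \<le> 1 / 2,
  taken at z = -y.\<close>

lemma inverse_one_minus_le_exp:
  fixes y :: real
  assumes "\<bar>y\<bar> \<le> 1 / 2"
  shows "1 / (1 - y) \<le> exp (y + 2 * y\<^sup>2)"
proof -
  have "- ln (1 - y) \<le> y + 2 * y\<^sup>2"
    using abs_ln_one_plus_x_minus_x_bound[of "- y"] assms by (simp add: abs_le_iff)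
  then have "exp (- ln (1 - y)) \<le> exp (y + 2 * y\<^sup>2)" by simp
  then show ?thesis
    using assms by (simp add: exp_minus inverse_eq_divide)
qed

lemma mgf_centered_quadratic_PiM_complex_normal:
  fixes u :: "'t \<Rightarrow> 's \<Rightarrow> complex" and x :: real
  assumes S: "finite S" and T: "finite T" and v: "\<And>s. s \<in> S \<Longrightarrow> v s \<ge> 0"
    and d: "\<And>t. t \<in> T \<Longrightarrow> \<bar>x * d t\<bar> \<le> 1 / 2"
    and orth: "\<And>\<eta>. (\<Sum>s\<in>S. v s * (cmod (\<Sum>t\<in>T. \<eta> t * u t s))\<^sup>2) = (\<Sum>t\<in>T. d t * (cmod (\<eta> t))\<^sup>2)"
  shows "(\<integral>\<^sup>+\<xi>. ennreal (exp (x * ((\<Sum>t\<in>T. (cmod (\<Sum>s\<in>S. u t s * \<xi> s))\<^sup>2) - (\<Sum>t\<in>T. d t))))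
      \<partial>PiM S (\<lambda>s. complex_normal (v s))) \<le> ennreal (exp (2 * x\<^sup>2 * (\<Sum>t\<in>T. (d t)\<^sup>2)))"
proof -
  let ?P = "PiM S (\<lambda>s. complex_normal (v s))"
  let ?q = "\<lambda>\<xi>. \<Sum>t\<in>T. (cmod (\<Sum>s\<in>S. u t s * \<xi> s))\<^sup>2"
  have d1: "x * d t < 1" if "t \<in> T" for t
    using d[OF that] by linarith
  have "(\<integral>\<^sup>+\<xi>. ennreal (exp (x * (?q \<xi> - (\<Sum>t\<in>T. d t)))) \<partial>?P) =
      (\<integral>\<^sup>+\<xi>. ennreal (exp (- x * (\<Sum>t\<in>T. d t))) * ennreal (exp (x * ?q \<xi>)) \<partial>?P)"
    by (intro nn_integral_cong) (simp add: ennreal_mult''[symmetric] mult_exp_exp algebra_simps)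
  also have "\<dots> = ennreal (exp (- x * (\<Sum>t\<in>T. d t))) * ennreal (\<Prod>t\<in>T. 1 / (1 - x * d t))"
    by (subst nn_integral_cmult, measurable)
      (simp only: mgf_quadratic_PiM_complex_normal[OF S T v d1 orth])
  also have "\<dots> \<le> ennreal (exp (- x * (\<Sum>t\<in>T. d t))) * ennreal (\<Prod>t\<in>T. exp (x * d t + 2 * (x * d t)\<^sup>2))"
    using d d1 by (intro mult_left_mono ennreal_leI prod_mono conjI inverse_one_minus_le_exp)
      (auto simp: less_imp_le)
  also have "\<dots> = ennreal (exp (2 * x\<^sup>2 * (\<Sum>t\<in>T. (d t)\<^sup>2)))"
    using T by (simp add: ennreal_mult''[symmetric] exp_sum[symmetric] mult_exp_exp sum.distrib
        sum_distrib_left power_mult_distrib sum_negf mult.assoc)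
  finally show ?thesis .
qed

section \<open>Dual vectors and orthonormalisation\<close>

text \<open>Vectors of dimension \<open>N\<close> are functions of which only the entries below
  \<open>N\<close> count, so columns of a random array need no conversion. Conjugation sits on the
  first argument.\<close>

definition cip :: "nat \<Rightarrow> (nat \<Rightarrow> complex) \<Rightarrow> (nat \<Rightarrow> complex) \<Rightarrow> complex" where
  "cip N u w = (\<Sum>a<N. cnj (u a) * w a)"

lemma cip_cong: "(\<And>a. a < N \<Longrightarrow> u a = u' a) \<Longrightarrow> (\<And>a. a < N \<Longrightarrow> w a = w' a) \<Longrightarrow> cip N u w = cip N u' w'"
  by (auto simp: cip_def)

lemma cip_sum_right: "cip N u (\<lambda>a. \<Sum>t\<in>T. c t * w t a) = (\<Sum>t\<in>T. c t * cip N u (w t))"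
  unfolding cip_def sum_distrib_left by (subst sum.swap) (simp add: ac_simps)

lemma cip_diff_right: "cip N u (\<lambda>a. w a - w' a) = cip N u w - cip N u w'"
  by (simp add: cip_def right_diff_distrib sum_subtractf)

lemma cip_add_right: "cip N u (\<lambda>a. w a + w' a) = cip N u w + cip N u w'"
  by (simp add: cip_def distrib_left sum.distrib)

lemma cip_scale_right: "cip N u (\<lambda>a. c * w a) = c * cip N u w"
  by (simp add: cip_def sum_distrib_left ac_simps)

lemma cip_divide_right: "cip N u (\<lambda>a. w a / c) = cip N u w / c"
  by (simp add: cip_def sum_divide_distrib)

lemma cnj_cip: "cnj (cip N u w) = cip N w u"
  by (simp add: cip_def ac_simps)

lemma cip_self: "cip N u u = complex_of_real (\<Sum>a<N. (cmod (u a))\<^sup>2)"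
  by (simp add: cip_def complex_norm_square ac_simps del: of_real_power)

lemma cip_eq_0_commute: "cip N u w = 0 \<longleftrightarrow> cip N w u = 0"
  by (metis cnj_cip complex_cnj_zero_iff)

lemma cip_eq_0_right: "(\<And>a. a < N \<Longrightarrow> w a = 0) \<Longrightarrow> cip N u w = 0"
  by (simp add: cip_def)

lemma cip_self_eq_0_iff: "cip N u u = 0 \<longleftrightarrow> (\<forall>a<N. u a = 0)"
  unfolding cip_self of_real_eq_0_iff by (subst sum_nonneg_eq_0_iff) auto

text \<open>The third clause places each \<open>q t\<close> in the span of the \<open>g j\<close>
  without naming coefficients: whatever is orthogonal to all \<open>g j\<close> is orthogonal to
  \<open>q t\<close>.\<close>

definition orthonormal_expansion ::
  "nat \<Rightarrow> 'j set \<Rightarrow> ('j \<Rightarrow> nat \<Rightarrow> complex) \<Rightarrow> ('j \<Rightarrow> nat \<Rightarrow> complex) \<Rightarrow> bool" where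
  "orthonormal_expansion N J g q \<longleftrightarrow>
     (\<forall>s\<in>J. \<forall>t\<in>J. cip N (q s) (q t) = (if s = t then 1 else 0)) \<and>
     (\<forall>j\<in>J. \<forall>a<N. g j a = (\<Sum>t\<in>J. cip N (q t) (g j) * q t a)) \<and>
     (\<forall>r. (\<forall>j\<in>J. cip N r (g j) = 0) \<longrightarrow> (\<forall>t\<in>J. cip N r (q t) = 0))"

text \<open>Linear independence of the \<open>g j\<close> is expressed by a dual family.\<close>

lemma gram_schmidt_dual:
  assumes "finite J" and "\<And>i j. i \<in> J \<Longrightarrow> j \<in> J \<Longrightarrow> cip N (x j) (g i) = (if i = j then 1 else 0)"
  shows "\<exists>q. orthonormal_expansion N J g q"
  using assms
proof (induction J)
  case empty
  then show ?case by (simp add: orthonormal_expansion_def)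
next
  case (insert j J)
  have "\<exists>q. orthonormal_expansion N J g q"
    by (rule insert.IH) (simp add: insert.prems)
  then obtain q where q: "orthonormal_expansion N J g q" by blast
  have on: "cip N (q s) (q t) = (if s = t then 1 else 0)" if "s \<in> J" "t \<in> J" for s t
    using q that by (auto simp: orthonormal_expansion_def)
  have ex: "g i a = (\<Sum>t\<in>J. cip N (q t) (g i) * q t a)" if "i \<in> J" "a < N" for i a
    using q that by (auto simp: orthonormal_expansion_def)
  have kill: "cip N r (q t) = 0" if "\<And>i. i \<in> J \<Longrightarrow> cip N r (g i) = 0" "t \<in> J" for r t
    using q that by (auto simp: orthonormal_expansion_def)
  define p where "p = (\<lambda>a. g j a - (\<Sum>t\<in>J. cip N (q t) (g j) * q t a))"
  have cip_p: "cip N r p = cip N r (g j) - (\<Sum>t\<in>J. cip N (q t) (g j) * cip N r (q t))" for r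
    by (simp only: p_def cip_diff_right cip_sum_right)
  have qp: "cip N (q t) p = 0" if "t \<in> J" for t
    unfolding cip_p using insert.hyps(1) that by (simp add: on if_distrib[of "\<lambda>z. _ * z"] cong: if_cong)
  have pq: "cip N p (q t) = 0" if "t \<in> J" for t
    using qp[OF that] cip_eq_0_commute by blast
  have pg: "cip N p (g i) = 0" if "i \<in> J" for i
  proof -
    have "cip N p (g i) = cip N p (\<lambda>a. \<Sum>t\<in>J. cip N (q t) (g i) * q t a)"
      using ex[OF that] by (intro cip_cong) auto
    then show ?thesis by (simp add: cip_sum_right pq)
  qed
  \<comment> \<open>Independence enters here: the dual vector of \<open>g j\<close> annihilates the
    earlier \<open>q t\<close> and pairs to 1 with \<open>g j\<close>, so it pairs to 1 with the
    residual \<open>p\<close>, which is therefore nonzero.\<close>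
  have "cip N (x j) (q t) = 0" if "t \<in> J" for t
    using insert.hyps(2) that insert.prems by (intro kill) auto
  then have "cip N (x j) p = 1"
    using insert.prems by (simp add: cip_p)
  then have "\<not> (\<forall>a<N. p a = 0)"
    using cip_eq_0_right[of N p "x j"] by auto
  define m where "m = sqrt (\<Sum>a<N. (cmod (p a))\<^sup>2)"
  have pp: "cip N p p = complex_of_real m * complex_of_real m"
    by (simp add: cip_self m_def sum_nonneg of_real_mult[symmetric] del: of_real_mult)
  have m: "complex_of_real m \<noteq> 0"
    using \<open>\<not> (\<forall>a<N. p a = 0)\<close> pp cip_self_eq_0_iff[of N p] by auto
  \<comment> \<open>The residual pairs with \<open>g j\<close> as with itself, which gives the
    coefficient of the new basis vector in the expansion of \<open>g j\<close>.\<close>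
  have pgj: "cip N p (g j) = complex_of_real m * complex_of_real m"
    using cip_p[of p] by (simp add: pq pp)
  define q' where "q' = q(j := \<lambda>a. p a / complex_of_real m)"
  have q'j: "q' j = (\<lambda>a. p a / complex_of_real m)" and q't: "\<And>t. t \<in> J \<Longrightarrow> q' t = q t"
    using insert.hyps(2) by (auto simp: q'_def)
  have left: "cip N (\<lambda>a. p a / complex_of_real m) w = cip N p w / complex_of_real m" for w
    by (simp add: cip_def sum_divide_distrib)
  have "cip N (q' s) (q' t) = (if s = t then 1 else 0)" if "s \<in> insert j J" "t \<in> insert j J" for s t
    using that insert.hyps(2) m
    by (auto simp: q'j q't on left cip_divide_right pq qp pp)
  moreover have "g i a = (\<Sum>t\<in>insert j J. cip N (q' t) (g i) * q' t a)"
    if "i \<in> insert j J" "a < N" for i a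
  proof (cases "i = j")
    case True
    have "(\<Sum>t\<in>insert j J. cip N (q' t) (g j) * q' t a) = p a + (\<Sum>t\<in>J. cip N (q t) (g j) * q t a)"
      using insert.hyps m by (simp add: q'j q't left pgj)
    then show ?thesis by (simp add: p_def True)
  next
    case False
    then show ?thesis
      using insert.hyps that by (simp add: q'j q't left pg ex)
  qed
  moreover have "cip N r (q' t) = 0" if "\<forall>i\<in>insert j J. cip N r (g i) = 0" "t \<in> insert j J" for r t
  proof -
    have "cip N r (q s) = 0" if "s \<in> J" for s
      using \<open>\<forall>i\<in>insert j J. _ i\<close> that by (intro kill) auto
    moreover from this have "cip N r p = 0"
      using that by (simp add: cip_p)
    ultimately show ?thesis
      using that by (auto simp: q'j q't cip_divide_right)
  qed
  ultimately have "orthonormal_expansion N (insert j J) g q'"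
    unfolding orthonormal_expansion_def by blast
  then show ?case by blast
qed

text \<open>Parseval, with conjugates on the basis because the coordinate of a vector along
  \<open>q t\<close> is a linear form with coefficients \<open>cnj (q t a)\<close>. In this shape it
  discharges the diagonalisation hypothesis of
  \<open>mgf_quadratic_PiM_complex_normal\<close>.\<close>

lemma orthonormal_sum_squares:
  assumes "finite J" and on: "\<And>s t. s \<in> J \<Longrightarrow> t \<in> J \<Longrightarrow> cip N (q s) (q t) = (if s = t then 1 else 0)"
  shows "(\<Sum>a<N. (cmod (\<Sum>t\<in>J. \<eta> t * cnj (q t a)))\<^sup>2) = (\<Sum>t\<in>J. (cmod (\<eta> t))\<^sup>2)"
proof -
  let ?w = "\<lambda>a. \<Sum>t\<in>J. cnj (\<eta> t) * q t a"
  have "cip N ?w ?w = (\<Sum>t\<in>J. cnj (\<eta> t) * cip N ?w (q t))"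
    by (rule cip_sum_right)
  also have "\<dots> = (\<Sum>t\<in>J. cnj (\<eta> t) * cnj (\<Sum>s\<in>J. cnj (\<eta> s) * cip N (q t) (q s)))"
    by (simp only: cip_sum_right[symmetric] cnj_cip)
  also have "\<dots> = (\<Sum>t\<in>J. cnj (\<eta> t) * \<eta> t)"
    using assms by (intro sum.cong refl) (simp add: on if_distrib[of "\<lambda>z. _ * z"] cong: if_cong)
  also have "\<dots> = complex_of_real (\<Sum>t\<in>J. (cmod (\<eta> t))\<^sup>2)"
    by (simp add: complex_norm_square ac_simps del: of_real_power)
  finally have "(\<Sum>a<N. (cmod (?w a))\<^sup>2) = (\<Sum>t\<in>J. (cmod (\<eta> t))\<^sup>2)"
    unfolding cip_self of_real_eq_iff .
  moreover have "cmod (\<Sum>t\<in>J. \<eta> t * cnj (q t a)) = cmod (?w a)" for a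
    using complex_mod_cnj[of "?w a"] by simp
  ultimately show ?thesis by simp
qed

text \<open>The vector dual to \<open>g k\<close> is \<open>p / \<parallel>p\<parallel>\<^sup>2\<close>, where \<open>p\<close> is the component of \<open>g k\<close> orthogonal to the
  other \<open>g j\<close>.\<close>

lemma dual_vector_norm:
  assumes J: "finite J" "k \<notin> J" and q: "orthonormal_expansion N J g q"
    and dual: "\<And>j. j \<in> J \<Longrightarrow> cip N y (g j) = 0" "cip N y (g k) = 1"
    and span: "\<And>a. a < N \<Longrightarrow> y a = (\<Sum>j\<in>insert k J. c j * g j a)"
  shows "1 / (\<Sum>a<N. (cmod (y a))\<^sup>2) =
    (\<Sum>a<N. (cmod (g k a))\<^sup>2) - (\<Sum>t\<in>J. (cmod (cip N (q t) (g k)))\<^sup>2)"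
proof -
  have on: "cip N (q s) (q t) = (if s = t then 1 else 0)" if "s \<in> J" "t \<in> J" for s t
    using q that by (auto simp: orthonormal_expansion_def)
  have ex: "g i a = (\<Sum>t\<in>J. cip N (q t) (g i) * q t a)" if "i \<in> J" "a < N" for i a
    using q that by (auto simp: orthonormal_expansion_def)
  have yq: "cip N y (q t) = 0" if "t \<in> J" for t
    using q that dual by (auto simp: orthonormal_expansion_def)
  have qy: "cip N (q t) y = 0" if "t \<in> J" for t
    using yq[OF that] cip_eq_0_commute by blast
  define p where "p = (\<lambda>a. g k a - (\<Sum>t\<in>J. cip N (q t) (g k) * q t a))"
  have cip_p: "cip N r p = cip N r (g k) - (\<Sum>t\<in>J. cip N (q t) (g k) * cip N r (q t))" for r
    by (simp only: p_def cip_diff_right cip_sum_right)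
  have qp: "cip N (q t) p = 0" if "t \<in> J" for t
    unfolding cip_p using J that by (simp add: on if_distrib[of "\<lambda>z. _ * z"] cong: if_cong)
  have pq: "cip N p (q t) = 0" if "t \<in> J" for t
    using qp[OF that] cip_eq_0_commute by blast
  \<comment> \<open>\<open>b t\<close> is the coefficient of \<open>q t\<close> once every
    \<open>g j\<close> in the expansion of \<open>y\<close> is rewritten by \<open>p\<close> and the
    basis. Orthogonality of \<open>y\<close> to the other columns makes it 0, leaving
    \<open>y\<close> a multiple of \<open>p\<close>.\<close>
  define b where "b t = c k * cip N (q t) (g k) + (\<Sum>j\<in>J. c j * cip N (q t) (g j))" for t
  have y: "y a = c k * p a + (\<Sum>t\<in>J. b t * q t a)" if "a < N" for a
  proof -
    have "(\<Sum>j\<in>J. c j * g j a) = (\<Sum>j\<in>J. \<Sum>t\<in>J. c j * (cip N (q t) (g j) * q t a))"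
      using ex that by (intro sum.cong refl) (simp add: sum_distrib_left)
    also have "\<dots> = (\<Sum>t\<in>J. \<Sum>j\<in>J. c j * (cip N (q t) (g j) * q t a))"
      by (rule sum.swap)
    finally have "(\<Sum>j\<in>J. c j * g j a) = (\<Sum>t\<in>J. (\<Sum>j\<in>J. c j * cip N (q t) (g j)) * q t a)"
      by (simp add: sum_distrib_right mult.assoc)
    moreover have "y a = c k * g k a + (\<Sum>j\<in>J. c j * g j a)"
      using span[OF that] J by simp
    ultimately show ?thesis
      by (simp add: p_def b_def sum_distrib_left sum.distrib algebra_simps)
  qed
  have b: "b t = 0" if "t \<in> J" for t
  proof -
    have "cip N (q t) y = cip N (q t) (\<lambda>a. c k * p a + (\<Sum>t\<in>J. b t * q t a))"
      by (rule cip_cong) (auto simp: y)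
    also have "\<dots> = c k * cip N (q t) p + (\<Sum>s\<in>J. b s * cip N (q t) (q s))"
      by (simp only: cip_add_right cip_scale_right cip_sum_right)
    also have "\<dots> = b t"
      using J that by (simp add: qp on if_distrib[of "\<lambda>z. _ * z"] cong: if_cong)
    finally show ?thesis using qy[OF that] by simp
  qed
  have y': "y a = c k * p a" if "a < N" for a
    using y[OF that] b by simp
  define m where "m = (\<Sum>a<N. (cmod (y a))\<^sup>2)"
  \<comment> \<open>From \<open>y = c k * p\<close> and pairing 1 the factor \<open>c k\<close> is
    the squared norm \<open>m\<close> of \<open>y\<close>; comparing norms then gives m = m^2
    |p|^2.\<close>
  have "cip N y p = 1"
    using dual(2) yq by (simp add: cip_p)
  moreover have "cip N y y = c k * cip N y p"
    unfolding cip_scale_right[symmetric] by (rule cip_cong) (auto simp: y')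
  ultimately have ck: "c k = complex_of_real m"
    by (simp add: cip_self m_def)
  have "m = m\<^sup>2 * (\<Sum>a<N. (cmod (p a))\<^sup>2)"
    unfolding m_def[symmetric] sum_distrib_left
    by (subst m_def, rule sum.cong) (auto simp: y' ck norm_mult power_mult_distrib)
  moreover have "m \<noteq> 0"
    using ck \<open>cip N y p = 1\<close> y' cip_eq_0_right[of N y p] cip_eq_0_commute[of N y p] by auto
  ultimately have "1 / m = (\<Sum>a<N. (cmod (p a))\<^sup>2)"
    by (simp add: power2_eq_square field_simps)
  moreover have "complex_of_real (\<Sum>a<N. (cmod (p a))\<^sup>2) =
    complex_of_real ((\<Sum>a<N. (cmod (g k a))\<^sup>2) - (\<Sum>t\<in>J. (cmod (cip N (q t) (g k)))\<^sup>2))"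
  proof -
    have "complex_of_real (\<Sum>a<N. (cmod (p a))\<^sup>2) = cip N p (g k)"
      using cip_p[of p] pq by (simp add: cip_self)
    also have "\<dots> = cnj (cip N (g k) p)" by (simp add: cnj_cip)
    also have "\<dots> = cip N (g k) (g k) - (\<Sum>t\<in>J. cnj (cip N (q t) (g k)) * cip N (q t) (g k))"
      by (simp add: cip_p cnj_cip)
    also have "\<dots> = complex_of_real ((\<Sum>a<N. (cmod (g k a))\<^sup>2) - (\<Sum>t\<in>J. (cmod (cip N (q t) (g k)))\<^sup>2))"
      by (simp add: cip_self complex_norm_square ac_simps del: of_real_power)
    finally show ?thesis .
  qed
  ultimately show ?thesis
    unfolding of_real_eq_iff m_def by simp
qed

section \<open>Zero-forcing row\<close>

lemma mat_adjoint_carrier: "A \<in> carrier_mat n m \<Longrightarrow> mat_adjoint A \<in> carrier_mat m n"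
  by (auto simp: mat_adjoint_def)

lemma mat_adjoint_index:
  fixes A :: "complex mat"
  assumes "A \<in> carrier_mat n m" "i < m" "j < n"
  shows "mat_adjoint A $$ (i, j) = cnj (A $$ (j, i))"
  using assms by (simp add: mat_adjoint_def mat_of_rows_def)

lemma mat_adjoint_mult:
  fixes A B :: "complex mat"
  assumes "A \<in> carrier_mat n m" "B \<in> carrier_mat m p"
  shows "mat_adjoint (A * B) = mat_adjoint B * mat_adjoint A"
proof (rule eq_matI)
  note C = mat_adjoint_carrier[OF assms(1)] mat_adjoint_carrier[OF assms(2)]
    mat_adjoint_carrier[OF mult_carrier_mat[OF assms]]
  show "dim_row (mat_adjoint (A * B)) = dim_row (mat_adjoint B * mat_adjoint A)"
    "dim_col (mat_adjoint (A * B)) = dim_col (mat_adjoint B * mat_adjoint A)"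
    using C by auto
  fix i j assume "i < dim_row (mat_adjoint B * mat_adjoint A)" "j < dim_col (mat_adjoint B * mat_adjoint A)"
  then show "mat_adjoint (A * B) $$ (i, j) = (mat_adjoint B * mat_adjoint A) $$ (i, j)"
    using assms C mat_adjoint_index[OF assms(1)] mat_adjoint_index[OF assms(2)]
      mat_adjoint_index[OF mult_carrier_mat[OF assms]]
    by (auto simp: scalar_prod_def intro!: sum.cong)
qed

text \<open>\<open>G * X\<close> and \<open>G * Y\<close> are Hermitian and absorb each other, so
  taking adjoints identifies them. Evaluating \<open>X * (G * Y * G)\<close> in two ways gives
  \<open>Y * G = 1\<close>, and then Y = X G Y = X G X = X.\<close>

lemma pseudo_inverse_unique:
  assumes G: "G \<in> carrier_mat n m" and X: "is_pseudo_inverse G X" and inv: "X * G = 1\<^sub>m m"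
  shows "pseudo_inverse G = X"
  unfolding pseudo_inverse_def
proof (rule the_equality[where P = "is_pseudo_inverse G", OF X])
  fix Y assume Y: "is_pseudo_inverse G Y"
  have C: "X \<in> carrier_mat m n" "Y \<in> carrier_mat m n"
    using G X Y by (auto simp: is_pseudo_inverse_def)
  have GX: "G * X \<in> carrier_mat n n" "G * Y \<in> carrier_mat n n"
    using G C by auto
  have h: "mat_adjoint (G * X) = G * X" "mat_adjoint (G * Y) = G * Y" "G * Y * G = G" "Y * G * Y = Y"
    "X * G * X = X" "G * X * G = G"
    using X Y by (auto simp: is_pseudo_inverse_def)
  have 1: "G * X * (G * Y) = G * Y"
    using G C GX h(6) by (metis assoc_mult_mat)
  have 2: "G * Y * (G * X) = G * X"
    using G C GX h(3) by (metis assoc_mult_mat)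
  have "G * X = G * Y"
    using mat_adjoint_mult[OF GX] 1 2 h(1,2) by simp
  have "Y * G = 1\<^sub>m m"
  proof -
    have "X * (G * Y * G) = (X * G) * (Y * G)"
      using G C by (metis assoc_mult_mat mult_carrier_mat)
    then show ?thesis using G C h(3) inv by auto
  qed
  have "Y = (Y * G) * Y" using h by simp
  also have "\<dots> = X * G * Y" by (simp add: \<open>Y * G = 1\<^sub>m m\<close> inv)
  also have "\<dots> = X * (G * Y)" using G C by (metis assoc_mult_mat)
  also have "\<dots> = X * (G * X)" by (simp add: \<open>G * X = G * Y\<close>)
  also have "\<dots> = X" using G C h(5) by (metis assoc_mult_mat)
  finally show "Y = X" .
qed

text \<open>The index pair \<open>(j, a)\<close> means column \<open>j\<close>, antenna
  \<open>a\<close>, transposed against the matrix convention; variances then depend on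
  \<open>fst\<close> only.\<close>

definition gram :: "nat \<Rightarrow> nat \<Rightarrow> (nat \<times> nat \<Rightarrow> complex) \<Rightarrow> complex mat" where
  "gram K N \<omega> = Matrix.mat K K (\<lambda>(i, j). cip N (\<lambda>a. \<omega> (i, a)) (\<lambda>a. \<omega> (j, a)))"

text \<open>Row \<open>k\<close> of \<open>(G\<^sup>* G)\<^sup>-\<^sup>1 G\<^sup>*\<close>, written with the adjugate so that it depends measurably on \<open>\<omega>\<close>.\<close>

definition zf_row :: "nat \<Rightarrow> nat \<Rightarrow> nat \<Rightarrow> (nat \<times> nat \<Rightarrow> complex) \<Rightarrow> nat \<Rightarrow> complex" where
  "zf_row K N k \<omega> a = (\<Sum>j<K. adj_mat (gram K N \<omega>) $$ (k, j) / det (gram K N \<omega>) * cnj (\<omega> (j, a)))"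

context
  fixes K N :: nat and \<omega> :: "nat \<times> nat \<Rightarrow> complex"
  assumes det: "det (gram K N \<omega>) \<noteq> 0"
begin

definition "gram_inv = Matrix.mat K K (\<lambda>(i, j). adj_mat (gram K N \<omega>) $$ (i, j) / det (gram K N \<omega>))"

lemma gram_carrier: "gram K N \<omega> \<in> carrier_mat K K"
  by (simp add: gram_def)

lemma gram_inv_carrier: "gram_inv \<in> carrier_mat K K"
  by (simp add: gram_inv_def)

lemma gram_inv_mult: "gram_inv * gram K N \<omega> = 1\<^sub>m K" "gram K N \<omega> * gram_inv = 1\<^sub>m K"
proof -
  note A = adj_mat[OF gram_carrier]
  have e: "gram_inv = (1 / det (gram K N \<omega>)) \<cdot>\<^sub>m adj_mat (gram K N \<omega>)"
    using A(1) by (intro eq_matI) (auto simp: gram_inv_def)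
  show "gram_inv * gram K N \<omega> = 1\<^sub>m K" "gram K N \<omega> * gram_inv = 1\<^sub>m K"
    unfolding e mult_smult_assoc_mat[OF A(1) gram_carrier] mult_smult_distrib[OF gram_carrier A(1)] A
    using det by (intro eq_matI; simp)+
qed

text \<open>The adjoint of the inverse is a left inverse of the Hermitian Gram matrix, hence equal
  to the inverse.\<close>

lemma gram_inv_hermitian:
  assumes "i < K" "j < K"
  shows "cnj (gram_inv $$ (i, j)) = gram_inv $$ (j, i)"
proof -
  have g: "mat_adjoint (gram K N \<omega>) = gram K N \<omega>"
    using mat_adjoint_index[OF gram_carrier] mat_adjoint_carrier[OF gram_carrier]
    by (intro eq_matI) (auto simp: gram_def cnj_cip)
  have one: "mat_adjoint (1\<^sub>m K :: complex mat) = 1\<^sub>m K"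
    using mat_adjoint_index[OF one_carrier_mat, of _ K] mat_adjoint_carrier[OF one_carrier_mat, of K]
    by (intro eq_matI) auto
  have c: "mat_adjoint gram_inv \<in> carrier_mat K K"
    by (rule mat_adjoint_carrier[OF gram_inv_carrier])
  have "mat_adjoint gram_inv * gram K N \<omega> = 1\<^sub>m K"
    using mat_adjoint_mult[OF gram_carrier gram_inv_carrier] by (simp add: gram_inv_mult g one)
  then have "mat_adjoint gram_inv = gram_inv"
    using assoc_mult_mat[OF c gram_carrier gram_inv_carrier] gram_inv_mult(2) gram_inv_carrier c
    by simp
  then show ?thesis
    using mat_adjoint_index[OF gram_inv_carrier assms(2,1)] by simp
qed

lemma zf_row_eq: "k < K \<Longrightarrow> zf_row K N k \<omega> a = (\<Sum>j<K. gram_inv $$ (k, j) * cnj (\<omega> (j, a)))"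
  by (simp add: zf_row_def gram_inv_def)

text \<open>The zero-forcing property. It exhibits the conjugated rows as the dual family of the
  columns.\<close>

lemma zf_row_dual:
  assumes "k < K" "i < K"
  shows "(\<Sum>a<N. zf_row K N k \<omega> a * \<omega> (i, a)) = (if i = k then 1 else 0)"
proof -
  have "(\<Sum>a<N. zf_row K N k \<omega> a * \<omega> (i, a)) = (\<Sum>j<K. gram_inv $$ (k, j) * gram K N \<omega> $$ (j, i))"
    unfolding zf_row_eq[OF assms(1)] sum_distrib_right using assms
    by (subst sum.swap) (simp add: gram_def cip_def sum_distrib_left mult.assoc)
  also have "\<dots> = (gram_inv * gram K N \<omega>) $$ (k, i)"
    using assms gram_inv_carrier gram_carrier
    by (simp add: scalar_prod_def lessThan_atLeast0)
  finally show ?thesis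
    using assms by (simp add: gram_inv_mult)
qed

text \<open>A left inverse \<open>X\<close> of \<open>G\<close> satisfies three of the Penrose
  conditions at once; the fourth, that \<open>G * X\<close> is Hermitian, comes from the Hermitian
  inverse Gram matrix.\<close>

lemma pseudo_inverse_row:
  assumes "k < K"
  shows "Matrix.row (pseudo_inverse (Matrix.mat N K (\<lambda>(a, j). \<omega> (j, a)))) k = Matrix.vec N (zf_row K N k \<omega>)"
proof -
  define G where "G = Matrix.mat N K (\<lambda>(a, j). \<omega> (j, a))"
  define X where "X = Matrix.mat K N (\<lambda>(k, a). zf_row K N k \<omega> a)"
  have C: "G \<in> carrier_mat N K" "X \<in> carrier_mat K N"
    by (auto simp: G_def X_def)
  have XG: "X * G = 1\<^sub>m K"
    using zf_row_dual by (intro eq_matI) (auto simp: G_def X_def scalar_prod_def lessThan_atLeast0)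
  have GXC: "G * X \<in> carrier_mat N N" using C by auto
  have one: "mat_adjoint (1\<^sub>m K :: complex mat) = 1\<^sub>m K"
    using mat_adjoint_index[OF one_carrier_mat, of _ K] mat_adjoint_carrier[OF one_carrier_mat, of K]
    by (intro eq_matI) auto
  have GX: "(G * X) $$ (a, b) = (\<Sum>i<K. \<Sum>j<K. \<omega> (i, a) * gram_inv $$ (i, j) * cnj (\<omega> (j, b)))"
    if "a < N" "b < N" for a b
    using that by (simp add: G_def X_def scalar_prod_def lessThan_atLeast0 zf_row_eq sum_distrib_left mult.assoc)
  have herm: "mat_adjoint (G * X) = G * X"
  proof (rule eq_matI)
    show "dim_row (mat_adjoint (G * X)) = dim_row (G * X)" "dim_col (mat_adjoint (G * X)) = dim_col (G * X)"
      using mat_adjoint_carrier[OF GXC] GXC by auto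
    fix a b assume "a < dim_row (G * X)" "b < dim_col (G * X)"
    then have ab: "a < N" "b < N" using GXC by auto
    have "cnj ((G * X) $$ (b, a)) = (\<Sum>i<K. \<Sum>j<K. cnj (\<omega> (i, b)) * gram_inv $$ (j, i) * \<omega> (j, a))"
      using ab by (simp add: GX gram_inv_hermitian)
    also have "\<dots> = (\<Sum>j<K. \<Sum>i<K. cnj (\<omega> (i, b)) * gram_inv $$ (j, i) * \<omega> (j, a))"
      by (rule sum.swap)
    also have "\<dots> = (G * X) $$ (a, b)"
      using ab by (simp add: GX ac_simps)
    finally show "mat_adjoint (G * X) $$ (a, b) = (G * X) $$ (a, b)"
      using mat_adjoint_index[OF GXC] ab by simp
  qed
  have "G * X * G = G"
    using C XG by (metis assoc_mult_mat right_mult_one_mat)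
  then have "is_pseudo_inverse G X"
    using C XG herm one by (auto simp: is_pseudo_inverse_def)
  then have "pseudo_inverse G = X"
    using pseudo_inverse_unique[OF C(1)] XG by blast
  then show ?thesis
    using assms by (auto simp: G_def X_def)
qed

text \<open>The conjugated row is dual to column \<open>k\<close> and a combination of the columns,
  as \<open>dual_vector_norm\<close> asks. The right side separates the squared norm of column
  \<open>k\<close> from that of its projection, and each part is a Gaussian quadratic form given the
  other columns.\<close>

lemma zf_row_norm:
  assumes k: "k < K" and q: "orthonormal_expansion N ({..<K} - {k}) (\<lambda>j a. \<omega> (j, a)) q"
  shows "1 / (\<Sum>a<N. (cmod (zf_row K N k \<omega> a))\<^sup>2) =
    (\<Sum>a<N. (cmod (\<omega> (k, a)))\<^sup>2) - (\<Sum>t\<in>{..<K} - {k}. (cmod (cip N (q t) (\<lambda>a. \<omega> (k, a))))\<^sup>2)"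
proof -
  have ins: "insert k ({..<K} - {k}) = {..<K}" using k by auto
  have dual: "cip N (\<lambda>a. cnj (zf_row K N k \<omega> a)) (\<lambda>a. \<omega> (i, a)) = (if i = k then 1 else 0)" if "i < K" for i
    using zf_row_dual[OF k that] by (simp add: cip_def)
  have "1 / (\<Sum>a<N. (cmod (cnj (zf_row K N k \<omega> a)))\<^sup>2) =
    (\<Sum>a<N. (cmod (\<omega> (k, a)))\<^sup>2) - (\<Sum>t\<in>{..<K} - {k}. (cmod (cip N (q t) (\<lambda>a. \<omega> (k, a))))\<^sup>2)"
  proof (rule dual_vector_norm[OF _ _ q])
    show "cnj (zf_row K N k \<omega> a) = (\<Sum>j\<in>insert k ({..<K} - {k}). cnj (gram_inv $$ (k, j)) * \<omega> (j, a))" for a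
      unfolding ins zf_row_eq[OF k] by simp
  qed (use k in \<open>auto simp: dual\<close>)
  then show ?thesis by simp
qed

lemma zf_row_norm_pos:
  assumes "k < K"
  shows "(\<Sum>a<N. (cmod (zf_row K N k \<omega> a))\<^sup>2) > 0"
proof -
  have "\<not> (\<forall>a<N. zf_row K N k \<omega> a = 0)"
    using zf_row_dual[OF assms assms] by (metis (no_types, lifting) lessThan_iff mult_zero_left sum.neutral zero_neq_one)
  then have "(\<Sum>a<N. (cmod (zf_row K N k \<omega> a))\<^sup>2) \<noteq> 0"
    by (subst sum_nonneg_eq_0_iff) auto
  then show ?thesis
    by (simp add: less_le sum_nonneg)
qed

text \<open>Gram-Schmidt with the conjugated zero-forcing rows as dual family.\<close>

lemma orthonormal_expansion_exists:
  assumes "J \<subseteq> {..<K}" and "\<And>j a. j \<in> J \<Longrightarrow> g j a = \<omega> (j, a)"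
  shows "\<exists>q. orthonormal_expansion N J g q"
proof (rule gram_schmidt_dual[where x = "\<lambda>j a. cnj (zf_row K N j \<omega> a)"])
  show "finite J" using assms(1) by (rule finite_subset) simp
  show "cip N (\<lambda>a. cnj (zf_row K N j \<omega> a)) (g i) = (if i = j then 1 else 0)" if "i \<in> J" "j \<in> J" for i j
  proof -
    have "i < K" "j < K" using assms(1) that by auto
    then show ?thesis
      using zf_row_dual[of j i] assms(2) that by (simp add: cip_def)
  qed
qed

end

section \<open>Measurable dependence of the Gram determinant and the zero-forcing row on the
  entries\<close>

lemma borel_measurable_cnj [measurable]:
  assumes [measurable]: "f \<in> borel_measurable M"
  shows "(\<lambda>x. cnj (f x)) \<in> borel_measurable M"
proof -
  have "cnj \<in> borel_measurable borel"
    by (intro borel_measurable_continuous_onI continuous_intros)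
  then show ?thesis by (rule measurable_compose[OF assms])
qed

lemma measurable_det:
  fixes f :: "nat \<Rightarrow> nat \<Rightarrow> 'z \<Rightarrow> complex"
  assumes [measurable]: "\<And>i j. i < m \<Longrightarrow> j < m \<Longrightarrow> f i j \<in> borel_measurable M"
  shows "(\<lambda>x. det (Matrix.mat m m (\<lambda>(i, j). f i j x))) \<in> borel_measurable M"
proof -
  have "(\<lambda>x. det (Matrix.mat m m (\<lambda>(i, j). f i j x))) =
    (\<lambda>x. \<Sum>p\<in>{p. p permutes {0..<m}}. signof p * (\<Prod>i = 0..<m. f i (p i) x))"
    by (auto simp: det_def intro!: sum.cong prod.cong ext dest: permutes_in_image)
  also have "\<dots> \<in> borel_measurable M"
  proof (rule borel_measurable_sum)
    fix p assume "p \<in> {p. p permutes {0..<m}}"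
    then have "p i < m" if "i < m" for i
      using that permutes_in_image[of p "{0..<m}" i] by simp
    then have "(\<lambda>x. \<Prod>i = 0..<m. f i (p i) x) \<in> borel_measurable M"
      by (intro borel_measurable_prod assms) auto
    then show "(\<lambda>x. signof p * (\<Prod>i = 0..<m. f i (p i) x)) \<in> borel_measurable M"
      by simp
  qed
  finally show ?thesis .
qed

lemma measurable_zf_row:
  assumes k: "k < K"
  assumes f [measurable]: "\<And>j a. j < K \<Longrightarrow> a < N \<Longrightarrow> (\<lambda>x. \<omega> x (j, a)) \<in> borel_measurable M"
  shows "(\<lambda>x. det (gram K N (\<omega> x))) \<in> borel_measurable M"
    and "a < N \<Longrightarrow> (\<lambda>x. zf_row K N k (\<omega> x) a) \<in> borel_measurable M"
proof -
  have c: "(\<lambda>x. cip N (\<lambda>a. \<omega> x (i, a)) (\<lambda>a. \<omega> x (j, a))) \<in> borel_measurable M" if "i < K" "j < K" for i j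
    unfolding cip_def using f that by (intro borel_measurable_sum borel_measurable_times borel_measurable_cnj) auto
  show d: "(\<lambda>x. det (gram K N (\<omega> x))) \<in> borel_measurable M"
    unfolding gram_def by (rule measurable_det) (rule c)
  have "(\<lambda>x. adj_mat (gram K N (\<omega> x)) $$ (i, j)) \<in> borel_measurable M" if ij: "i < K" "j < K" for i j
  proof -
    \<comment> \<open>The minor, written as a matrix with skipped indices so that the determinant
      lemma covers cofactors too.\<close>
    let ?D = "\<lambda>x. Matrix.mat (K - 1) (K - 1) (\<lambda>(i', j').
        cip N (\<lambda>a. \<omega> x (insert_index j i', a)) (\<lambda>a. \<omega> x (insert_index i j', a)))"
    have "mat_delete (gram K N (\<omega> x)) j i = ?D x" for x
      using ij by (intro eq_matI) (auto simp: gram_def mat_delete_def insert_index_def)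
    then have "adj_mat (gram K N (\<omega> x)) $$ (i, j) = (-1) ^ (j + i) * det (?D x)" for x
      using ij by (simp add: adj_mat_def cofactor_def) (simp add: gram_def)
    moreover have "(\<lambda>x. det (?D x)) \<in> borel_measurable M"
      by (rule measurable_det, rule c) (use ij in \<open>auto simp: insert_index_def\<close>)
    ultimately show ?thesis by simp
  qed
  then show "a < N \<Longrightarrow> (\<lambda>x. zf_row K N k (\<omega> x) a) \<in> borel_measurable M"
    unfolding zf_row_def using k d f
    by (intro borel_measurable_sum borel_measurable_times borel_measurable_divide borel_measurable_cnj) auto
qed

section \<open>Random matrices with Gaussian columns\<close>

abbreviation normal_columns :: "nat \<Rightarrow> nat \<Rightarrow> (nat \<Rightarrow> real) \<Rightarrow> (nat \<times> nat \<Rightarrow> complex) measure" where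
  "normal_columns K N v \<equiv> PiM ({..<K} \<times> {..<N}) (\<lambda>p. complex_normal (v (fst p)))"

lemma measurable_normal_columns_component:
  "j < K \<Longrightarrow> a < N \<Longrightarrow> (\<lambda>\<omega>. \<omega> (j, a)) \<in> borel_measurable (normal_columns K N v)"
  by (rule measurable_compose[OF measurable_component_singleton, where g = id, simplified]) auto

text \<open>One nonzero maximal minor suffices for full column rank, and the corner blocks are
  nested, which permits an induction on their size.\<close>

definition leading_block :: "nat \<Rightarrow> (nat \<times> nat \<Rightarrow> complex) \<Rightarrow> complex mat" where
  "leading_block m \<omega> = Matrix.mat m m (\<lambda>(a, j). \<omega> (j, a))"

text \<open>A null vector of the Gram matrix gives a combination of the columns that is orthogonal
  to every column, hence to itself, hence 0; its first \<open>K\<close> entries contradict the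
  regularity of the leading block.\<close>

lemma det_gram_nonzero:
  assumes "K \<le> N" "det (leading_block K \<omega>) \<noteq> 0"
  shows "det (gram K N \<omega>) \<noteq> 0"
proof
  have C: "gram K N \<omega> \<in> carrier_mat K K" "leading_block K \<omega> \<in> carrier_mat K K"
    by (auto simp: gram_def leading_block_def)
  assume "det (gram K N \<omega>) = 0"
  then obtain x where x: "x \<in> carrier_vec K" "x \<noteq> 0\<^sub>v K" "gram K N \<omega> *\<^sub>v x = 0\<^sub>v K"
    using det_0_iff_vec_prod_zero_field[OF C(1)] by blast
  let ?y = "\<lambda>a. \<Sum>j<K. x $ j * \<omega> (j, a)"
  have "cip N (\<lambda>a. \<omega> (i, a)) ?y = 0" if "i < K" for i
  proof -
    have "cip N (\<lambda>a. \<omega> (i, a)) ?y = (gram K N \<omega> *\<^sub>v x) $ i"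
      using that x(1) C by (simp add: cip_sum_right gram_def scalar_prod_def lessThan_atLeast0 mult.commute)
    then show ?thesis using x(3) that by simp
  qed
  then have "cip N ?y (\<lambda>a. \<omega> (i, a)) = 0" if "i < K" for i
    using cip_eq_0_commute that by blast
  then have "cip N ?y ?y = 0"
    by (simp add: cip_sum_right)
  then have y: "?y a = 0" if "a < N" for a
    using that by (simp only: cip_self_eq_0_iff)
  have "leading_block K \<omega> *\<^sub>v x = 0\<^sub>v K"
  proof (rule eq_vecI)
    fix a assume "a < dim_vec (0\<^sub>v K :: complex vec)"
    then have "a < K" "a < N" using assms(1) by auto
    then show "(leading_block K \<omega> *\<^sub>v x) $ a = (0\<^sub>v K :: complex vec) $ a"
      using y[of a] x(1) C by (simp add: leading_block_def scalar_prod_def lessThan_atLeast0 mult.commute)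
  qed (simp add: leading_block_def)
  then show False
    using det_0_iff_vec_prod_zero_field[OF C(2)] x(1,2) assms(2) by blast
qed

text \<open>Laplace expansion along the last column: the determinant is affine in the corner entry,
  and its slope is the preceding leading minor.\<close>

lemma det_leading_block_update:
  "\<exists>c. \<forall>y. det (leading_block (Suc m) (fun_upd \<omega> (m, m) y)) = y * det (leading_block m \<omega>) + c"
proof -
  let ?A = "\<lambda>y. leading_block (Suc m) (fun_upd \<omega> (m, m) y)"
  have C: "?A y \<in> carrier_mat (Suc m) (Suc m)" for y
    by (simp add: leading_block_def)
  have del: "mat_delete (?A y) i m = mat_delete (?A 0) i m" if "i \<le> m" for i y
    using that by (intro eq_matI) (auto simp: leading_block_def mat_delete_def)
  have last: "mat_delete (?A 0) m m = leading_block m \<omega>"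
    by (intro eq_matI) (auto simp: leading_block_def mat_delete_def)
  have "det (?A y) = y * det (leading_block m \<omega>) + (\<Sum>i<m. \<omega> (m, i) * cofactor (?A 0) i m)" for y
  proof -
    have "det (?A y) = (\<Sum>i<Suc m. ?A y $$ (i, m) * cofactor (?A y) i m)"
      by (rule laplace_expansion_column[OF C]) simp
    also have "\<dots> = (\<Sum>i<m. \<omega> (m, i) * cofactor (?A 0) i m) + y * det (leading_block m \<omega>)"
    proof -
      have "?A y $$ (i, m) * cofactor (?A y) i m = \<omega> (m, i) * cofactor (?A 0) i m" if "i < m" for i
        using that del[of i y] by (simp add: cofactor_def) (simp add: leading_block_def)
      moreover have "?A y $$ (m, m) * cofactor (?A y) m m = y * det (leading_block m \<omega>)"
        using del[of m y] by (simp add: cofactor_def last) (simp add: leading_block_def)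
      ultimately show ?thesis by simp
    qed
    finally show ?thesis by simp
  qed
  then show ?thesis by blast
qed

text \<open>If the preceding minor is nonzero, then for fixed other entries the next one vanishes at
  a single value of the corner entry, and a nondegenerate complex Gaussian has no atoms.\<close>

lemma AE_det_leading_block:
  assumes v: "\<And>j. j < K \<Longrightarrow> v j > 0" and "K \<le> N" and "m \<le> K"
  shows "AE \<omega> in normal_columns K N v. det (leading_block m \<omega>) \<noteq> 0"
  using \<open>m \<le> K\<close>
proof (induction m)
  case 0
  have "det (leading_block 0 \<omega>) = 1" for \<omega>
    by (simp add: leading_block_def det_dim_zero)
  then show ?case by simp
next
  case (Suc m)
  let ?I = "{..<K} \<times> {..<N}"
  let ?M = "\<lambda>p. complex_normal (v (fst p))"
  interpret product_prob_space ?M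
    by (intro product_prob_spaceI prob_space_complex_normal)
  have I: "?I = insert (m, m) (?I - {(m, m)})" "finite (?I - {(m, m)})"
    using Suc.prems \<open>K \<le> N\<close> by auto
  have meas [measurable]: "(\<lambda>\<omega>. det (leading_block i \<omega>)) \<in> borel_measurable (normal_columns K N v)" if "i \<le> K" for i
    unfolding leading_block_def using that \<open>K \<le> N\<close>
    by (intro measurable_det measurable_normal_columns_component) auto
  have mm [measurable]: "(\<lambda>\<omega>. det (leading_block m \<omega>)) \<in> borel_measurable (normal_columns K N v)"
    "(\<lambda>\<omega>. det (leading_block (Suc m) \<omega>)) \<in> borel_measurable (normal_columns K N v)"
    using Suc.prems by (auto intro!: meas)
  let ?B = "{\<omega>. det (leading_block (Suc m) \<omega>) = 0 \<and> det (leading_block m \<omega>) \<noteq> 0}"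
  have null: "(\<integral>\<^sup>+y. indicator ?B (fun_upd \<omega> (m, m) y) \<partial>?M (m, m)) = 0" for \<omega>
  proof -
    obtain c where c: "\<And>y. det (leading_block (Suc m) (fun_upd \<omega> (m, m) y)) = y * det (leading_block m \<omega>) + c"
      using det_leading_block_update by blast
    have "leading_block m (fun_upd \<omega> (m, m) y) = leading_block m \<omega>" for y
      by (auto simp: leading_block_def intro!: eq_matI)
    then have "(\<integral>\<^sup>+y. indicator ?B (fun_upd \<omega> (m, m) y) \<partial>?M (m, m)) \<le>
      (\<integral>\<^sup>+y. indicator {- c / det (leading_block m \<omega>)} y \<partial>?M (m, m))"
      by (intro nn_integral_mono) (auto simp: indicator_def c field_simps eq_neg_iff_add_eq_0)
    also have "\<dots> = 0"
      using Suc.prems v emeasure_complex_normal_singleton[of "v m"] by simp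
    finally show ?thesis by simp
  qed
  have "(\<integral>\<^sup>+\<omega>. indicator ?B \<omega> \<partial>normal_columns K N v) =
    (\<integral>\<^sup>+\<omega>. \<integral>\<^sup>+y. indicator ?B (fun_upd \<omega> (m, m) y) \<partial>?M (m, m) \<partial>PiM (?I - {(m, m)}) ?M)"
  proof (subst (1) I(1), rule product_nn_integral_insert)
    have "(\<lambda>\<omega>. indicator ?B \<omega> :: ennreal) \<in> borel_measurable (normal_columns K N v)"
      by measurable
    then show "(\<lambda>\<omega>. indicator ?B \<omega> :: ennreal) \<in> borel_measurable (PiM (insert (m, m) (?I - {(m, m)})) ?M)"
      unfolding I(1)[symmetric] .
  qed (use I in auto)
  also have "\<dots> = 0" by (simp only: null) simp
  finally have "AE \<omega> in normal_columns K N v. indicator ?B \<omega> = (0 :: ennreal)"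
    by (subst (asm) nn_integral_0_iff_AE) measurable
  moreover have "AE \<omega> in normal_columns K N v. det (leading_block m \<omega>) \<noteq> 0"
    using Suc by simp
  ultimately show ?case
    by eventually_elim (auto simp: indicator_def split: if_splits)
qed

lemma AE_det_gram:
  assumes "\<And>j. j < K \<Longrightarrow> v j > 0" and "K \<le> N"
  shows "AE \<omega> in normal_columns K N v. det (gram K N \<omega>) \<noteq> 0"
proof -
  have "AE \<omega> in normal_columns K N v. det (leading_block K \<omega>) \<noteq> 0"
    by (rule AE_det_leading_block) (use assms in auto)
  then show ?thesis
    by eventually_elim (rule det_gram_nonzero[OF assms(2)])
qed

text \<open>The coordinate functionals of column \<open>k\<close> serve as the diagonalising family,
  with \<open>N\<close> equal weights \<open>v k\<close>.\<close>

lemma mgf_column_norm: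
  assumes v: "\<And>j. j < K \<Longrightarrow> v j \<ge> 0" and k: "k < K" and x: "\<bar>x * v k\<bar> \<le> 1 / 2"
  shows "(\<integral>\<^sup>+\<omega>. ennreal (exp (x * ((\<Sum>a<N. (cmod (\<omega> (k, a)))\<^sup>2) - real N * v k))) \<partial>normal_columns K N v)
    \<le> ennreal (exp (2 * x\<^sup>2 * (real N * (v k)\<^sup>2)))"
proof -
  let ?S = "{..<K} \<times> {..<N}"
  let ?u = "\<lambda>t s. if s = (k, t) then 1 else 0 :: complex"
  have pick: "(\<Sum>s\<in>?S. ?u t s * \<omega> s) = \<omega> (k, t)" if "t < N" for t and \<omega> :: "nat \<times> nat \<Rightarrow> complex"
    using k that by (simp add: if_distrib[of "\<lambda>z. z * _"] cong: if_cong)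
  have orth: "(\<Sum>s\<in>?S. v (fst s) * (cmod (\<Sum>t\<in>{..<N}. \<eta> t * ?u t s))\<^sup>2) = (\<Sum>t\<in>{..<N}. v k * (cmod (\<eta> t))\<^sup>2)" for \<eta>
  proof -
    have "(\<Sum>t\<in>{..<N}. \<eta> t * ?u t s) = (if fst s = k then \<eta> (snd s) else 0)" if "s \<in> ?S" for s
      using that by (cases s) (auto simp: if_distrib[of "\<lambda>z. _ * z"] cong: if_cong)
    then have "(\<Sum>s\<in>?S. v (fst s) * (cmod (\<Sum>t\<in>{..<N}. \<eta> t * ?u t s))\<^sup>2) =
        (\<Sum>(j, a)\<in>?S. v j * (cmod (if j = k then \<eta> a else 0))\<^sup>2)"
      by (intro sum.cong) auto
    also have "\<dots> = (\<Sum>j<K. if j = k then (\<Sum>a<N. v k * (cmod (\<eta> a))\<^sup>2) else 0)"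
      unfolding sum.cartesian_product[symmetric] by (intro sum.cong) auto
    finally show ?thesis using k by simp
  qed
  have "(\<integral>\<^sup>+\<omega>. ennreal (exp (x * ((\<Sum>t\<in>{..<N}. (cmod (\<Sum>s\<in>?S. ?u t s * \<omega> s))\<^sup>2) - (\<Sum>t\<in>{..<N}. v k)))) \<partial>normal_columns K N v)
    \<le> ennreal (exp (2 * x\<^sup>2 * (\<Sum>t\<in>{..<N}. (v k)\<^sup>2)))"
    by (rule mgf_centered_quadratic_PiM_complex_normal) (use v x orth in auto)
  then show ?thesis
    by (simp add: pick)
qed

text \<open>For a fixed unit row the combinations of distinct columns are uncorrelated, and the
  \<open>j\<close>-th has variance \<open>d j\<close> because \<open>r\<close> has norm 1. The row
  is deterministic here; it becomes the zero-forcing direction after conditioning on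
  \<open>G\<close>.\<close>

lemma mgf_combined_columns:
  assumes d: "\<And>j. j < K \<Longrightarrow> d j \<ge> 0" and x: "\<And>j. j < K \<Longrightarrow> \<bar>x * d j\<bar> \<le> 1 / 2"
    and r: "(\<Sum>a<N. (cmod (r a))\<^sup>2) = 1"
  shows "(\<integral>\<^sup>+\<xi>. ennreal (exp (x * ((\<Sum>j<K. (cmod (\<Sum>a<N. r a * \<xi> (j, a)))\<^sup>2) - (\<Sum>j<K. d j)))) \<partial>normal_columns K N d)
    \<le> ennreal (exp (2 * x\<^sup>2 * (\<Sum>j<K. (d j)\<^sup>2)))"
proof -
  let ?S = "{..<K} \<times> {..<N}"
  let ?u = "\<lambda>t s. if fst s = t then r (snd s) else 0"
  have pick: "(\<Sum>s\<in>?S. ?u t s * \<omega> s) = (\<Sum>a<N. r a * \<omega> (t, a))" if "t < K" for t and \<omega> :: "nat \<times> nat \<Rightarrow> complex"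
  proof -
    have "(\<Sum>s\<in>?S. ?u t s * \<omega> s) = (\<Sum>j<K. \<Sum>a<N. (if j = t then r a * \<omega> (j, a) else 0))"
      unfolding sum.cartesian_product by (intro sum.cong) auto
    also have "\<dots> = (\<Sum>j<K. if j = t then (\<Sum>a<N. r a * \<omega> (t, a)) else 0)"
      by (intro sum.cong) auto
    finally show ?thesis using that by simp
  qed
  have orth: "(\<Sum>s\<in>?S. d (fst s) * (cmod (\<Sum>t\<in>{..<K}. \<eta> t * ?u t s))\<^sup>2) = (\<Sum>t\<in>{..<K}. d t * (cmod (\<eta> t))\<^sup>2)" for \<eta>
  proof -
    have "(\<Sum>t\<in>{..<K}. \<eta> t * ?u t s) = \<eta> (fst s) * r (snd s)" if "s \<in> ?S" for s
      using that by (cases s) (auto simp: if_distrib[of "\<lambda>z. _ * z"] cong: if_cong)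
    then have "(\<Sum>s\<in>?S. d (fst s) * (cmod (\<Sum>t\<in>{..<K}. \<eta> t * ?u t s))\<^sup>2) =
        (\<Sum>(j, a)\<in>?S. d j * (cmod (\<eta> j))\<^sup>2 * (cmod (r a))\<^sup>2)"
      by (intro sum.cong) (auto simp: norm_mult power_mult_distrib)
    also have "\<dots> = (\<Sum>j<K. d j * (cmod (\<eta> j))\<^sup>2 * (\<Sum>a<N. (cmod (r a))\<^sup>2))"
      unfolding sum.cartesian_product[symmetric] sum_distrib_left ..
    finally show ?thesis by (simp add: r)
  qed
  have "(\<integral>\<^sup>+\<omega>. ennreal (exp (x * ((\<Sum>t\<in>{..<K}. (cmod (\<Sum>s\<in>?S. ?u t s * \<omega> s))\<^sup>2) - (\<Sum>t\<in>{..<K}. d t)))) \<partial>normal_columns K N d)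
    \<le> ennreal (exp (2 * x\<^sup>2 * (\<Sum>t\<in>{..<K}. (d t)\<^sup>2)))"
    by (rule mgf_centered_quadratic_PiM_complex_normal) (use d x orth in auto)
  then show ?thesis
    by (simp add: pick)
qed

text \<open>Squared norm of the projection of column \<open>k\<close> onto the span of the other columns (almost surely).
  On the null set where the columns are dependent, the value is chosen so that centring gives 0.\<close>

definition proj_norm :: "nat \<Rightarrow> nat \<Rightarrow> real \<Rightarrow> nat \<Rightarrow> (nat \<times> nat \<Rightarrow> complex) \<Rightarrow> real" where
  "proj_norm K N c k \<omega> =
     (if det (gram K N \<omega>) = 0 then real (K - 1) * c
      else (\<Sum>a<N. (cmod (\<omega> (k, a)))\<^sup>2) - 1 / (\<Sum>a<N. (cmod (zf_row K N k \<omega> a))\<^sup>2))"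

lemma measurable_proj_norm:
  assumes "k < K"
  shows "(\<lambda>\<omega>. proj_norm K N c k \<omega>) \<in> borel_measurable (normal_columns K N v)"
proof -
  let ?M = "normal_columns K N v"
  have z: "(\<lambda>\<omega>. zf_row K N k \<omega> a) \<in> borel_measurable ?M" if "a < N" for a
    by (rule measurable_zf_row(2)[OF assms _ that]) (rule measurable_normal_columns_component)
  have [measurable]: "(\<lambda>\<omega>. \<Sum>a<N. (cmod (zf_row K N k \<omega> a))\<^sup>2) \<in> borel_measurable ?M"
    using z by (intro borel_measurable_sum borel_measurable_power measurable_compose[OF z borel_measurable_norm]) auto
  have c: "(\<lambda>\<omega>. \<omega> (k, a)) \<in> borel_measurable ?M" if "a < N" for a
    by (rule measurable_normal_columns_component[OF assms that])
  have [measurable]: "(\<lambda>\<omega>. \<Sum>a<N. (cmod (\<omega> (k, a)))\<^sup>2) \<in> borel_measurable ?M"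
    by (intro borel_measurable_sum borel_measurable_power measurable_compose[OF c borel_measurable_norm]) auto
  have [measurable]: "(\<lambda>\<omega>. det (gram K N \<omega>)) \<in> borel_measurable ?M"
    by (rule measurable_zf_row(1)[OF assms]) (rule measurable_normal_columns_component)
  show ?thesis
    unfolding proj_norm_def by measurable
qed

lemma measurable_quadratic:
  fixes u :: "'t \<Rightarrow> 's \<Rightarrow> complex" and x :: real
  shows "(\<lambda>\<xi>. ennreal (exp (x * ((\<Sum>t\<in>T. (cmod (\<Sum>s\<in>S. u t s * \<xi> s))\<^sup>2) - c))))
    \<in> borel_measurable (PiM S (\<lambda>s. complex_normal (v s)))"
  by measurable

text \<open>Condition on the other columns: the orthonormal basis \<open>q\<close> of their span
  does not involve column \<open>k\<close>, so by \<open>zf_row_norm\<close> the projected norm is a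
  sum of \<open>K - 1\<close> squared coordinates of a Gaussian column with entry variance
  \<open>v k\<close>.\<close>

lemma mgf_proj_norm:
  assumes v: "\<And>j. j < K \<Longrightarrow> v j \<ge> 0" and k: "k < K" and x: "\<bar>x * v k\<bar> \<le> 1 / 2"
  shows "(\<integral>\<^sup>+\<omega>. ennreal (exp (x * (proj_norm K N (v k) k \<omega> - real (K - 1) * v k))) \<partial>normal_columns K N v)
    \<le> ennreal (2 * exp (2 * x\<^sup>2 * (real (K - 1) * (v k)\<^sup>2)))"
proof -
  let ?M = "\<lambda>p::nat \<times> nat. complex_normal (v (fst p))"
  let ?J = "({..<K} - {k}) \<times> {..<N}" and ?I = "{k} \<times> {..<N}"
  let ?T = "{..<K} - {k}"
  let ?f = "\<lambda>\<omega>. ennreal (exp (x * (proj_norm K N (v k) k \<omega> - real (K - 1) * v k)))"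
  interpret product_prob_space ?M
    by (intro product_prob_spaceI prob_space_complex_normal)
  have U: "?J \<union> ?I = {..<K} \<times> {..<N}" using k by auto
  have card: "card ?T = K - 1" using k by simp
  have inner: "(\<integral>\<^sup>+\<xi>. ?f (merge ?J ?I (\<omega>, \<xi>)) \<partial>PiM ?I ?M) \<le> ennreal (2 * exp (2 * x\<^sup>2 * (real (K - 1) * (v k)\<^sup>2)))" for \<omega>
  proof (cases "\<exists>\<xi>. det (gram K N (merge ?J ?I (\<omega>, \<xi>))) \<noteq> 0")
    \<comment> \<open>No choice of column \<open>k\<close> makes the columns independent, so the
      default value in \<open>proj_norm\<close> makes the integrand constantly 1.\<close>
    case False
    then have "?f (merge ?J ?I (\<omega>, \<xi>)) = 1" for \<xi>
      by (simp add: proj_norm_def)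
    then have "(\<integral>\<^sup>+\<xi>. ?f (merge ?J ?I (\<omega>, \<xi>)) \<partial>PiM ?I ?M) = (\<integral>\<^sup>+\<xi>. 1 \<partial>PiM ?I ?M)"
      by (simp only:)
    also have "\<dots> = ennreal 1"
      by (simp add: prob_space.emeasure_space_1 prob_space_PiM prob_space_complex_normal)
    finally have "(\<integral>\<^sup>+\<xi>. ?f (merge ?J ?I (\<omega>, \<xi>)) \<partial>PiM ?I ?M) = ennreal 1" .
    moreover have "1 \<le> 2 * exp (2 * x\<^sup>2 * (real (K - 1) * (v k)\<^sup>2))"
    proof -
      have "1 \<le> exp (2 * x\<^sup>2 * (real (K - 1) * (v k)\<^sup>2))" by simp
      then show ?thesis by linarith
    qed
    ultimately show ?thesis by (simp only: ennreal_leI)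
  next
    case True
    then obtain \<xi>0 where \<xi>0: "det (gram K N (merge ?J ?I (\<omega>, \<xi>0))) \<noteq> 0" ..
    \<comment> \<open>The entries below \<open>N\<close> are taken from \<open>\<omega>\<close>
      alone, so the basis found with the help of \<open>\<xi>0\<close> serves every
      \<open>\<xi>\<close>; entries from \<open>N\<close> on do not affect
      \<open>cip N\<close>.\<close>
    have "\<exists>q. orthonormal_expansion N ?T (\<lambda>j a. if a < N then \<omega> (j, a) else merge ?J ?I (\<omega>, \<xi>0) (j, a)) q"
      by (rule orthonormal_expansion_exists[OF \<xi>0]) (auto simp: merge_def)
    then obtain q where q0: "orthonormal_expansion N ?T (\<lambda>j a. if a < N then \<omega> (j, a) else merge ?J ?I (\<omega>, \<xi>0) (j, a)) q" ..
    have cc: "cip N u (\<lambda>a. if a < N then w a else w' a) = cip N u w" for u w w'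
      by (rule cip_cong) auto
    have q: "orthonormal_expansion N ?T (\<lambda>j a. merge ?J ?I (\<omega>, \<xi>) (j, a)) q" for \<xi>
    proof -
      have "cip N u (\<lambda>a. merge ?J ?I (\<omega>, \<xi>) (j, a)) = cip N u (\<lambda>a. \<omega> (j, a))" if "j \<in> ?T" for u j
        using that by (intro cip_cong) (auto simp: merge_def)
      then show ?thesis
        using q0 unfolding orthonormal_expansion_def cc by (auto simp: merge_def)
    qed
    have on: "cip N (q s) (q t) = (if s = t then 1 else 0)" if "s \<in> ?T" "t \<in> ?T" for s t
      using q0 that by (auto simp: orthonormal_expansion_def)
    let ?u = "\<lambda>t s. cnj (q t (snd s))"
    let ?Q = "\<lambda>\<xi>. (\<Sum>t\<in>?T. (cmod (\<Sum>s\<in>?I. ?u t s * \<xi> s))\<^sup>2) - (\<Sum>t\<in>?T. v k)"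
    have I: "(\<Sum>s\<in>?I. h s) = (\<Sum>a<N. h (k, a))" for h :: "nat \<times> nat \<Rightarrow> 'z::comm_monoid_add"
      by (rule sum.reindex_bij_witness[of _ "\<lambda>a. (k, a)" snd]) auto
    \<comment> \<open>Degenerate values of column \<open>k\<close> may remain, and there the
      integrand is 1. Adding 1 covers them without an argument on null sets and is the origin of the
      factor 2 in the bound.\<close>
    have le: "?f (merge ?J ?I (\<omega>, \<xi>)) \<le> 1 + ennreal (exp (x * ?Q \<xi>))" for \<xi>
    proof (cases "det (gram K N (merge ?J ?I (\<omega>, \<xi>))) = 0")
      case True
      then show ?thesis by (simp add: proj_norm_def)
    next
      case False
      have "cip N (q t) (\<lambda>a. merge ?J ?I (\<omega>, \<xi>) (k, a)) = (\<Sum>s\<in>?I. ?u t s * \<xi> s)" for t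
        unfolding I cip_def by (intro sum.cong) (auto simp: merge_def)
      then have "proj_norm K N (v k) k (merge ?J ?I (\<omega>, \<xi>)) - real (K - 1) * v k = ?Q \<xi>"
        using False zf_row_norm[OF False k q] card by (simp add: proj_norm_def)
      then show ?thesis by simp
    qed
    have orth: "(\<Sum>s\<in>?I. v (fst s) * (cmod (\<Sum>t\<in>?T. \<eta> t * ?u t s))\<^sup>2) = (\<Sum>t\<in>?T. v k * (cmod (\<eta> t))\<^sup>2)" for \<eta>
      unfolding I using orthonormal_sum_squares[of ?T N q \<eta>] on
      by (simp add: sum_distrib_left[symmetric])
    define E where "E = exp (2 * x\<^sup>2 * (real (K - 1) * (v k)\<^sup>2))"
    have E: "1 \<le> E" by (simp add: E_def)
    have one: "(\<integral>\<^sup>+\<xi>. 1 \<partial>PiM ?I ?M) = 1"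
      by (simp add: prob_space.emeasure_space_1 prob_space_PiM prob_space_complex_normal)
    have Q: "(\<integral>\<^sup>+\<xi>. ennreal (exp (x * ?Q \<xi>)) \<partial>PiM ?I ?M) \<le> ennreal (exp (2 * x\<^sup>2 * (\<Sum>t\<in>?T. (v k)\<^sup>2)))"
      by (rule mgf_centered_quadratic_PiM_complex_normal) (use v k x orth in auto)
    have "(\<integral>\<^sup>+\<xi>. ?f (merge ?J ?I (\<omega>, \<xi>)) \<partial>PiM ?I ?M) \<le> (\<integral>\<^sup>+\<xi>. 1 + ennreal (exp (x * ?Q \<xi>)) \<partial>PiM ?I ?M)"
      by (intro nn_integral_mono le)
    also have "\<dots> = 1 + (\<integral>\<^sup>+\<xi>. ennreal (exp (x * ?Q \<xi>)) \<partial>PiM ?I ?M)"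
      by (subst nn_integral_add) (simp_all only: one measurable_quadratic borel_measurable_const)
    also have "\<dots> \<le> 1 + ennreal E"
      using Q card by (intro add_left_mono) (simp add: E_def)
    also have "\<dots> = ennreal (1 + E)"
      using E by (subst ennreal_plus) auto
    also have "\<dots> \<le> ennreal (2 * E)"
      using E by (intro ennreal_leI) linarith
    finally show ?thesis by (simp only: E_def)
  qed
  have "(\<integral>\<^sup>+\<omega>. ?f \<omega> \<partial>normal_columns K N v) =
    (\<integral>\<^sup>+\<omega>. \<integral>\<^sup>+\<xi>. ?f (merge ?J ?I (\<omega>, \<xi>)) \<partial>PiM ?I ?M \<partial>PiM ?J ?M)"
    unfolding U[symmetric]
    by (rule product_nn_integral_fold) (use measurable_proj_norm[OF k, of N "v k" v] in \<open>auto simp: U\<close>)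
  also have "\<dots> \<le> (\<integral>\<^sup>+\<omega>. ennreal (2 * exp (2 * x\<^sup>2 * (real (K - 1) * (v k)\<^sup>2))) \<partial>PiM ?J ?M)"
    by (intro nn_integral_mono inner)
  also have "\<dots> = ennreal (2 * exp (2 * x\<^sup>2 * (real (K - 1) * (v k)\<^sup>2)))"
    by (simp add: prob_space.emeasure_space_1 prob_space_PiM prob_space_complex_normal)
  finally show ?thesis .
qed

section \<open>Independence and Gaussian prediction\<close>

context prob_space
begin

lemma indep_var_sum_restrict:
  fixes X :: "'i \<Rightarrow> 'a \<Rightarrow> complex"
  assumes "indep_vars (\<lambda>_. borel) X I" and "A \<inter> B = {}" "A \<subseteq> I" "B \<subseteq> I"
  shows "indep_var borel (\<lambda>\<omega>. \<Sum>s\<in>A. X s \<omega>) borel (\<lambda>\<omega>. \<Sum>s\<in>B. X s \<omega>)"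
proof -
  have "indep_var borel ((\<lambda>f. \<Sum>s\<in>A. f s) \<circ> (\<lambda>\<omega>. restrict (\<lambda>i. X i \<omega>) A))
      borel ((\<lambda>f. \<Sum>s\<in>B. f s) \<circ> (\<lambda>\<omega>. restrict (\<lambda>i. X i \<omega>) B))"
    by (rule indep_var_compose[OF indep_var_restrict[OF assms]])
      (intro borel_measurable_sum measurable_component_singleton; simp)+
  then show ?thesis by (simp add: comp_def cong: sum.cong)
qed

lemma nn_integral_indep_var:
  assumes "indep_var N1 X N2 Y" and [measurable]: "(\<lambda>(x, y). f x y) \<in> borel_measurable (N1 \<Otimes>\<^sub>M N2)"
  shows "(\<integral>\<^sup>+\<omega>. f (X \<omega>) (Y \<omega>) \<partial>M) = (\<integral>\<^sup>+x. \<integral>\<^sup>+y. f x y \<partial>distr M N2 Y \<partial>distr M N1 X)"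
proof -
  have m [measurable]: "X \<in> measurable M N1" "Y \<in> measurable M N2"
    and d: "distr M N1 X \<Otimes>\<^sub>M distr M N2 Y = distr M (N1 \<Otimes>\<^sub>M N2) (\<lambda>x. (X x, Y x))"
    using assms(1) by (auto simp: indep_var_distribution_eq)
  interpret Y: prob_space "distr M N2 Y" by (rule prob_space_distr) (rule m)
  have "(\<integral>\<^sup>+\<omega>. f (X \<omega>) (Y \<omega>) \<partial>M) = (\<integral>\<^sup>+z. (\<lambda>(x, y). f x y) z \<partial>distr M (N1 \<Otimes>\<^sub>M N2) (\<lambda>x. (X x, Y x)))"
    by (subst nn_integral_distr) auto
  also have "\<dots> = (\<integral>\<^sup>+x. \<integral>\<^sup>+y. f x y \<partial>distr M N2 Y \<partial>distr M N1 X)"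
    unfolding d[symmetric] by (subst Y.nn_integral_fst[symmetric]) auto
  finally show ?thesis .
qed

lemma distr_add_complex_normal:
  assumes "indep_var borel X borel Y"
    and X: "distr M borel X = complex_normal v" and Y: "distr M borel Y = complex_normal u"
    and "v \<ge> 0" "u \<ge> 0"
  shows "distr M borel (\<lambda>\<omega>. X \<omega> + Y \<omega>) = complex_normal (v + u)"
proof (rule measure_eqI)
  have [measurable]: "X \<in> borel_measurable M" "Y \<in> borel_measurable M"
    using assms(1) by (auto simp: indep_var_distribution_eq)
  fix A assume "A \<in> sets (distr M borel (\<lambda>\<omega>. X \<omega> + Y \<omega>))"
  then have [measurable]: "A \<in> sets borel" by simp
  have "emeasure (distr M borel (\<lambda>\<omega>. X \<omega> + Y \<omega>)) A = (\<integral>\<^sup>+\<omega>. indicator A (X \<omega> + Y \<omega>) \<partial>M)"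
    by (subst nn_integral_indicator[symmetric], simp) (rule nn_integral_distr, measurable)
  also have "\<dots> = (\<integral>\<^sup>+x. \<integral>\<^sup>+y. indicator A (x + y) \<partial>complex_normal u \<partial>complex_normal v)"
    unfolding X[symmetric] Y[symmetric] by (rule nn_integral_indep_var[OF assms(1)]) measurable
  also have "\<dots> = (\<integral>\<^sup>+x. indicator A x \<partial>complex_normal (v + u))"
    using assms by (intro nn_integral_complex_normal_add) measurable
  finally show "emeasure (distr M borel (\<lambda>\<omega>. X \<omega> + Y \<omega>)) A = emeasure (complex_normal (v + u)) A"
    by simp
qed simp

lemma distr_sum_complex_normal:
  fixes X :: "'i \<Rightarrow> 'a \<Rightarrow> complex"
  assumes "finite A" "A \<noteq> {}" "indep_vars (\<lambda>_. borel) X A"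
    and "\<And>s. s \<in> A \<Longrightarrow> distr M borel (X s) = complex_normal (v s)" "\<And>s. s \<in> A \<Longrightarrow> v s \<ge> 0"
  shows "distr M borel (\<lambda>\<omega>. \<Sum>s\<in>A. X s \<omega>) = complex_normal (\<Sum>s\<in>A. v s)"
  using assms
proof (induction A rule: finite_ne_induct)
  case (singleton s)
  then show ?case by simp
next
  case (insert s A)
  have IH: "distr M borel (\<lambda>\<omega>. \<Sum>s\<in>A. X s \<omega>) = complex_normal (\<Sum>s\<in>A. v s)"
    using insert.prems by (intro insert.IH) (auto intro: indep_vars_subset)
  have "indep_var borel (\<lambda>\<omega>. \<Sum>t\<in>{s}. X t \<omega>) borel (\<lambda>\<omega>. \<Sum>s\<in>A. X s \<omega>)"
    using insert.hyps by (intro indep_var_sum_restrict[OF insert.prems(1)]) auto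
  then have "distr M borel (\<lambda>\<omega>. X s \<omega> + (\<Sum>s\<in>A. X s \<omega>)) = complex_normal (v s + (\<Sum>s\<in>A. v s))"
    using IH insert.prems by (intro distr_add_complex_normal sum_nonneg) auto
  then show ?case using insert.hyps by simp
qed

lemma distr_scale_complex_normal:
  assumes [measurable]: "X \<in> borel_measurable M" and X: "distr M borel X = complex_normal v"
  shows "distr M borel (\<lambda>\<omega>. complex_of_real c * X \<omega>) = complex_normal (c\<^sup>2 * v)"
proof (rule measure_eqI)
  fix A assume "A \<in> sets (distr M borel (\<lambda>\<omega>. complex_of_real c * X \<omega>))"
  then have [measurable]: "A \<in> sets borel" by simp
  have "emeasure (distr M borel (\<lambda>\<omega>. complex_of_real c * X \<omega>)) A = (\<integral>\<^sup>+\<omega>. indicator A (complex_of_real c * X \<omega>) \<partial>M)"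
    by (subst nn_integral_indicator[symmetric], simp) (rule nn_integral_distr, measurable)
  also have "\<dots> = (\<integral>\<^sup>+x. indicator A (complex_of_real c * x) \<partial>complex_normal v)"
    unfolding X[symmetric] by (rule nn_integral_distr[symmetric]) measurable
  also have "\<dots> = (\<integral>\<^sup>+x. indicator A x \<partial>complex_normal (c\<^sup>2 * v))"
    by (rule nn_integral_complex_normal_scale) measurable
  finally show "emeasure (distr M borel (\<lambda>\<omega>. complex_of_real c * X \<omega>)) A = emeasure (complex_normal (c\<^sup>2 * v)) A"
    by simp
qed simp

text \<open>\<open>X x\<close>, \<open>X y\<close> and \<open>X w\<close> stand for the channel, the
  rest of the pilot observation and the innovation; \<open>G\<close> is the scaled observation and
  \<open>E\<close> the delay error. A product as joint law expresses independence and both marginals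
  at once.\<close>

lemma distr_prediction:
  fixes X :: "'i \<Rightarrow> 'a \<Rightarrow> complex" and c \<alpha> b s d :: real
  assumes ind: "indep_vars (\<lambda>_. borel) X I" and I: "x \<in> I" "y \<in> I" "w \<in> I" "x \<noteq> y" "x \<noteq> w" "y \<noteq> w"
    and X: "distr M borel (X x) = complex_normal b" and Y: "distr M borel (X y) = complex_normal s"
    and W: "distr M borel (X w) = complex_normal d"
    and pos: "b > 0" "s > 0" "d \<ge> 0" "\<alpha> \<noteq> 0"
  defines "G \<equiv> \<lambda>\<omega>. complex_of_real c * (X x \<omega> + X y \<omega>)"
    and "E \<equiv> \<lambda>\<omega>. complex_of_real \<alpha> * (X x \<omega> - complex_of_real (b / (b + s)) * (X x \<omega> + X y \<omega>)) + X w \<omega>"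
  shows "distr M (borel \<Otimes>\<^sub>M borel) (\<lambda>\<omega>. (G \<omega>, E \<omega>)) =
    complex_normal (c\<^sup>2 * (b + s)) \<Otimes>\<^sub>M complex_normal (\<alpha>\<^sup>2 * (b * s / (b + s)) + d)"
proof (rule measure_eqI)
  have [measurable]: "X x \<in> borel_measurable M" "X y \<in> borel_measurable M" "X w \<in> borel_measurable M"
    using ind I by (auto simp: indep_vars_def)
  have [measurable]: "G \<in> borel_measurable M" "E \<in> borel_measurable M"
    unfolding G_def E_def by measurable
  interpret N: prob_space "complex_normal v" for v by (rule prob_space_complex_normal)
  define V where "V i = (if i = x then b else if i = y then s else d)" for i
  interpret PV: product_prob_space "\<lambda>i. complex_normal (V i)"
    by (rule product_prob_space_complex_normal)
  have "indep_vars (\<lambda>_. borel) X {x, y, w}"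
    using I by (intro indep_vars_subset[OF ind]) auto
  then have "distr M (PiM {x, y, w} (\<lambda>_. borel)) (\<lambda>\<omega>. \<lambda>i\<in>{x, y, w}. X i \<omega>) = PiM {x, y, w} (\<lambda>i. distr M borel (X i))"
    by (subst (asm) indep_vars_iff_distr_eq_PiM') auto
  also have "\<dots> = PiM {x, y, w} (\<lambda>i. complex_normal (V i))"
    using I X Y W by (intro PiM_cong) (auto simp: V_def)
  finally have law: "distr M (PiM {x, y, w} (\<lambda>_. borel)) (\<lambda>\<omega>. \<lambda>i\<in>{x, y, w}. X i \<omega>) = PiM {x, y, w} (\<lambda>i. complex_normal (V i))" .
  \<comment> \<open>The three coordinates are peeled off the product measure one at a time. The
    assumption on \<open>F\<close> states joint measurability by composition, since \<open>F\<close>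
    is curried.\<close>
  have triple: "(\<integral>\<^sup>+\<omega>. F (X x \<omega>) (X y \<omega>) (X w \<omega>) \<partial>M) =
    (\<integral>\<^sup>+\<xi>. \<integral>\<^sup>+\<eta>. \<integral>\<^sup>+\<epsilon>. F \<xi> \<eta> \<epsilon> \<partial>complex_normal d \<partial>complex_normal s \<partial>complex_normal b)"
    if F: "\<And>N u1 u2 u3. u1 \<in> borel_measurable N \<Longrightarrow> u2 \<in> borel_measurable N \<Longrightarrow> u3 \<in> borel_measurable N \<Longrightarrow>
      (\<lambda>z::'i \<Rightarrow> complex. F (u1 z) (u2 z) (u3 z)) \<in> borel_measurable N"
      and F1: "\<And>\<xi> \<eta>. F \<xi> \<eta> \<in> borel_measurable borel"
    for F :: "complex \<Rightarrow> complex \<Rightarrow> complex \<Rightarrow> ennreal"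
  proof -
    have comp: "(\<lambda>z. z i) \<in> borel_measurable (PiM J (\<lambda>i. complex_normal (V i)))" if "i \<in> J" for i J
      using measurable_component_singleton[OF that, of "\<lambda>i. complex_normal (V i)"]
      by (simp cong: measurable_cong_sets)
    have "(\<integral>\<^sup>+\<omega>. F (X x \<omega>) (X y \<omega>) (X w \<omega>) \<partial>M) =
        (\<integral>\<^sup>+z. F (z x) (z y) (z w) \<partial>distr M (PiM {x, y, w} (\<lambda>_. borel)) (\<lambda>\<omega>. \<lambda>i\<in>{x, y, w}. X i \<omega>))"
      by (subst nn_integral_distr) (auto intro!: F measurable_restrict)
    also have "\<dots> = (\<integral>\<^sup>+\<xi>. \<integral>\<^sup>+z. F ((z(x := \<xi>)) x) ((z(x := \<xi>)) y) ((z(x := \<xi>)) w)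
        \<partial>PiM {y, w} (\<lambda>i. complex_normal (V i)) \<partial>complex_normal (V x))"
      unfolding law using I by (intro PV.product_nn_integral_insert_rev) (auto intro!: F comp)
    also have "\<dots> = (\<integral>\<^sup>+\<xi>. \<integral>\<^sup>+z. F \<xi> (z y) (z w) \<partial>PiM {y, w} (\<lambda>i. complex_normal (V i)) \<partial>complex_normal b)"
      using I by (simp add: V_def)
    also have "\<dots> = (\<integral>\<^sup>+\<xi>. \<integral>\<^sup>+\<eta>. \<integral>\<^sup>+z. F \<xi> ((z(y := \<eta>)) y) ((z(y := \<eta>)) w)
        \<partial>PiM {w} (\<lambda>i. complex_normal (V i)) \<partial>complex_normal (V y) \<partial>complex_normal b)"
      using I by (intro nn_integral_cong[OF PV.product_nn_integral_insert_rev]) (auto intro!: F comp)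
    also have "\<dots> = (\<integral>\<^sup>+\<xi>. \<integral>\<^sup>+\<eta>. \<integral>\<^sup>+z. F \<xi> \<eta> (z w)
        \<partial>PiM {w} (\<lambda>i. complex_normal (V i)) \<partial>complex_normal s \<partial>complex_normal b)"
      using I by (simp add: V_def)
    also have "\<dots> = (\<integral>\<^sup>+\<xi>. \<integral>\<^sup>+\<eta>. \<integral>\<^sup>+\<epsilon>. F \<xi> \<eta> \<epsilon> \<partial>complex_normal (V w) \<partial>complex_normal s \<partial>complex_normal b)"
      by (intro nn_integral_cong PV.product_nn_integral_singleton[where f = "F \<xi> \<eta>" for \<xi> \<eta>])
        (simp add: F1 cong: measurable_cong_sets)
    finally show ?thesis using I by (simp add: V_def)
  qed
  show "sets (distr M (borel \<Otimes>\<^sub>M borel) (\<lambda>\<omega>. (G \<omega>, E \<omega>))) =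
    sets (complex_normal (c\<^sup>2 * (b + s)) \<Otimes>\<^sub>M complex_normal (\<alpha>\<^sup>2 * (b * s / (b + s)) + d))"
    by (simp cong: sets_pair_measure_cong)
  fix A assume "A \<in> sets (distr M (borel \<Otimes>\<^sub>M borel) (\<lambda>\<omega>. (G \<omega>, E \<omega>)))"
  then have [measurable]: "A \<in> sets (borel \<Otimes>\<^sub>M borel)" by simp
  let ?f = "\<lambda>g e. indicator A (g, e) :: ennreal"
  let ?e = "\<lambda>\<xi> \<eta> \<epsilon>. complex_of_real \<alpha> * (\<xi> - complex_of_real (b / (b + s)) * (\<xi> + \<eta>)) + \<epsilon>"
  define F where "F \<xi> \<eta> \<epsilon> = ?f (complex_of_real c * (\<xi> + \<eta>)) (?e \<xi> \<eta> \<epsilon>)" for \<xi> \<eta> \<epsilon>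
  have "emeasure (distr M (borel \<Otimes>\<^sub>M borel) (\<lambda>\<omega>. (G \<omega>, E \<omega>))) A = (\<integral>\<^sup>+\<omega>. ?f (G \<omega>) (E \<omega>) \<partial>M)"
    by (subst nn_integral_indicator[symmetric], simp) (rule nn_integral_distr, measurable)
  also have "\<dots> = (\<integral>\<^sup>+\<omega>. F (X x \<omega>) (X y \<omega>) (X w \<omega>) \<partial>M)"
    by (simp only: F_def G_def E_def)
  also have "\<dots> = (\<integral>\<^sup>+\<xi>. \<integral>\<^sup>+\<eta>. \<integral>\<^sup>+\<epsilon>. F \<xi> \<eta> \<epsilon> \<partial>complex_normal d \<partial>complex_normal s \<partial>complex_normal b)"
  proof (rule triple)
    show "(\<lambda>z. F (u1 z) (u2 z) (u3 z)) \<in> borel_measurable N"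
      if [measurable]: "u1 \<in> borel_measurable N" "u2 \<in> borel_measurable N" "u3 \<in> borel_measurable N"
      for N :: "('i \<Rightarrow> complex) measure" and u1 u2 u3
      unfolding F_def by measurable
    have "(\<lambda>\<epsilon>. F \<xi> \<eta> \<epsilon>) \<in> borel_measurable borel" for \<xi> \<eta>
      unfolding F_def by measurable
    then show "F \<xi> \<eta> \<in> borel_measurable borel" for \<xi> \<eta> .
  qed
  also have "\<dots> = (\<integral>\<^sup>+\<xi>. \<integral>\<^sup>+\<eta>. \<integral>\<^sup>+\<epsilon>. ?f (complex_of_real c * (\<xi> + \<eta>)) (?e \<xi> \<eta> \<epsilon>)
      \<partial>complex_normal d \<partial>complex_normal s \<partial>complex_normal b)"
    by (simp only: F_def)
  also have "\<dots> = (\<integral>\<^sup>+w. \<integral>\<^sup>+u. ?f (complex_of_real c * w) u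
      \<partial>complex_normal (\<alpha>\<^sup>2 * (b * s / (b + s)) + d) \<partial>complex_normal (b + s))"
    by (rule nn_integral_complex_normal_prediction[OF pos, where f = "\<lambda>w u. ?f (complex_of_real c * w) u"]) measurable
  also have "\<dots> = (\<integral>\<^sup>+w. \<integral>\<^sup>+u. ?f w u
      \<partial>complex_normal (\<alpha>\<^sup>2 * (b * s / (b + s)) + d) \<partial>complex_normal (c\<^sup>2 * (b + s)))"
    by (rule nn_integral_complex_normal_scale[where f = "\<lambda>w. \<integral>\<^sup>+u. ?f w u \<partial>complex_normal (\<alpha>\<^sup>2 * (b * s / (b + s)) + d)"]) measurable
  also have "\<dots> = emeasure (complex_normal (c\<^sup>2 * (b + s)) \<Otimes>\<^sub>M complex_normal (\<alpha>\<^sup>2 * (b * s / (b + s)) + d)) A"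
    by (rule N.emeasure_pair_measure[symmetric]) measurable
  finally show "emeasure (distr M (borel \<Otimes>\<^sub>M borel) (\<lambda>\<omega>. (G \<omega>, E \<omega>))) A =
    emeasure (complex_normal (c\<^sup>2 * (b + s)) \<Otimes>\<^sub>M complex_normal (\<alpha>\<^sup>2 * (b * s / (b + s)) + d)) A" .
qed

text \<open>The boolean index puts the two families side by side: \<open>False\<close> selects
  \<open>A\<close>, \<open>True\<close> selects \<open>B\<close>. The probability of a box
  factorises over \<open>p\<close> by independence of the pairs and then inside each pair.\<close>

lemma indep_vars_unzip:
  assumes I: "finite I" "I \<noteq> {}" and ind: "indep_vars (\<lambda>_. N \<Otimes>\<^sub>M N) (\<lambda>p \<omega>. (A p \<omega>, B p \<omega>)) I"
    and pair: "\<And>p. p \<in> I \<Longrightarrow> indep_var N (A p) N (B p)"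
  shows "indep_vars (\<lambda>_. N) (\<lambda>(c, p). if c then B p else A p) (UNIV \<times> I)"
proof -
  have rv: "A p \<in> measurable M N" "B p \<in> measurable M N" if "p \<in> I" for p
    using pair[OF that] by (auto simp: indep_var_distribution_eq)
  show ?thesis
  proof (subst indep_vars_finite[where E = "\<lambda>_. sets N"])
    show "UNIV \<times> I \<noteq> {}" "finite ((UNIV :: bool set) \<times> I)" using I by auto
    show "\<forall>S\<in>UNIV \<times> I \<rightarrow> sets N.
      prob (\<Inter>j\<in>UNIV \<times> I. (case j of (c, p) \<Rightarrow> if c then B p else A p) -` S j \<inter> space M) =
      (\<Prod>j\<in>UNIV \<times> I. prob ((case j of (c, p) \<Rightarrow> if c then B p else A p) -` S j \<inter> space M))"
    proof
      fix S assume S: "S \<in> (UNIV :: bool set) \<times> I \<rightarrow> sets N"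
      have U: "UNIV \<times> I = {False} \<times> I \<union> {True} \<times> I" by auto
      have "(\<Inter>j\<in>UNIV \<times> I. (case j of (c, p) \<Rightarrow> if c then B p else A p) -` S j \<inter> space M) =
        (\<Inter>p\<in>I. (\<lambda>\<omega>. (A p \<omega>, B p \<omega>)) -` (S (False, p) \<times> S (True, p)) \<inter> space M)"
        using I by (auto split: if_splits simp: all_conj_distrib) (metis (full_types))+
      also have "prob \<dots> = (\<Prod>p\<in>I. prob ((\<lambda>\<omega>. (A p \<omega>, B p \<omega>)) -` (S (False, p) \<times> S (True, p)) \<inter> space M))"
        using S I by (intro indep_varsD_finite[OF ind]) auto
      also have "\<dots> = (\<Prod>p\<in>I. prob (A p -` S (False, p) \<inter> space M) * prob (B p -` S (True, p) \<inter> space M))"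
        using S by (intro prod.cong refl indep_varD[OF pair]) auto
      also have "\<dots> = (\<Prod>p\<in>I. \<Prod>c\<in>UNIV. prob ((if c then B p else A p) -` S (c, p) \<inter> space M))"
        by (simp add: UNIV_bool)
      also have "\<dots> = (\<Prod>c\<in>UNIV. \<Prod>p\<in>I. prob ((if c then B p else A p) -` S (c, p) \<inter> space M))"
        by (rule prod.swap)
      also have "\<dots> = (\<Prod>j\<in>UNIV \<times> I. prob ((case j of (c, p) \<Rightarrow> if c then B p else A p) -` S j \<inter> space M))"
        unfolding prod.cartesian_product by (intro prod.cong) auto
      finally show "prob (\<Inter>j\<in>UNIV \<times> I. (case j of (c, p) \<Rightarrow> if c then B p else A p) -` S j \<inter> space M) =
        (\<Prod>j\<in>UNIV \<times> I. prob ((case j of (c, p) \<Rightarrow> if c then B p else A p) -` S j \<inter> space M))" .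
    qed
  qed (use rv in \<open>auto simp: sets.sigma_sets_eq Int_stable_def sets.space_closed intro: sets.sigma_sets_eq[symmetric]\<close>)
qed

text \<open>A product of pairs becomes a pair of products: grouping the variables of
  \<open>indep_vars_unzip\<close> by the boolean index makes the families \<open>A\<close> and
  \<open>B\<close> independent as wholes, and the marginals come from the law of each pair.\<close>

lemma distr_unzip:
  assumes I: "finite I" "I \<noteq> {}" and ind: "indep_vars (\<lambda>_. N \<Otimes>\<^sub>M N) (\<lambda>p \<omega>. (A p \<omega>, B p \<omega>)) I"
    and law: "\<And>p. p \<in> I \<Longrightarrow> distr M (N \<Otimes>\<^sub>M N) (\<lambda>\<omega>. (A p \<omega>, B p \<omega>)) = P p \<Otimes>\<^sub>M Q p"
    and P: "\<And>p. prob_space (P p)" "\<And>p. sets (P p) = sets N"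
    and Q: "\<And>p. prob_space (Q p)" "\<And>p. sets (Q p) = sets N"
  shows "(\<lambda>\<omega>. \<lambda>p\<in>I. A p \<omega>) \<in> measurable M (PiM I (\<lambda>_. N))"
    and "(\<lambda>\<omega>. \<lambda>p\<in>I. B p \<omega>) \<in> measurable M (PiM I (\<lambda>_. N))"
    and "distr M (PiM I (\<lambda>_. N) \<Otimes>\<^sub>M PiM I (\<lambda>_. N)) (\<lambda>\<omega>. (\<lambda>p\<in>I. A p \<omega>, \<lambda>p\<in>I. B p \<omega>)) = PiM I P \<Otimes>\<^sub>M PiM I Q"
proof -
  have pair_rv: "(\<lambda>\<omega>. (A p \<omega>, B p \<omega>)) \<in> measurable M (N \<Otimes>\<^sub>M N)" if "p \<in> I" for p
    using ind that by (auto simp: indep_vars_def)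
  have rv: "A p \<in> measurable M N" "B p \<in> measurable M N" if "p \<in> I" for p
    using measurable_compose[OF pair_rv[OF that] measurable_fst] measurable_compose[OF pair_rv[OF that] measurable_snd]
    by simp_all
  have A: "distr M N (A p) = P p" if p: "p \<in> I" for p
  proof -
    have "distr M N (A p) = distr (distr M (N \<Otimes>\<^sub>M N) (\<lambda>\<omega>. (A p \<omega>, B p \<omega>))) N fst"
      using pair_rv[OF p] by (subst distr_distr) (auto simp: comp_def)
    also have "\<dots> = distr (P p \<Otimes>\<^sub>M Q p) (P p) fst"
      unfolding law[OF p] by (rule distr_cong) (auto simp: P)
    also have "\<dots> = P p"
      by (rule prob_space.distr_pair_fst[OF Q(1)])
    finally show ?thesis .
  qed
  have B: "distr M N (B p) = Q p" if p: "p \<in> I" for p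
  proof (rule measure_eqI)
    fix S assume "S \<in> sets (distr M N (B p))"
    then have S: "S \<in> sets N" by simp
    interpret Q: prob_space "Q p" by (rule Q)
    interpret P: prob_space "P p" by (rule P)
    have sp: "space (P p) = space N" "space (Q p) = space N"
      using sets_eq_imp_space_eq[OF P(2)] sets_eq_imp_space_eq[OF Q(2)] by auto
    have "emeasure (distr M N (B p)) S = emeasure (distr M (N \<Otimes>\<^sub>M N) (\<lambda>\<omega>. (A p \<omega>, B p \<omega>))) (space N \<times> S)"
      using S rv[OF p] pair_rv[OF p]
      by (simp add: emeasure_distr)
        (auto intro!: arg_cong[where f = "emeasure M"] dest: measurable_space[OF rv(1)[OF p]])
    also have "\<dots> = emeasure (P p) (space N) * emeasure (Q p) S"
      unfolding law[OF p] using S by (intro Q.emeasure_pair_measure_Times) (auto simp: P Q)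
    finally show "emeasure (distr M N (B p)) S = emeasure (Q p) S"
      using P.emeasure_space_1 by (simp add: sp)
  qed (simp add: Q)
  have pair: "indep_var N (A p) N (B p)" if "p \<in> I" for p
    using rv[OF that] that by (simp add: indep_var_distribution_eq A B law)
  have all: "indep_vars (\<lambda>_. N) (\<lambda>(c, p). if c then B p else A p) (UNIV \<times> I)"
    by (rule indep_vars_unzip[OF I ind pair])
  let ?R = "\<lambda>c f. \<lambda>p\<in>I. f (c, p)"
  have R: "?R c \<in> measurable (PiM ({c} \<times> I) (\<lambda>_. N)) (PiM I (\<lambda>_. N))" for c :: bool
    by (rule measurable_restrict) (auto intro: measurable_component_singleton)
  have "indep_var (PiM I (\<lambda>_. N)) (?R False \<circ> (\<lambda>\<omega>. restrict (\<lambda>i. (case i of (c, p) \<Rightarrow> if c then B p else A p) \<omega>) ({False} \<times> I)))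
    (PiM I (\<lambda>_. N)) (?R True \<circ> (\<lambda>\<omega>. restrict (\<lambda>i. (case i of (c, p) \<Rightarrow> if c then B p else A p) \<omega>) ({True} \<times> I)))"
    by (rule indep_var_compose[OF indep_var_restrict[OF all] R R]) auto
  then have iv: "indep_var (PiM I (\<lambda>_. N)) (\<lambda>\<omega>. \<lambda>p\<in>I. A p \<omega>) (PiM I (\<lambda>_. N)) (\<lambda>\<omega>. \<lambda>p\<in>I. B p \<omega>)"
    by (simp add: comp_def cong: restrict_cong)
  show "(\<lambda>\<omega>. \<lambda>p\<in>I. A p \<omega>) \<in> measurable M (PiM I (\<lambda>_. N))" "(\<lambda>\<omega>. \<lambda>p\<in>I. B p \<omega>) \<in> measurable M (PiM I (\<lambda>_. N))"
    using rv by (auto intro!: measurable_restrict)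
  have "indep_vars (\<lambda>_. N) A I" "indep_vars (\<lambda>_. N) B I"
    using indep_vars_compose2[OF ind, of "\<lambda>_. fst" "\<lambda>_. N"] indep_vars_compose2[OF ind, of "\<lambda>_. snd" "\<lambda>_. N"]
    by simp_all
  then have "distr M (PiM I (\<lambda>_. N)) (\<lambda>\<omega>. \<lambda>p\<in>I. A p \<omega>) = PiM I P"
    "distr M (PiM I (\<lambda>_. N)) (\<lambda>\<omega>. \<lambda>p\<in>I. B p \<omega>) = PiM I Q"
    using rv I A B by (auto simp: indep_vars_iff_distr_eq_PiM' intro!: PiM_cong)
  then show "distr M (PiM I (\<lambda>_. N) \<Otimes>\<^sub>M PiM I (\<lambda>_. N)) (\<lambda>\<omega>. (\<lambda>p\<in>I. A p \<omega>, \<lambda>p\<in>I. B p \<omega>)) = PiM I P \<Otimes>\<^sub>M PiM I Q"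
    using iv by (simp add: indep_var_distribution_eq)
qed

end

section \<open>Joint law of channel estimate and delay error\<close>

text \<open>Factors that turn fading and pilot noise into summands of the pilot observation; an
  innovation already carries its variance.\<close>

primrec source_weight :: "large_scale \<Rightarrow> real \<Rightarrow> nat \<Rightarrow> source \<Rightarrow> real" where
  "source_weight \<beta> ptr l (Fading i j a) = sqrt (\<beta> l i j)"
| "source_weight \<beta> ptr l (Pilot_noise j a) = 1 / sqrt ptr"
| "source_weight \<beta> ptr l (Innovation i j a) = 1"

text \<open>Block 0 is the channel of cell \<open>i\<close>, block 1 the rest of the pilot observation, block 2 the innovation.\<close>

definition source_block :: "nat \<Rightarrow> nat \<Rightarrow> nat \<Rightarrow> nat \<times> nat \<Rightarrow> source set" where
  "source_block L i c p =
     (if c = 0 then {Fading i (fst p) (snd p)}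
      else if c = 1 then insert (Pilot_noise (fst p) (snd p)) ((\<lambda>i'. Fading i' (fst p) (snd p)) ` ({..<L} - {i}))
      else {Innovation i (fst p) (snd p)})"

lemma sum_source_block_1:
  "(\<Sum>s\<in>source_block L i 1 p. f s) =
    (\<Sum>i'\<in>{..<L} - {i}. f (Fading i' (fst p) (snd p))) + (f (Pilot_noise (fst p) (snd p)) :: 'z::comm_monoid_add)"
proof -
  have "(\<Sum>s\<in>(\<lambda>i'. Fading i' (fst p) (snd p)) ` ({..<L} - {i}). f s) =
      (\<Sum>i'\<in>{..<L} - {i}. f (Fading i' (fst p) (snd p)))"
    by (subst sum.reindex) (auto simp: inj_on_def)
  then show ?thesis
    unfolding source_block_def by (simp, subst sum.insert) (auto simp: add.commute)
qed

lemma entries_law: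
  fixes M :: "'a measure" and \<beta> :: large_scale
  assumes du: "delayed_uplink M \<beta> L K N \<alpha> h z e l n"
    and \<alpha>: "\<alpha> \<noteq> 0" "\<bar>\<alpha>\<bar> \<le> 1" and i: "i < L" and ptr: "ptr > 0" and KN: "K > 0" "N > 0"
    and \<beta>: "\<And>i j. i < L \<Longrightarrow> 0 < \<beta> l i j"
  defines "I \<equiv> {..<K} \<times> {..<N}"
  defines "G \<equiv> \<lambda>\<omega>. \<lambda>p\<in>I. channel_est \<beta> L N ptr (h \<omega>) (z \<omega>) l l (fst p) (n - 1) $ snd p"
    and "E \<equiv> \<lambda>\<omega>. \<lambda>p\<in>I. delay_error \<beta> L N ptr \<alpha> (h \<omega>) (z \<omega>) (e \<omega>) l i (fst p) n $ snd p"
  shows "G \<in> measurable M (PiM I (\<lambda>_. borel))"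
    and "E \<in> measurable M (PiM I (\<lambda>_. borel))"
    and "distr M (PiM I (\<lambda>_. borel) \<Otimes>\<^sub>M PiM I (\<lambda>_. borel)) (\<lambda>\<omega>. (G \<omega>, E \<omega>)) =
      normal_columns K N (\<lambda>j. beta_hat \<beta> L ptr l l j) \<Otimes>\<^sub>M
      normal_columns K N (\<lambda>j. \<beta> l i j - \<alpha>\<^sup>2 * beta_hat \<beta> L ptr l i j)"
proof -
  interpret prob_space M using du by (simp add: delayed_uplink_def)
  let ?src = "\<lambda>s \<omega>. source_val (h \<omega>) (z \<omega>) (e \<omega>) l n s"
  let ?w = "source_weight \<beta> ptr l"
  let ?S = "\<lambda>j. \<Sum>i'<L. \<beta> l i' j"
  have ind: "indep_vars (\<lambda>_. borel) ?src (sources L K N)"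
    and law: "\<And>s. s \<in> sources L K N \<Longrightarrow> distr M borel (?src s) = complex_normal (source_variance \<beta> \<alpha> l s)"
    using du by (auto simp: delayed_uplink_def)
  have I: "finite I" "I \<noteq> {}" using KN by (auto simp: I_def)
  define T where "T s \<omega> = complex_of_real (?w s) * ?src s \<omega>" for s \<omega>
  define \<tau> where "\<tau> s = (?w s)\<^sup>2 * source_variance \<beta> \<alpha> l s" for s
  have indT: "indep_vars (\<lambda>_. borel) T (sources L K N)"
    using indep_vars_compose2[OF ind, of "\<lambda>s x. complex_of_real (?w s) * x" "\<lambda>_. borel"]
    by (simp add: T_def[abs_def])
  have lawT: "distr M borel (T s) = complex_normal (\<tau> s)" if "s \<in> sources L K N" for s
    unfolding T_def[abs_def] \<tau>_def using that ind
    by (intro distr_scale_complex_normal law) (auto simp: indep_vars_def)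
  have \<tau>0: "\<tau> s \<ge> 0" if "s \<in> sources L K N" for s
  proof -
    have "\<alpha>\<^sup>2 \<le> 1" using \<alpha>(2) by (simp add: abs_square_le_1)
    then show ?thesis
      using that \<beta> by (auto simp: \<tau>_def sources_def less_imp_le)
  qed
  let ?B = "source_block L i"
  let ?J = "{0, 1, 2 :: nat} \<times> I"
  have B: "?B c p \<subseteq> sources L K N" "finite (?B c p)" "?B c p \<noteq> {}" if "p \<in> I" for c p
    using that i by (auto simp: source_block_def sources_def I_def)
  have disj: "disjoint_family_on (\<lambda>(c, p). ?B c p) ?J"
    unfolding disjoint_family_on_def
    by (auto simp: source_block_def prod_eq_iff split: if_splits)
  define X where "X = (\<lambda>(c, p) \<omega>. \<Sum>s\<in>?B c p. T s \<omega>)"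
  have "indep_vars (\<lambda>_. borel) (\<lambda>j \<omega>. (\<lambda>(c, p) f. \<Sum>s\<in>?B c p. f s) j
      (restrict (\<lambda>s. T s \<omega>) ((\<lambda>(c, p). ?B c p) j))) ?J"
  proof (rule indep_vars_compose2[OF indep_vars_restrict[OF indT _ disj]])
    show "(case j of (c, p) \<Rightarrow> ?B c p) \<subseteq> sources L K N" if "j \<in> ?J" for j
      using that B by (cases j) auto
    have "(\<lambda>f. \<Sum>s\<in>S. f s) \<in> borel_measurable (PiM S (\<lambda>_. borel :: complex measure))" for S :: "source set"
      by (intro borel_measurable_sum measurable_component_singleton)
    then show "(case j of (c, p) \<Rightarrow> \<lambda>f. \<Sum>s\<in>?B c p. f s :: complex) \<in>
      borel_measurable (PiM (case j of (c, p) \<Rightarrow> ?B c p) (\<lambda>_. borel))" for j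
      by (cases j) simp
  qed
  then have indX: "indep_vars (\<lambda>_. borel) X ?J"
    by (simp add: X_def split_beta' cong: sum.cong)
  define V where "V c p = (\<Sum>s\<in>?B c p. \<tau> s)" for c p
  have lawX: "distr M borel (X (c, p)) = complex_normal (V c p)" if "p \<in> I" for c p
    using B[OF that, of c] lawT \<tau>0 unfolding X_def V_def prod.case
    by (intro distr_sum_complex_normal indep_vars_subset[OF indT]) auto
  \<comment> \<open>\<open>b\<close>, \<open>s\<close> and \<open>d\<close> are the variances of the
    three blocks, \<open>b + s\<close> that of the pilot observation. \<open>c\<close> is the
    estimator gain of cell \<open>l\<close>, whereas \<open>b / (b + s)\<close> is that of cell
    \<open>i\<close>.\<close>
  define b where "b p = \<beta> l i (fst p)" for p :: "nat \<times> nat"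
  define s where "s p = (\<Sum>i'\<in>{..<L} - {i}. \<beta> l i' (fst p)) + 1 / ptr" for p :: "nat \<times> nat"
  define d where "d p = (1 - \<alpha>\<^sup>2) * \<beta> l i (fst p)" for p :: "nat \<times> nat"
  define c where "c p = \<beta> l l (fst p) * inverse (1 / ptr + ?S (fst p))" for p :: "nat \<times> nat"
  have bs: "b p + s p = 1 / ptr + ?S (fst p)" for p
    using i by (simp add: b_def s_def sum.remove[of "{..<L}" i])
  have pos: "b p > 0" "s p > 0" "d p \<ge> 0" for p
  proof -
    show "b p > 0" using \<beta> i by (simp add: b_def)
    have "(\<Sum>i'\<in>{..<L} - {i}. \<beta> l i' (fst p)) \<ge> 0"
      using \<beta> by (intro sum_nonneg) (auto intro: less_imp_le)
    then show "s p > 0" using ptr by (simp add: s_def add_nonneg_pos)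
    have "\<alpha>\<^sup>2 \<le> 1" using \<alpha>(2) by (simp add: abs_square_le_1)
    then show "d p \<ge> 0" using \<beta>[OF i] by (simp add: d_def less_imp_le)
  qed
  have V: "V 0 p = b p" "V 1 p = s p" "V 2 p = d p" for p
  proof -
    show "V 0 p = b p" "V 2 p = d p"
      using \<beta>[OF i] by (auto simp: V_def b_def d_def source_block_def \<tau>_def less_imp_le)
    show "V 1 p = s p"
      unfolding V_def sum_source_block_1 s_def \<tau>_def using \<beta> ptr
      by (auto simp: less_imp_le power_divide intro!: sum.cong)
  qed
  have scale: "(B * inverse Z)\<^sup>2 * Z = B\<^sup>2 / Z" if "Z \<noteq> 0" for B Z :: real
    using that by (simp add: power2_eq_square field_simps)
  have split: "x * y / (x + y) = x - x\<^sup>2 / (x + y)" if "x + y \<noteq> 0" for x y :: real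
    using that by (simp add: power2_eq_square field_simps)
  define A where "A p \<omega> = complex_of_real (c p) * (X (0, p) \<omega> + X (1, p) \<omega>)" for p \<omega>
  define D where "D p \<omega> = complex_of_real \<alpha> * (X (0, p) \<omega> - complex_of_real (b p / (b p + s p)) * (X (0, p) \<omega> + X (1, p) \<omega>)) + X (2, p) \<omega>" for p \<omega>
  have law_pair: "distr M (borel \<Otimes>\<^sub>M borel) (\<lambda>\<omega>. (A p \<omega>, D p \<omega>)) =
      complex_normal (beta_hat \<beta> L ptr l l (fst p)) \<Otimes>\<^sub>M
      complex_normal (\<beta> l i (fst p) - \<alpha>\<^sup>2 * beta_hat \<beta> L ptr l i (fst p))" if p: "p \<in> I" for p
  proof -
    have "distr M (borel \<Otimes>\<^sub>M borel) (\<lambda>\<omega>. (A p \<omega>, D p \<omega>)) =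
      complex_normal ((c p)\<^sup>2 * (b p + s p)) \<Otimes>\<^sub>M complex_normal (\<alpha>\<^sup>2 * (b p * s p / (b p + s p)) + d p)"
      unfolding A_def D_def
      by (rule distr_prediction[OF indX]) (use p pos \<alpha> in \<open>auto simp: lawX V V(2)[unfolded One_nat_def]\<close>)
    moreover have "(c p)\<^sup>2 * (b p + s p) = beta_hat \<beta> L ptr l l (fst p)"
    proof -
      have "b p + s p \<noteq> 0" using pos(1,2)[of p] by linarith
      then show ?thesis
        unfolding c_def beta_hat_def bs[symmetric] add.commute[of "?S (fst p)"]
        by (rule scale)
    qed
    moreover have "\<alpha>\<^sup>2 * (b p * s p / (b p + s p)) + d p = \<beta> l i (fst p) - \<alpha>\<^sup>2 * beta_hat \<beta> L ptr l i (fst p)"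
    proof -
      have ne: "b p + s p \<noteq> 0" using pos(1,2)[of p] by linarith
      have "beta_hat \<beta> L ptr l i (fst p) = (b p)\<^sup>2 / (b p + s p)"
        unfolding bs by (simp add: beta_hat_def b_def add.commute)
      moreover have "b p * s p / (b p + s p) = b p - (b p)\<^sup>2 / (b p + s p)"
        by (rule split[OF ne])
      ultimately have eq: "b p * s p / (b p + s p) = b p - beta_hat \<beta> L ptr l i (fst p)" by simp
      show ?thesis
        unfolding eq by (simp add: d_def b_def algebra_simps)
    qed
    ultimately show ?thesis by simp
  qed
  have ind_pair: "indep_vars (\<lambda>_. borel \<Otimes>\<^sub>M borel) (\<lambda>p \<omega>. (A p \<omega>, D p \<omega>)) I"
  proof -
    let ?Y = "\<lambda>p f. (complex_of_real (c p) * (f (0, p) + f (1, p)),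
      complex_of_real \<alpha> * (f (0, p) - complex_of_real (b p / (b p + s p)) * (f (0, p) + f (1, p))) + f (2 :: nat, p))"
    have "indep_vars (\<lambda>_. borel \<Otimes>\<^sub>M borel) (\<lambda>p \<omega>. ?Y p (restrict (\<lambda>j. X j \<omega>) ({0, 1, 2} \<times> {p}))) I"
    proof (rule indep_vars_compose2[OF indep_vars_restrict[OF indX]])
      fix p :: "nat \<times> nat"
      have [measurable]: "(\<lambda>f. f (0, p)) \<in> borel_measurable (PiM ({0, 1, 2 :: nat} \<times> {p}) (\<lambda>_. borel :: complex measure))"
        "(\<lambda>f. f (1, p)) \<in> borel_measurable (PiM ({0, 1, 2 :: nat} \<times> {p}) (\<lambda>_. borel :: complex measure))"
        "(\<lambda>f. f (2, p)) \<in> borel_measurable (PiM ({0, 1, 2 :: nat} \<times> {p}) (\<lambda>_. borel :: complex measure))"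
        by (auto intro!: measurable_component_singleton)
      show "?Y p \<in> measurable (PiM ({0, 1, 2} \<times> {p}) (\<lambda>_. borel)) (borel \<Otimes>\<^sub>M borel)"
        by measurable
    qed (auto simp: disjoint_family_on_def)
    then show ?thesis by (simp add: A_def D_def)
  qed
  have dims: "h \<omega> l i' j (n - 1) \<in> carrier_vec N" "z \<omega> l j (n - 1) \<in> carrier_vec N" "e \<omega> l i' j n \<in> carrier_vec N"
    if "\<omega> \<in> space M" "i' < L" "j < K" for \<omega> i' j
    using du that unfolding delayed_uplink_def by blast+
  have chan: "channel \<beta> (h \<omega>) l i' j (n - 1) $ a = T (Fading i' j a) \<omega>" if "\<omega> \<in> space M" "i' < L" "j < K" "a < N" for \<omega> i' j a
    using dims[OF that(1-3)] that(4) by (simp add: channel_def T_def)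
  have X01: "(\<Sum>i'<L. channel \<beta> (h \<omega>) l i' j (n - 1) $ a) + complex_of_real (1 / sqrt ptr) * z \<omega> l j (n - 1) $ a =
      X (0, (j, a)) \<omega> + X (1, (j, a)) \<omega>" if "\<omega> \<in> space M" "j < K" "a < N" for \<omega> j a
  proof -
    have "(\<Sum>i'<L. channel \<beta> (h \<omega>) l i' j (n - 1) $ a) = (\<Sum>i'<L. T (Fading i' j a) \<omega>)"
      using chan that by simp
    also have "\<dots> = T (Fading i j a) \<omega> + (\<Sum>i'\<in>{..<L} - {i}. T (Fading i' j a) \<omega>)"
      using i by (simp add: sum.remove[of "{..<L}" i])
    finally show ?thesis
      unfolding X_def prod.case sum_source_block_1 by (simp add: source_block_def T_def)
  qed
  \<comment> \<open>Stated on \<open>space M\<close>, where the dimensions of the random vectors are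
    known.\<close>
  have G_eq: "G \<omega> = (\<lambda>p\<in>I. A p \<omega>)" if "\<omega> \<in> space M" for \<omega>
    unfolding G_def A_def
    by (rule restrict_ext) (use X01[OF that] in \<open>auto simp: I_def channel_est_def c_def\<close>)
  have E_eq: "E \<omega> = (\<lambda>p\<in>I. D p \<omega>)" if \<omega>: "\<omega> \<in> space M" for \<omega>
    unfolding E_def
  proof (rule restrict_ext)
    fix p assume "p \<in> I"
    then obtain j a where p: "p = (j, a)" and ja: "j < K" "a < N" by (auto simp: I_def)
    have est: "channel_est \<beta> L N ptr (h \<omega>) (z \<omega>) l i j (n - 1) $ a = complex_of_real (b p / (b p + s p)) * (X (0, p) \<omega> + X (1, p) \<omega>)"
      using X01[OF \<omega> ja] ja by (simp add: channel_est_def p bs) (simp add: b_def divide_inverse)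
    have dim: "dim_vec (channel_est \<beta> L N ptr (h \<omega>) (z \<omega>) l i j (n - 1)) = N"
      by (simp add: channel_est_def)
    have "delay_error \<beta> L N ptr \<alpha> (h \<omega>) (z \<omega>) (e \<omega>) l i j n $ a =
      complex_of_real \<alpha> * (channel \<beta> (h \<omega>) l i j (n - 1) $ a - channel_est \<beta> L N ptr (h \<omega>) (z \<omega>) l i j (n - 1) $ a) + e \<omega> l i j n $ a"
      using dims[OF \<omega> i ja(1)] ja dim by (simp add: delay_error_def est_error_def)
    also have "\<dots> = D p \<omega>"
      unfolding D_def est chan[OF \<omega> i ja] by (simp add: p X_def source_block_def T_def)
    finally show "delay_error \<beta> L N ptr \<alpha> (h \<omega>) (z \<omega>) (e \<omega>) l i (fst p) n $ snd p = D p \<omega>"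
      by (simp add: p)
  qed
  note unzip = distr_unzip[OF I ind_pair law_pair]
  have U: "(\<lambda>\<omega>. \<lambda>p\<in>I. A p \<omega>) \<in> measurable M (PiM I (\<lambda>_. borel))"
    "(\<lambda>\<omega>. \<lambda>p\<in>I. D p \<omega>) \<in> measurable M (PiM I (\<lambda>_. borel))"
    "distr M (PiM I (\<lambda>_. borel) \<Otimes>\<^sub>M PiM I (\<lambda>_. borel)) (\<lambda>\<omega>. (\<lambda>p\<in>I. A p \<omega>, \<lambda>p\<in>I. D p \<omega>)) =
      normal_columns K N (\<lambda>j. beta_hat \<beta> L ptr l l j) \<Otimes>\<^sub>M
      normal_columns K N (\<lambda>j. \<beta> l i j - \<alpha>\<^sup>2 * beta_hat \<beta> L ptr l i j)"
    unfolding I_def[symmetric] by (rule unzip; simp add: prob_space_complex_normal)+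
  show "G \<in> measurable M (PiM I (\<lambda>_. borel))" "E \<in> measurable M (PiM I (\<lambda>_. borel))"
    using U(1,2) G_eq E_eq by (simp_all cong: measurable_cong)
  show "distr M (PiM I (\<lambda>_. borel) \<Otimes>\<^sub>M PiM I (\<lambda>_. borel)) (\<lambda>\<omega>. (G \<omega>, E \<omega>)) =
      normal_columns K N (\<lambda>j. beta_hat \<beta> L ptr l l j) \<Otimes>\<^sub>M
      normal_columns K N (\<lambda>j. \<beta> l i j - \<alpha>\<^sup>2 * beta_hat \<beta> L ptr l i j)"
    unfolding U(3)[symmetric] by (rule distr_cong) (auto simp: G_eq E_eq)
qed

section \<open>Almost sure convergence\<close>

lemma nn_integral_pair_law:
  assumes [measurable]: "G \<in> measurable M A" "E \<in> measurable M B"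
    and law: "distr M (A \<Otimes>\<^sub>M B) (\<lambda>\<omega>. (G \<omega>, E \<omega>)) = P \<Otimes>\<^sub>M Q"
    and Q: "prob_space Q" "sets P = sets A" "sets Q = sets B"
    and f: "(\<lambda>(x, y). f x y) \<in> borel_measurable (A \<Otimes>\<^sub>M B)"
  shows "(\<integral>\<^sup>+\<omega>. f (G \<omega>) (E \<omega>) \<partial>M) = (\<integral>\<^sup>+x. \<integral>\<^sup>+y. f x y \<partial>Q \<partial>P)"
proof -
  interpret Q: prob_space Q by (rule Q)
  have f': "(\<lambda>(x, y). f x y) \<in> borel_measurable (P \<Otimes>\<^sub>M Q)"
    using f by (simp cong: measurable_cong_sets sets_pair_measure_cong add: Q)
  have "(\<integral>\<^sup>+\<omega>. f (G \<omega>) (E \<omega>) \<partial>M) = (\<integral>\<^sup>+z. (\<lambda>(x, y). f x y) z \<partial>distr M (A \<Otimes>\<^sub>M B) (\<lambda>\<omega>. (G \<omega>, E \<omega>)))"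
    using f by (subst nn_integral_distr) auto
  also have "\<dots> = (\<integral>\<^sup>+x. \<integral>\<^sup>+y. f x y \<partial>Q \<partial>P)"
    unfolding law using f' by (subst Q.nn_integral_fst[symmetric]) auto
  finally show ?thesis .
qed

text \<open>In the Chernoff bound the linear gain beats the quadratic loss for small
  \<open>x\<close>, so each tail is at most \<open>2 * q ^ m\<close> because
  \<open>m \<le> K m\<close>. The factor 2 in the hypothesis is the one of
  \<open>mgf_proj_norm\<close>.\<close>

lemma (in prob_space) AE_tendsto_0_of_mgf:
  fixes Z :: "nat \<Rightarrow> 'a \<Rightarrow> real" and K :: "nat \<Rightarrow> nat" and C t0 :: real
  assumes K: "\<And>m. m \<le> K m" and [measurable]: "\<And>m. Z m \<in> borel_measurable M"
    and t0: "t0 > 0" and C: "C \<ge> 0"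
    and mgf: "\<And>m x. \<bar>x\<bar> \<le> t0 \<Longrightarrow> (\<integral>\<^sup>+\<omega>. ennreal (exp (x * Z m \<omega>)) \<partial>M) \<le> ennreal (2 * exp (C * x\<^sup>2 * real (K m)))"
  shows "AE \<omega> in M. (\<lambda>m. Z m \<omega> / real (K m)) \<longlonglongrightarrow> 0"
proof -
  have conc: "AE \<omega> in M. eventually (\<lambda>m. \<bar>Z m \<omega> / real (K m)\<bar> < \<epsilon>) sequentially" if \<epsilon>: "\<epsilon> > 0" for \<epsilon>
  proof -
    \<comment> \<open>Chosen so that \<open>C * t \<le> \<epsilon> / 2\<close>, whence the exponent
      t \<epsilon> - C t^2 is at least t \<epsilon> / 2. The summand 1 in \<open>C + 1\<close> keeps
      \<open>t\<close> positive when \<open>C = 0\<close>.\<close>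
    define t where "t = min t0 (\<epsilon> / (2 * (C + 1)))"
    have t: "t > 0" "t \<le> t0" using t0 \<epsilon> C by (auto simp: t_def)
    have "C * t \<le> (C + 1) * (\<epsilon> / (2 * (C + 1)))"
      using C t by (intro mult_mono) (auto simp: t_def)
    moreover have "(C + 1) * (\<epsilon> / (2 * (C + 1))) = \<epsilon> / 2" using C by (simp add: divide_simps)
    ultimately have Ct: "C * t \<le> \<epsilon> / 2" by (rule ord_le_eq_trans)
    define q where "q = exp (- (t * \<epsilon> / 2))"
    have q: "0 < q" "q < 1" using t \<epsilon> by (auto simp: q_def)
    have tail: "prob {\<omega> \<in> space M. \<epsilon> * real (K m) \<le> s * Z m \<omega>} \<le> 2 * q ^ m" if s: "\<bar>s\<bar> = 1" for s m
    proof -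
      have "emeasure M {\<omega> \<in> space M. \<epsilon> * real (K m) \<le> s * Z m \<omega>} \<le>
          ennreal (exp (- t * (\<epsilon> * real (K m)))) * (\<integral>\<^sup>+\<omega>. ennreal (exp (t * (s * Z m \<omega>))) * indicator (space M) \<omega> \<partial>M)"
        using Chernoff_ineq_nn_integral_ge[of t "space M" M "\<lambda>\<omega>. s * Z m \<omega>" "\<epsilon> * real (K m)"] t by simp
      also have "(\<integral>\<^sup>+\<omega>. ennreal (exp (t * (s * Z m \<omega>))) * indicator (space M) \<omega> \<partial>M) =
          (\<integral>\<^sup>+\<omega>. ennreal (exp ((t * s) * Z m \<omega>)) \<partial>M)"
        by (intro nn_integral_cong) (simp add: mult.assoc)
      also have "ennreal (exp (- t * (\<epsilon> * real (K m)))) * \<dots> \<le>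
          ennreal (exp (- t * (\<epsilon> * real (K m)))) * ennreal (2 * exp (C * (t * s)\<^sup>2 * real (K m)))"
        using t s by (intro mult_left_mono mgf) (auto simp: abs_mult)
      also have "\<dots> = ennreal (2 * exp (- (t * \<epsilon> - C * t\<^sup>2) * real (K m)))"
      proof -
        have "s\<^sup>2 = 1" using s by (simp add: abs_square_eq_1)
        then have "exp (- t * (\<epsilon> * real (K m))) * (2 * exp (C * (t * s)\<^sup>2 * real (K m))) =
            2 * exp (- (t * \<epsilon> - C * t\<^sup>2) * real (K m))"
          by (simp add: mult_exp_exp power_mult_distrib algebra_simps)
        then show ?thesis by (simp add: ennreal_mult''[symmetric])
      qed
      also have "\<dots> \<le> ennreal (2 * q ^ m)"
      proof -
        have ge: "t * \<epsilon> / 2 \<le> t * \<epsilon> - C * t\<^sup>2"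
        proof -
          have "t * (C * t) \<le> t * (\<epsilon> / 2)" using Ct t(1) by (intro mult_left_mono) auto
          moreover have "C * t\<^sup>2 = t * (C * t)" by (simp add: power2_eq_square)
          moreover have "t * (\<epsilon> / 2) = t * \<epsilon> / 2" "t * \<epsilon> / 2 + t * \<epsilon> / 2 = t * \<epsilon>" by simp_all
          ultimately show ?thesis by linarith
        qed
        have "0 \<le> t * \<epsilon> / 2" using t(1) \<epsilon> by simp
        then have "0 \<le> t * \<epsilon> - C * t\<^sup>2" using ge by (rule order_trans)
        then have "(t * \<epsilon> / 2) * real m \<le> (t * \<epsilon> - C * t\<^sup>2) * real (K m)"
          by - (rule mult_mono[OF ge], simp add: K, assumption, simp)
        then have "exp (- (t * \<epsilon> - C * t\<^sup>2) * real (K m)) \<le> exp (real m * (- (t * \<epsilon> / 2)))"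
          by (simp only: exp_le_cancel_iff mult_minus_left mult_minus_right neg_le_iff_le mult.commute[of "real m"])
        also have "\<dots> = q ^ m" by (simp only: q_def exp_of_nat_mult)
        finally show ?thesis by (intro ennreal_leI) simp
      qed
      finally show ?thesis
        using q by (simp add: emeasure_eq_measure)
    qed
    define A where "A m = {\<omega> \<in> space M. \<epsilon> * real (K m) \<le> \<bar>Z m \<omega>\<bar>}" for m
    have A [measurable]: "A m \<in> events" for m unfolding A_def by measurable
    have PA: "prob (A m) \<le> 4 * q ^ m" for m
    proof -
      have "prob (A m) \<le> prob ({\<omega> \<in> space M. \<epsilon> * real (K m) \<le> 1 * Z m \<omega>} \<union> {\<omega> \<in> space M. \<epsilon> * real (K m) \<le> (-1) * Z m \<omega>})"
        by (rule finite_measure_mono) (auto simp: A_def abs_if)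
      also have "\<dots> \<le> prob {\<omega> \<in> space M. \<epsilon> * real (K m) \<le> 1 * Z m \<omega>} + prob {\<omega> \<in> space M. \<epsilon> * real (K m) \<le> (-1) * Z m \<omega>}"
        by (rule measure_Un_le) measurable
      also have "\<dots> \<le> 2 * q ^ m + 2 * q ^ m"
        by (intro add_mono tail) auto
      finally show ?thesis by simp
    qed
    have "summable (\<lambda>m. prob (A m))"
    proof (rule summable_comparison_test')
      show "summable (\<lambda>m. 4 * q ^ m)"
        using q by (intro summable_mult summable_geometric) simp
    qed (use PA in auto)
    then have "AE \<omega> in M. eventually (\<lambda>m. \<omega> \<in> space M - A m) sequentially"
      by (intro borel_cantelli_AE1) (auto simp: emeasure_eq_measure)
    then show ?thesis
    proof eventually_elim
      case (elim \<omega>)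
      then show ?case
        using eventually_gt_at_top[of 0]
      proof eventually_elim
        case (elim m)
        then have "\<bar>Z m \<omega>\<bar> < \<epsilon> * real (K m)" "K m > 0" using K[of m] by (auto simp: A_def)
        then show ?case by (simp add: field_simps)
      qed
    qed
  qed
  \<comment> \<open>The exceptional null set depends on \<epsilon>, so \<epsilon> runs through the
    countably many values 1 / (p + 1).\<close>
  have "AE \<omega> in M. \<forall>p::nat. eventually (\<lambda>m. \<bar>Z m \<omega> / real (K m)\<bar> < 1 / real (Suc p)) sequentially"
    by (subst AE_all_countable) (intro allI conc, simp)
  then show ?thesis
  proof eventually_elim
    case (elim \<omega>)
    show ?case
    proof (rule tendstoI)
      fix \<epsilon> :: real assume "\<epsilon> > 0"
      then obtain p where "1 / real (Suc p) < \<epsilon>"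
        using nat_approx_posE by blast
      then show "eventually (\<lambda>m. dist (Z m \<omega> / real (K m)) 0 < \<epsilon>) sequentially"
        using elim by (auto elim!: allE[where x = p] eventually_mono simp del: of_nat_Suc)
    qed
  qed
qed

text \<open>The direction of the zero-forcing row, with a coordinate vector as default. It thus has
  norm 1 for every array, and \<open>mgf_combined_columns\<close> applies on each fibre without a
  case distinction.\<close>

definition unit_row :: "nat \<Rightarrow> nat \<Rightarrow> nat \<Rightarrow> (nat \<times> nat \<Rightarrow> complex) \<Rightarrow> nat \<Rightarrow> complex" where
  "unit_row K N k \<omega> a =
     (let q = (\<Sum>b<N. (cmod (zf_row K N k \<omega> b))\<^sup>2)
      in if q = 0 then (if a = 0 then 1 else 0) else zf_row K N k \<omega> a / complex_of_real (sqrt q))"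

lemma unit_row_norm:
  assumes "N > 0"
  shows "(\<Sum>a<N. (cmod (unit_row K N k \<omega> a))\<^sup>2) = 1"
proof -
  define q where "q = (\<Sum>b<N. (cmod (zf_row K N k \<omega> b))\<^sup>2)"
  have "q \<ge> 0" by (simp add: q_def sum_nonneg)
  show ?thesis
  proof (cases "q = 0")
    case True
    then have "(\<Sum>a<N. (cmod (unit_row K N k \<omega> a))\<^sup>2) = (\<Sum>a<N. if a = 0 then 1 else 0)"
      unfolding unit_row_def q_def[symmetric] by (intro sum.cong) (auto simp: Let_def)
    then show ?thesis using assms by simp
  next
    case False
    then have "(\<Sum>a<N. (cmod (unit_row K N k \<omega> a))\<^sup>2) = (\<Sum>a<N. (cmod (zf_row K N k \<omega> a))\<^sup>2 / q)"
      unfolding unit_row_def q_def[symmetric] using \<open>q \<ge> 0\<close>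
      by (intro sum.cong) (auto simp: Let_def norm_divide power_divide)
    also have "\<dots> = 1"
      using False by (simp add: sum_divide_distrib[symmetric] q_def[symmetric])
    finally show ?thesis .
  qed
qed

lemma measurable_unit_row:
  assumes "k < K" and "\<And>j a. j < K \<Longrightarrow> a < N \<Longrightarrow> (\<lambda>x. \<omega> x (j, a)) \<in> borel_measurable M" and "a < N"
  shows "(\<lambda>x. unit_row K N k (\<omega> x) a) \<in> borel_measurable M"
proof -
  have z: "(\<lambda>x. zf_row K N k (\<omega> x) b) \<in> borel_measurable M" if "b < N" for b
    by (rule measurable_zf_row(2)[OF assms(1) _ that]) (rule assms(2))
  have [measurable]: "(\<lambda>x. \<Sum>b<N. (cmod (zf_row K N k (\<omega> x) b))\<^sup>2) \<in> borel_measurable M"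
    by (intro borel_measurable_sum borel_measurable_power measurable_compose[OF z borel_measurable_norm]) auto
  have [measurable]: "(\<lambda>x. zf_row K N k (\<omega> x) a) \<in> borel_measurable M" by (rule z[OF assms(3)])
  show ?thesis
    unfolding unit_row_def Let_def by measurable
qed

lemma quotient_tendsto_0:
  fixes x y T U w :: "nat \<Rightarrow> real" and c C Y \<delta> :: real
  assumes xy: "(\<lambda>m. x m - y m) \<longlonglongrightarrow> 0" and TU: "(\<lambda>m. T m - U m) \<longlonglongrightarrow> 0" and w: "w \<longlonglongrightarrow> 0"
    and Y: "\<And>m. \<bar>y m\<bar> \<le> Y" and \<delta>: "\<delta> > 0" "\<And>m. \<delta> \<le> c * C * y m + U m"
  shows "(\<lambda>m. c * x m / (c * C * x m + T m + w m) - c * y m / (c * C * y m + U m)) \<longlonglongrightarrow> 0"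
proof -
  define p where "p m = c * C * x m + T m + w m" for m
  define r where "r m = c * C * y m + U m" for m
  have pr: "(\<lambda>m. p m - r m) \<longlonglongrightarrow> 0"
  proof -
    have "(\<lambda>m. c * C * (x m - y m) + (T m - U m) + w m) \<longlonglongrightarrow> c * C * 0 + 0 + 0"
      by (intro tendsto_intros xy TU w)
    then show ?thesis by (simp add: p_def r_def algebra_simps)
  qed
  have ev: "eventually (\<lambda>m. p m \<ge> \<delta> / 2) sequentially"
  proof -
    have "eventually (\<lambda>m. dist (p m - r m) 0 < \<delta> / 2) sequentially"
      using pr \<delta>(1) by (intro tendstoD) auto
    then show ?thesis
      by eventually_elim (use \<delta>(2) in \<open>auto simp: r_def dist_real_def abs_less_iff field_simps\<close>, smt (verit) \<delta>(2))
  qed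
  have lim: "(\<lambda>m. \<bar>c\<bar> * \<bar>x m - y m\<bar> * (2 / \<delta>) + \<bar>c\<bar> * Y * \<bar>p m - r m\<bar> * (2 / \<delta>) * (1 / \<delta>)) \<longlonglongrightarrow> 0"
  proof -
    have "(\<lambda>m. \<bar>c\<bar> * \<bar>x m - y m\<bar> * (2 / \<delta>) + \<bar>c\<bar> * Y * \<bar>p m - r m\<bar> * (2 / \<delta>) * (1 / \<delta>)) \<longlonglongrightarrow>
        \<bar>c\<bar> * \<bar>0\<bar> * (2 / \<delta>) + \<bar>c\<bar> * Y * \<bar>0\<bar> * (2 / \<delta>) * (1 / \<delta>)"
      by (intro tendsto_intros xy pr)
    then show ?thesis by simp
  qed
  have "(\<lambda>m. c * x m / p m - c * y m / r m) \<longlonglongrightarrow> 0"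
  proof (rule Lim_null_comparison[OF _ lim])
    show "eventually (\<lambda>m. norm (c * x m / p m - c * y m / r m) \<le>
      \<bar>c\<bar> * \<bar>x m - y m\<bar> * (2 / \<delta>) + \<bar>c\<bar> * Y * \<bar>p m - r m\<bar> * (2 / \<delta>) * (1 / \<delta>)) sequentially"
      using ev
    proof eventually_elim
      case (elim m)
      have r: "r m \<ge> \<delta>" using \<delta>(2) by (simp add: r_def)
      have pos: "p m > 0" "r m > 0" using elim r \<delta>(1) by linarith+
      have inv: "1 / p m \<le> 2 / \<delta>" "1 / r m \<le> 1 / \<delta>"
        using elim r \<delta>(1) pos by (auto simp: field_simps)
      have "c * x m / p m - c * y m / r m = c * (x m - y m) * (1 / p m) - c * y m * (p m - r m) * (1 / p m) * (1 / r m)"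
        using pos by (simp add: field_simps)
      then have "norm (c * x m / p m - c * y m / r m) \<le>
        \<bar>c * (x m - y m) * (1 / p m)\<bar> + \<bar>c * y m * (p m - r m) * (1 / p m) * (1 / r m)\<bar>"
        by (simp only: real_norm_def abs_triangle_ineq4)
      also have "\<dots> = \<bar>c\<bar> * \<bar>x m - y m\<bar> * (1 / p m) + \<bar>c\<bar> * \<bar>y m\<bar> * \<bar>p m - r m\<bar> * (1 / p m) * (1 / r m)"
        using pos by (simp add: abs_mult)
      also have "\<dots> \<le> \<bar>c\<bar> * \<bar>x m - y m\<bar> * (2 / \<delta>) + \<bar>c\<bar> * Y * \<bar>p m - r m\<bar> * (2 / \<delta>) * (1 / \<delta>)"
        using inv Y[of m] pos \<delta>(1) by (intro add_mono mult_mono) auto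
      finally show ?case .
    qed
  qed
  then show ?thesis by (simp add: p_def r_def)
qed

section \<open>Zero-forcing SINR\<close>

lemma mat_trace_D_tilde:
  "mat_trace (D_tilde \<beta> L K ptr \<alpha> l i) = (\<Sum>j<K. \<beta> l i j - \<alpha>\<^sup>2 * beta_hat \<beta> L ptr l i j)"
  by (simp add: mat_trace_def D_tilde_def diag_mat_def mat_diag_def sum_list_sum_nth lessThan_atLeast0)

lemma row_mult_index:
  "j < dim_col A \<Longrightarrow> dim_row A = N \<Longrightarrow> row_mult (Matrix.vec N r) A $ j = (\<Sum>a<N. r a * A $$ (a, j))"
  by (simp add: row_mult_def scalar_prod_def lessThan_atLeast0)

lemma norm_vec_row_mult:
  assumes "dim_row A = N"
  shows "(norm_vec (row_mult (Matrix.vec N r) A))\<^sup>2 = (\<Sum>j<dim_col A. (cmod (\<Sum>a<N. r a * A $$ (a, j)))\<^sup>2)"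
proof -
  have "dim_vec (row_mult (Matrix.vec N r) A) = dim_col A"
    by (simp add: row_mult_def)
  then show ?thesis
    using assms by (simp add: norm_vec_def sum_nonneg row_mult_index)
qed

text \<open>With q the squared norm of the row, numerator and denominator are divided by
  \<open>pr * q * K\<close>, which leaves \<open>x = 1 / (q * K)\<close>. All cells are estimated
  from one pilot observation, so the estimate of cell \<open>i\<close> is \<open>G\<close> with
  column \<open>j\<close> scaled by \<open>\<beta> l i j / \<beta> l l j\<close>, and the
  interference is deterministic.\<close>

lemma zf_sinr_eq:
  fixes c :: real
  assumes k: "k < K" and N: "N > 0" and l: "l < L" and pr: "pr > 0"
    and \<beta>: "\<And>i j. i < L \<Longrightarrow> 0 < \<beta> l i j"
    and G: "\<And>j a. j < K \<Longrightarrow> a < N \<Longrightarrow> G (j, a) = channel_est \<beta> L N ptr h z l l j (n - 1) $ a"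
    and E: "\<And>i j a. i < L \<Longrightarrow> j < K \<Longrightarrow> a < N \<Longrightarrow> E i (j, a) = delay_error \<beta> L N ptr \<alpha> h z e l i j n $ a"
    and det: "det (gram K N G) \<noteq> 0"
  defines "x \<equiv> ((\<Sum>a<N. (cmod (G (k, a)))\<^sup>2) - proj_norm K N c k G) / real K"
    and "T \<equiv> (\<Sum>i<L. (\<Sum>j<K. (cmod (\<Sum>a<N. unit_row K N k G a * E i (j, a)))\<^sup>2) / real K)"
    and "C \<equiv> (\<Sum>i\<in>{..<L} - {l}. (\<beta> l i k / \<beta> l l k)\<^sup>2)"
  shows "zf_sinr \<beta> L K N pr ptr \<alpha> h z e l k n = \<alpha>\<^sup>2 * x / (\<alpha>\<^sup>2 * C * x + T + 1 / (pr * real K))"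
proof -
  define q where "q = (\<Sum>a<N. (cmod (zf_row K N k G a))\<^sup>2)"
  have q: "q > 0" unfolding q_def by (rule zf_row_norm_pos[OF det k])
  let ?r = "Matrix.vec N (zf_row K N k G)"
  let ?Q = "\<lambda>i. \<Sum>j<K. (cmod (\<Sum>a<N. unit_row K N k G a * E i (j, a)))\<^sup>2"
  have est: "est_mat \<beta> L K N ptr h z l l (n - 1) = Matrix.mat N K (\<lambda>(a, j). G (j, a))"
    by (rule eq_matI) (auto simp: est_mat_def G)
  have row: "Matrix.row (pseudo_inverse (est_mat \<beta> L K N ptr h z l l (n - 1))) k = ?r"
    unfolding est by (rule pseudo_inverse_row[OF det k])
  have nr: "(norm_vec ?r)\<^sup>2 = q"
    by (simp add: norm_vec_def q_def sum_nonneg)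
  have interference: "(norm_vec (row_mult ?r (est_mat \<beta> L K N ptr h z l i (n - 1))))\<^sup>2 = (\<beta> l i k / \<beta> l l k)\<^sup>2"
    if i: "i < L" for i
  proof -
    have "est_mat \<beta> L K N ptr h z l i (n - 1) $$ (a, j) = complex_of_real (\<beta> l i j / \<beta> l l j) * G (j, a)"
      if "j < K" "a < N" for j a
      using that \<beta>[OF l, of j] by (simp add: est_mat_def G channel_est_def)
    then have "(\<Sum>a<N. zf_row K N k G a * est_mat \<beta> L K N ptr h z l i (n - 1) $$ (a, j)) =
        complex_of_real (\<beta> l i j / \<beta> l l j) * (\<Sum>a<N. zf_row K N k G a * G (j, a))" if "j < K" for j
      using that unfolding sum_distrib_left by (intro sum.cong) auto
    also have "\<dots> j = (if j = k then complex_of_real (\<beta> l i k / \<beta> l l k) else 0)" if "j < K" for j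
      using zf_row_dual[OF det k that] by simp
    finally have "(norm_vec (row_mult ?r (est_mat \<beta> L K N ptr h z l i (n - 1))))\<^sup>2 =
        (\<Sum>j<K. (cmod (if j = k then complex_of_real (\<beta> l i k / \<beta> l l k) else 0))\<^sup>2)"
      by (subst norm_vec_row_mult) (simp_all add: est_mat_def)
    also have "\<dots> = (\<Sum>j<K. if j = k then (\<beta> l i k / \<beta> l l k)\<^sup>2 else 0)"
      by (intro sum.cong) (auto simp: norm_divide power_divide)
    finally show ?thesis using k by simp
  qed
  have error: "(norm_vec (row_mult ?r (delay_error_mat \<beta> L K N ptr \<alpha> h z e l i n)))\<^sup>2 = q * ?Q i"
    if i: "i < L" for i
  proof -
    have u: "zf_row K N k G a = complex_of_real (sqrt q) * unit_row K N k G a" for a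
      using q unfolding unit_row_def q_def[symmetric] by simp
    have "(\<Sum>a<N. zf_row K N k G a * delay_error_mat \<beta> L K N ptr \<alpha> h z e l i n $$ (a, j)) =
        complex_of_real (sqrt q) * (\<Sum>a<N. unit_row K N k G a * E i (j, a))" if "j < K" for j
      using that i unfolding sum_distrib_left by (intro sum.cong) (auto simp: u delay_error_mat_def E)
    then have "(norm_vec (row_mult ?r (delay_error_mat \<beta> L K N ptr \<alpha> h z e l i n)))\<^sup>2 =
        (\<Sum>j<K. (cmod (complex_of_real (sqrt q) * (\<Sum>a<N. unit_row K N k G a * E i (j, a))))\<^sup>2)"
      by (subst norm_vec_row_mult) (simp_all add: delay_error_mat_def)
    also have "\<dots> = (\<Sum>j<K. q * (cmod (\<Sum>a<N. unit_row K N k G a * E i (j, a)))\<^sup>2)"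
      using q by (intro sum.cong refl) (simp only: norm_mult power_mult_distrib norm_of_real power2_abs real_sqrt_pow2 less_imp_le)
    finally show ?thesis by (simp add: sum_distrib_left)
  qed
  have K: "real K > 0" using k by simp
  have x: "x = 1 / (q * real K)"
    using det by (simp add: x_def proj_norm_def q_def)
  have T: "(\<Sum>i<L. ?Q i) = real K * T"
    using K by (simp add: T_def sum_divide_distrib[symmetric])
  have "zf_sinr \<beta> L K N pr ptr \<alpha> h z e l k n = \<alpha>\<^sup>2 * pr / (\<alpha>\<^sup>2 * pr * C + pr * (\<Sum>i<L. q * ?Q i) + q)"
    unfolding zf_sinr_def row Let_def nr C_def by (simp add: interference error)
  also have "(\<Sum>i<L. q * ?Q i) = q * (real K * T)"
    by (simp add: sum_distrib_left[symmetric] T)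
  also have "\<alpha>\<^sup>2 * pr / (\<alpha>\<^sup>2 * pr * C + pr * (q * (real K * T)) + q) =
      (\<alpha>\<^sup>2 * pr / (pr * q * real K)) / ((\<alpha>\<^sup>2 * pr * C + pr * (q * (real K * T)) + q) / (pr * q * real K))"
    using q K pr by simp
  also have "\<alpha>\<^sup>2 * pr / (pr * q * real K) = \<alpha>\<^sup>2 * x"
    using q K pr by (simp add: x)
  also have "(\<alpha>\<^sup>2 * pr * C + pr * (q * (real K * T)) + q) / (pr * q * real K) = \<alpha>\<^sup>2 * C * x + T + 1 / (pr * real K)"
    using q K pr by (simp add: x add_divide_distrib)
  finally show ?thesis .
qed

text \<open>The third bound is monotonicity in the pilot energy; at \<open>ptr0 = pr\<close> it
  bounds the estimate variance below, uniformly in the pilot length.\<close>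

lemma beta_hat_bounds:
  assumes \<beta>: "\<And>i j. i < L \<Longrightarrow> 0 < \<beta> l i j" and i: "i < L" and ptr: "ptr > 0"
  shows "0 < beta_hat \<beta> L ptr l i j" and "beta_hat \<beta> L ptr l i j \<le> \<beta> l i j"
    and "ptr0 > 0 \<Longrightarrow> ptr0 \<le> ptr \<Longrightarrow> (\<beta> l i j)\<^sup>2 / ((\<Sum>i'<L. \<beta> l i' j) + 1 / ptr0) \<le> beta_hat \<beta> L ptr l i j"
proof -
  let ?S = "\<Sum>i'<L. \<beta> l i' j"
  have S: "\<beta> l i j \<le> ?S"
    using \<beta> i by (intro member_le_sum) (auto intro: less_imp_le)
  have pos: "\<beta> l i j > 0" "?S > 0" "?S + 1 / ptr > 0"
    using \<beta>[OF i, of j] S ptr by (auto intro: add_pos_pos less_le_trans)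
  show "0 < beta_hat \<beta> L ptr l i j"
    using pos by (simp add: beta_hat_def)
  have "(\<beta> l i j)\<^sup>2 \<le> \<beta> l i j * (?S + 1 / ptr)"
    unfolding power2_eq_square using S pos ptr by (intro mult_left_mono add_increasing2) auto
  then show "beta_hat \<beta> L ptr l i j \<le> \<beta> l i j"
    using pos by (simp add: beta_hat_def pos_divide_le_eq)
  show "(\<beta> l i j)\<^sup>2 / (?S + 1 / ptr0) \<le> beta_hat \<beta> L ptr l i j" if "ptr0 > 0" "ptr0 \<le> ptr"
    unfolding beta_hat_def using pos that by (intro divide_left_mono add_left_mono) (auto simp: frac_le add_pos_pos)
qed

text \<open>\<open>m\<close> numbers systems whose size grows along a strictly increasing
  \<open>K\<close>, while the cell, the terminal and the symbol time stay fixed; the pilot length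
  may vary with \<open>m\<close>. Boundedness of \<beta> makes the tails uniform. For
  \<open>L = 1\<close> the factor C of the equivalent is 0, for \<kappa> = 1 the factor \<kappa> - 1
  is; its denominator then consists of the trace term alone, whose lower bound is asked in these
  cases.\<close>

theorem theorem4:
  fixes M :: "'a measure" and \<beta> :: large_scale
    and L l k :: nat and n :: int
    and K N \<tau> :: "nat \<Rightarrow> nat"
    and pr \<kappa> fD Ts \<alpha> :: real
    and h e :: "nat \<Rightarrow> 'a \<Rightarrow> fading" and z :: "nat \<Rightarrow> 'a \<Rightarrow> pilot_noise"
  assumes "l < L" and "\<And>m. k < K m"
    and "strict_mono K" and "\<And>m. K m \<le> N m" and "\<And>m. real (N m) = \<kappa> * real (K m)"
    and "pr > 0" and "\<And>m. K m \<le> \<tau> m"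
    and "0 \<le> fD" and "0 < Ts" and "\<alpha> = bessel_J0 (2 * pi * fD * Ts)"
    and "\<And>i j. i < L \<Longrightarrow> 0 < \<beta> l i j"
    and "\<exists>B. \<forall>i<L. \<forall>j. \<beta> l i j \<le> B"
    and "L = 1 \<or> \<kappa> = 1 \<Longrightarrow>
      \<exists>\<delta>>0. \<forall>m. \<delta> \<le> (\<Sum>i<L. 1 / real (K m) *
        mat_trace (D_tilde \<beta> L (K m) (real (\<tau> m) * pr) \<alpha> l i))"
    and "\<And>m. delayed_uplink M \<beta> L (K m) (N m) \<alpha> (h m) (z m) (e m) l n"
  shows "AE \<omega> in M.
    (\<lambda>m. zf_sinr \<beta> L (K m) (N m) pr (real (\<tau> m) * pr) \<alpha> (h m \<omega>) (z m \<omega>) (e m \<omega>) l k n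
       - zf_sinr_det \<beta> L (K m) \<kappa> (real (\<tau> m) * pr) \<alpha> l k) \<longlonglongrightarrow> 0"
proof (cases "\<alpha> = 0")
  \<comment> \<open>Both numerators carry the factor \<alpha>^2, so both quotients are 0.\<close>
  case True
  then show ?thesis
    by (simp add: zf_sinr_def zf_sinr_det_def Let_def)
next
  case False
  note l = assms(1) and k = assms(2) and KN = assms(4) and N\<kappa> = assms(5) and pr = assms(6)
    and K\<tau> = assms(7) and \<beta> = assms(11) and du = assms(14)
  interpret prob_space M using du[of 0] by (simp add: delayed_uplink_def)
  have \<alpha>1: "\<bar>\<alpha>\<bar> \<le> 1" using abs_bessel_J0_le_1 by (simp add: assms(10))
  have K0: "K m > 0" and N0: "N m > 0" for m using k[of m] KN[of m] by auto
  have Km: "m \<le> K m" for m by (rule strict_mono_imp_increasing[OF assms(3)])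
  have \<kappa>: "\<kappa> \<ge> 1" using KN[of 0] N\<kappa>[of 0] K0[of 0] by (metis mult_le_cancel_right1 of_nat_0_less_iff of_nat_mono not_less)

  \<comment> \<open>Bounds on the variances, uniform in system size and terminal\<close>
  define ptr where "ptr m = real (\<tau> m) * pr" for m
  have ptr: "ptr m > 0" "pr \<le> ptr m" for m
    using K0[of m] K\<tau>[of m] pr by (auto simp: ptr_def)
  obtain B where "\<forall>i<L. \<forall>j. \<beta> l i j \<le> B" using assms(12) by blast
  then have B: "\<beta> l i j \<le> B" if "i < L" for i j using that by blast
  have B0: "B > 0" using B[OF l, of 0] \<beta>[OF l, of 0] by linarith
  define v where "v m j = beta_hat \<beta> L (ptr m) l l j" for m j
  define d where "d m i j = \<beta> l i j - \<alpha>\<^sup>2 * beta_hat \<beta> L (ptr m) l i j" for m i j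
  have v: "0 < v m j" "v m j \<le> B" for m j
    unfolding v_def
    using beta_hat_bounds(1)[where \<beta> = \<beta>, OF \<beta> l ptr(1), of m j]
      order_trans[OF beta_hat_bounds(2)[where \<beta> = \<beta>, OF \<beta> l ptr(1), of m j] B[OF l]]
    by auto
  have d: "0 \<le> d m i j" "d m i j \<le> B" if "i < L" for m i j
  proof -
    note bh = beta_hat_bounds[where \<beta> = \<beta>, OF \<beta> that ptr(1)[of m], where j = j]
    have "\<alpha>\<^sup>2 \<le> 1" using \<alpha>1 by (simp add: abs_square_le_1)
    then have "\<alpha>\<^sup>2 * beta_hat \<beta> L (ptr m) l i j \<le> 1 * \<beta> l i j"
      using bh by (intro mult_mono) auto
    then show "0 \<le> d m i j" by (simp add: d_def)
    have "0 \<le> \<alpha>\<^sup>2 * beta_hat \<beta> L (ptr m) l i j" using bh by simp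
    then show "d m i j \<le> B" using B[OF that, of j] by (simp add: d_def)
  qed

  \<comment> \<open>Joint laws of estimate and delay error along the sequence of systems\<close>
  let ?I = "\<lambda>m. {..<K m} \<times> {..<N m}"
  define G where "G m \<omega> = (\<lambda>p\<in>?I m. channel_est \<beta> L (N m) (ptr m) (h m \<omega>) (z m \<omega>) l l (fst p) (n - 1) $ snd p)" for m \<omega>
  define E where "E m i \<omega> = (\<lambda>p\<in>?I m. delay_error \<beta> L (N m) (ptr m) \<alpha> (h m \<omega>) (z m \<omega>) (e m \<omega>) l i (fst p) n $ snd p)" for m i \<omega>
  note laws = entries_law[where \<beta> = \<beta>, OF du False \<alpha>1 _ ptr(1) K0 N0 \<beta>]
  have G_meas: "G m \<in> measurable M (PiM (?I m) (\<lambda>_. borel))" for m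
    unfolding G_def by (rule laws(1)[OF l])
  have E_meas: "E m i \<in> measurable M (PiM (?I m) (\<lambda>_. borel))" if "i < L" for m i
    unfolding E_def by (rule laws(2)[OF that])
  have law: "distr M (PiM (?I m) (\<lambda>_. borel) \<Otimes>\<^sub>M PiM (?I m) (\<lambda>_. borel)) (\<lambda>\<omega>. (G m \<omega>, E m i \<omega>)) =
      normal_columns (K m) (N m) (v m) \<Otimes>\<^sub>M normal_columns (K m) (N m) (d m i)" if "i < L" for m i
    unfolding G_def E_def v_def d_def by (rule laws(3)[OF that])
  have ps: "prob_space (normal_columns K' N' v')" for K' N' v'
    by (intro prob_space_PiM prob_space_complex_normal)
  have pair: "(\<integral>\<^sup>+\<omega>. f (G m \<omega>) (E m i \<omega>) \<partial>M) =
      (\<integral>\<^sup>+x. \<integral>\<^sup>+y. f x y \<partial>normal_columns (K m) (N m) (d m i) \<partial>normal_columns (K m) (N m) (v m))"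
    if "i < L" "(\<lambda>(x, y). f x y) \<in> borel_measurable (PiM (?I m) (\<lambda>_. borel) \<Otimes>\<^sub>M PiM (?I m) (\<lambda>_. borel))" for f i m
    by (rule nn_integral_pair_law[OF G_meas E_meas[OF that(1)] law[OF that(1)] ps])
      (use that(2) in \<open>simp_all add: sets_PiM_complex_normal\<close>)
  have single: "(\<integral>\<^sup>+\<omega>. f (G m \<omega>) \<partial>M) = (\<integral>\<^sup>+x. f x \<partial>normal_columns (K m) (N m) (v m))"
    if [measurable]: "f \<in> borel_measurable (PiM (?I m) (\<lambda>_. borel))" for f m
  proof -
    have "(\<integral>\<^sup>+\<omega>. f (G m \<omega>) \<partial>M) =
      (\<integral>\<^sup>+x. \<integral>\<^sup>+y. f x \<partial>normal_columns (K m) (N m) (d m l) \<partial>normal_columns (K m) (N m) (v m))"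
      by (rule pair[of l "\<lambda>x y. f x" m, OF l]) measurable
    then show ?thesis
      using prob_space.emeasure_space_1[OF ps] by simp
  qed
  have comp: "(\<lambda>x. x (j, a)) \<in> borel_measurable (PiM (?I m) (\<lambda>_. borel :: complex measure))" if "j < K m" "a < N m" for j a m
    using that by (intro measurable_component_singleton) auto

  \<comment> \<open>\<open>R1\<close> and \<open>R2\<close> are the fluctuations of the two parts of
    1 / |r|^2, the squared norm of column \<open>k\<close> and that of its projection;
    \<open>R3\<close> is the fluctuation of the delay errors of one cell.\<close>
  define R1 where "R1 m \<omega> = (\<Sum>a<N m. (cmod (G m \<omega> (k, a)))\<^sup>2) - real (N m) * v m k" for m \<omega>
  define R2 where "R2 m \<omega> = proj_norm (K m) (N m) (v m k) k (G m \<omega>) - real (K m - 1) * v m k" for m \<omega>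
  define R3 where "R3 i m \<omega> = (\<Sum>j<K m. (cmod (\<Sum>a<N m. unit_row (K m) (N m) k (G m \<omega>) a * E m i \<omega> (j, a)))\<^sup>2)
    - (\<Sum>j<K m. d m i j)" for i m \<omega>
  \<comment> \<open>For \<open>\<bar>x\<bar> \<le> t0\<close> and variances up to \<open>B\<close>
    all products are at most 1 / 2, as the moment bounds require. \<open>Cb\<close> is 2 times the
    bound \<kappa> B^2 on the sum of squared variances per terminal.\<close>
  define t0 where "t0 = 1 / (2 * B)"
  define Cb where "Cb = 2 * \<kappa> * B\<^sup>2"
  have t0: "t0 > 0" using B0 by (simp add: t0_def)
  have Cb: "Cb \<ge> 0" using \<kappa> by (simp add: Cb_def)
  have small: "\<bar>x * y\<bar> \<le> 1 / 2" if "\<bar>x\<bar> \<le> t0" "0 \<le> y" "y \<le> B" for x y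
  proof -
    have "\<bar>x\<bar> * \<bar>y\<bar> \<le> t0 * B" using that t0 by (intro mult_mono) auto
    then show ?thesis using B0 by (simp add: abs_mult t0_def)
  qed
  have big: "ennreal (exp (2 * x\<^sup>2 * s)) \<le> ennreal (2 * exp (Cb * x\<^sup>2 * real (K m)))"
    "ennreal (2 * exp (2 * x\<^sup>2 * s)) \<le> ennreal (2 * exp (Cb * x\<^sup>2 * real (K m)))"
    if s: "s \<le> \<kappa> * real (K m) * B\<^sup>2" for x s m
  proof -
    have "2 * x\<^sup>2 * s \<le> 2 * x\<^sup>2 * (\<kappa> * real (K m) * B\<^sup>2)"
      by (rule mult_left_mono[OF s]) simp
    also have "\<dots> = Cb * x\<^sup>2 * real (K m)" by (simp add: Cb_def)
    finally have le: "exp (2 * x\<^sup>2 * s) \<le> exp (Cb * x\<^sup>2 * real (K m))" by simp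
    then show "ennreal (2 * exp (2 * x\<^sup>2 * s)) \<le> ennreal (2 * exp (Cb * x\<^sup>2 * real (K m)))"
      by (intro ennreal_leI) simp
    have "exp (Cb * x\<^sup>2 * real (K m)) > 0" by simp
    then show "ennreal (exp (2 * x\<^sup>2 * s)) \<le> ennreal (2 * exp (Cb * x\<^sup>2 * real (K m)))"
      using le by (intro ennreal_leI) linarith
  qed
  have v2: "(v m k)\<^sup>2 \<le> B\<^sup>2" for m using v[of m k] by (intro power_mono) auto

  have "AE \<omega> in M. (\<lambda>m. R1 m \<omega> / real (K m)) \<longlonglongrightarrow> 0"
  proof (rule AE_tendsto_0_of_mgf[OF Km _ t0 Cb])
    have f: "(\<lambda>g. \<Sum>a<N m. (cmod (g (k, a)))\<^sup>2) \<in> borel_measurable (PiM (?I m) (\<lambda>_. borel :: complex measure))" for m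
      using comp[OF k] by (intro borel_measurable_sum borel_measurable_power measurable_compose[OF comp[OF k] borel_measurable_norm]) auto
    note [measurable] = f measurable_compose[OF G_meas f]
    show "R1 m \<in> borel_measurable M" for m
      unfolding R1_def by measurable
    fix m and x :: real assume x: "\<bar>x\<bar> \<le> t0"
    have "(\<integral>\<^sup>+\<omega>. ennreal (exp (x * R1 m \<omega>)) \<partial>M) =
        (\<integral>\<^sup>+g. ennreal (exp (x * ((\<Sum>a<N m. (cmod (g (k, a)))\<^sup>2) - real (N m) * v m k))) \<partial>normal_columns (K m) (N m) (v m))"
      unfolding R1_def by (rule single) measurable
    also have "\<dots> \<le> ennreal (exp (2 * x\<^sup>2 * (real (N m) * (v m k)\<^sup>2)))"
      using v k small[OF x] by (intro mgf_column_norm) (auto simp: less_imp_le)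
    also have "\<dots> \<le> ennreal (2 * exp (Cb * x\<^sup>2 * real (K m)))"
      using v2[of m] by (intro big) (simp add: N\<kappa>[symmetric] mult_left_mono)
    finally show "(\<integral>\<^sup>+\<omega>. ennreal (exp (x * R1 m \<omega>)) \<partial>M) \<le> ennreal (2 * exp (Cb * x\<^sup>2 * real (K m)))" .
  qed
  moreover have "AE \<omega> in M. (\<lambda>m. R2 m \<omega> / real (K m)) \<longlonglongrightarrow> 0"
  proof (rule AE_tendsto_0_of_mgf[OF Km _ t0 Cb])
    have f: "(\<lambda>g. proj_norm (K m) (N m) (v m k) k g) \<in> borel_measurable (PiM (?I m) (\<lambda>_. borel :: complex measure))" for m
      using measurable_proj_norm[OF k, where v = "v m"] by (simp cong: measurable_cong_sets add: sets_PiM_complex_normal)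
    note [measurable] = f measurable_compose[OF G_meas f]
    show "R2 m \<in> borel_measurable M" for m
      unfolding R2_def by measurable
    fix m and x :: real assume x: "\<bar>x\<bar> \<le> t0"
    have "(\<integral>\<^sup>+\<omega>. ennreal (exp (x * R2 m \<omega>)) \<partial>M) =
        (\<integral>\<^sup>+g. ennreal (exp (x * (proj_norm (K m) (N m) (v m k) k g - real (K m - 1) * v m k))) \<partial>normal_columns (K m) (N m) (v m))"
      unfolding R2_def by (rule single) measurable
    also have "\<dots> \<le> ennreal (2 * exp (2 * x\<^sup>2 * (real (K m - 1) * (v m k)\<^sup>2)))"
      using v k small[OF x] by (intro mgf_proj_norm) (auto simp: less_imp_le)
    also have "\<dots> \<le> ennreal (2 * exp (Cb * x\<^sup>2 * real (K m)))"
    proof (rule big(2))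
      have "real (K m - 1) \<le> \<kappa> * real (K m)" using KN[of m] by (simp add: N\<kappa>[symmetric])
      then show "real (K m - 1) * (v m k)\<^sup>2 \<le> \<kappa> * real (K m) * B\<^sup>2"
        using v2[of m] \<kappa> by (intro mult_mono) auto
    qed
    finally show "(\<integral>\<^sup>+\<omega>. ennreal (exp (x * R2 m \<omega>)) \<partial>M) \<le> ennreal (2 * exp (Cb * x\<^sup>2 * real (K m)))" .
  qed
  moreover have "AE \<omega> in M. (\<lambda>m. R3 i m \<omega> / real (K m)) \<longlonglongrightarrow> 0" if i: "i < L" for i
  proof (rule AE_tendsto_0_of_mgf[OF Km _ t0 Cb])
    let ?q = "\<lambda>m g y. \<Sum>j<K m. (cmod (\<Sum>a<N m. unit_row (K m) (N m) k g a * y (j, a)))\<^sup>2"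
    have f: "(\<lambda>x. ?q m (fst x) (snd x)) \<in> borel_measurable (PiM (?I m) (\<lambda>_. borel :: complex measure) \<Otimes>\<^sub>M PiM (?I m) (\<lambda>_. borel))" for m
    proof -
      have u: "(\<lambda>x. unit_row (K m) (N m) k (fst x) a) \<in> borel_measurable (PiM (?I m) (\<lambda>_. borel :: complex measure) \<Otimes>\<^sub>M PiM (?I m) (\<lambda>_. borel :: complex measure))"
        if "a < N m" for a
        by (rule measurable_unit_row[OF k _ that]) (rule measurable_compose[OF measurable_fst comp])
      have y: "(\<lambda>x. snd x (j, a)) \<in> borel_measurable (PiM (?I m) (\<lambda>_. borel :: complex measure) \<Otimes>\<^sub>M PiM (?I m) (\<lambda>_. borel :: complex measure))"
        if "j < K m" "a < N m" for j a
        by (rule measurable_compose[OF measurable_snd comp[OF that]])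
      have "(\<lambda>x. \<Sum>a<N m. unit_row (K m) (N m) k (fst x) a * snd x (j, a)) \<in> borel_measurable (PiM (?I m) (\<lambda>_. borel :: complex measure) \<Otimes>\<^sub>M PiM (?I m) (\<lambda>_. borel :: complex measure))"
        if "j < K m" for j
        using that by (intro borel_measurable_sum borel_measurable_times u y) auto
      then show ?thesis
        by (intro borel_measurable_sum borel_measurable_power) (auto intro: measurable_compose[OF _ borel_measurable_norm])
    qed
    have [measurable]: "(\<lambda>\<omega>. ?q m (G m \<omega>) (E m i \<omega>)) \<in> borel_measurable M" for m
      using measurable_compose[OF measurable_Pair[OF G_meas E_meas[OF i]] f] by simp
    show "R3 i m \<in> borel_measurable M" for m
      unfolding R3_def by measurable
    fix m and x :: real assume x: "\<bar>x\<bar> \<le> t0"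
    note [measurable] = f[of m]
    have "(\<integral>\<^sup>+\<omega>. ennreal (exp (x * R3 i m \<omega>)) \<partial>M) =
        (\<integral>\<^sup>+g. \<integral>\<^sup>+y. ennreal (exp (x * (?q m g y - (\<Sum>j<K m. d m i j)))) \<partial>normal_columns (K m) (N m) (d m i) \<partial>normal_columns (K m) (N m) (v m))"
      unfolding R3_def
      by (rule pair[of i "\<lambda>g y. ennreal (exp (x * (?q m g y - (\<Sum>j<K m. d m i j))))" m, OF i])
        (unfold split_beta', measurable)
    \<comment> \<open>For each fixed \<open>g\<close> the row is a deterministic unit vector, and
      the bound obtained does not depend on \<open>g\<close>.\<close>
    also have "\<dots> \<le> (\<integral>\<^sup>+g. ennreal (exp (2 * x\<^sup>2 * (\<Sum>j<K m. (d m i j)\<^sup>2))) \<partial>normal_columns (K m) (N m) (v m))"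
      using d[OF i] small[OF x] N0[of m] by (intro nn_integral_mono mgf_combined_columns unit_row_norm) auto
    also have "\<dots> = ennreal (exp (2 * x\<^sup>2 * (\<Sum>j<K m. (d m i j)\<^sup>2)))"
      using prob_space.emeasure_space_1[OF ps] by simp
    also have "\<dots> \<le> ennreal (2 * exp (Cb * x\<^sup>2 * real (K m)))"
    proof (rule big(1))
      have "(\<Sum>j<K m. (d m i j)\<^sup>2) \<le> (\<Sum>j<K m. B\<^sup>2)"
        using d[OF i] by (intro sum_mono power_mono) auto
      also have "\<dots> = 1 * real (K m) * B\<^sup>2" by simp
      also have "\<dots> \<le> \<kappa> * real (K m) * B\<^sup>2"
        using \<kappa> by (intro mult_right_mono) auto
      finally show "(\<Sum>j<K m. (d m i j)\<^sup>2) \<le> \<kappa> * real (K m) * B\<^sup>2" .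
    qed
    finally show "(\<integral>\<^sup>+\<omega>. ennreal (exp (x * R3 i m \<omega>)) \<partial>M) \<le> ennreal (2 * exp (Cb * x\<^sup>2 * real (K m)))" .
  qed
  then have "AE \<omega> in M. \<forall>i\<in>{..<L}. (\<lambda>m. R3 i m \<omega> / real (K m)) \<longlonglongrightarrow> 0"
    by (subst AE_ball_countable) auto
  \<comment> \<open>The null event is carried from the law of \<open>G\<close> to the sample space
    as a vanishing integral of its indicator; countably many sizes allow one exceptional
    set.\<close>
  moreover have "AE \<omega> in M. \<forall>m. det (gram (K m) (N m) (G m \<omega>)) \<noteq> 0"
  proof (subst AE_all_countable, rule allI)
    fix m
    have [measurable]: "(\<lambda>g. det (gram (K m) (N m) g)) \<in> borel_measurable (PiM (?I m) (\<lambda>_. borel))"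
      by (rule measurable_zf_row(1)[OF k]) (rule comp)
    note [measurable] = measurable_compose[OF G_meas this]
    let ?f = "\<lambda>g. indicator {g. det (gram (K m) (N m) g) = 0} g :: ennreal"
    have f: "?f \<in> borel_measurable (PiM (?I m) (\<lambda>_. borel))" by measurable
    then have f': "?f \<in> borel_measurable (normal_columns (K m) (N m) (v m))"
      by (simp cong: measurable_cong_sets add: sets_PiM_complex_normal)
    have "AE g in normal_columns (K m) (N m) (v m). det (gram (K m) (N m) g) \<noteq> 0"
      using v KN by (intro AE_det_gram) auto
    then have "(\<integral>\<^sup>+g. ?f g \<partial>normal_columns (K m) (N m) (v m)) = 0"
      by (subst nn_integral_0_iff_AE[OF f']) auto
    then have "(\<integral>\<^sup>+\<omega>. ?f (G m \<omega>) \<partial>M) = 0"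
      using single[OF f] by simp
    then show "AE \<omega> in M. det (gram (K m) (N m) (G m \<omega>)) \<noteq> 0"
      by (subst (asm) nn_integral_0_iff_AE) (auto intro: measurable_compose[OF G_meas f] simp: indicator_def elim: AE_mp)
  qed
  ultimately show ?thesis
  proof eventually_elim
    case (elim \<omega>)

    \<comment> \<open>Comparison of the two quotients at one sample point\<close>
    define C where "C = (\<Sum>i\<in>{..<L} - {l}. (\<beta> l i k / \<beta> l l k)\<^sup>2)"
    define x where "x m = ((\<Sum>a<N m. (cmod (G m \<omega> (k, a)))\<^sup>2) - proj_norm (K m) (N m) (v m k) k (G m \<omega>)) / real (K m)" for m
    define y where "y m = v m k * (\<kappa> - 1)" for m
    define T where "T m = (\<Sum>i<L. (\<Sum>j<K m. (cmod (\<Sum>a<N m. unit_row (K m) (N m) k (G m \<omega>) a * E m i \<omega> (j, a)))\<^sup>2) / real (K m))" for m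
    define U where "U m = (\<Sum>i<L. 1 / real (K m) * mat_trace (D_tilde \<beta> L (K m) (ptr m) \<alpha> l i))" for m
    define w where "w m = 1 / (pr * real (K m))" for m
    have invK: "(\<lambda>m. 1 / real (K m)) \<longlonglongrightarrow> 0"
    proof -
      have "filterlim (\<lambda>m. real (K m)) at_top sequentially"
        using filterlim_compose[OF filterlim_real_sequentially filterlim_subseq[OF assms(3)]] .
      then show ?thesis by (rule tendsto_divide_0[OF tendsto_const filterlim_at_top_imp_at_infinity])
    qed
    have sinr: "zf_sinr \<beta> L (K m) (N m) pr (ptr m) \<alpha> (h m \<omega>) (z m \<omega>) (e m \<omega>) l k n =
      \<alpha>\<^sup>2 * x m / (\<alpha>\<^sup>2 * C * x m + T m + w m)" for m
      unfolding x_def T_def C_def w_def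
      by (rule zf_sinr_eq[where \<beta> = \<beta> and G = "G m \<omega>" and E = "\<lambda>i. E m i \<omega>", OF k N0 l pr \<beta>])
        (use elim in \<open>auto simp: G_def E_def\<close>)
    have det: "zf_sinr_det \<beta> L (K m) \<kappa> (ptr m) \<alpha> l k = \<alpha>\<^sup>2 * y m / (\<alpha>\<^sup>2 * C * y m + U m)" for m
      by (simp add: zf_sinr_det_def Let_def C_def[symmetric] U_def y_def v_def mult.assoc)
    have U_eq: "U m = (\<Sum>i<L. (\<Sum>j<K m. d m i j) / real (K m))" for m
      by (simp add: U_def mat_trace_D_tilde d_def)
    have C0: "C \<ge> 0" by (simp add: C_def sum_nonneg)
    have U0: "U m \<ge> 0" for m
      unfolding U_eq using d by (intro sum_nonneg divide_nonneg_nonneg) auto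
    have y0: "y m \<ge> 0" for m
      using v[of m k] \<kappa> by (simp add: y_def)
    have lower: "\<exists>\<delta>>0. \<forall>m. \<delta> \<le> \<alpha>\<^sup>2 * C * y m + U m"
    proof (cases "L = 1 \<or> \<kappa> = 1")
      case True
      then obtain \<delta> where \<delta>: "\<delta> > 0" "\<And>m. \<delta> \<le> U m"
        using assms(13) by (auto simp: U_def ptr_def)
      have "\<delta> \<le> \<alpha>\<^sup>2 * C * y m + U m" for m
        using \<delta>(2)[of m] C0 y0[of m] by (simp add: add_increasing)
      then show ?thesis using \<delta>(1) by blast
    next
      case F: False
      \<comment> \<open>\<open>ptr m\<close> is at least \<open>pr\<close>, so \<open>b0\<close>
        bounds \<open>v m k\<close> below for all \<open>m\<close>; with more than one cell and
        \<kappa> > 1 the interference term alone then keeps the denominator away from 0.\<close>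
      define b0 where "b0 = (\<beta> l l k)\<^sup>2 / ((\<Sum>i'<L. \<beta> l i' k) + 1 / pr)"
      have "(\<Sum>i'<L. \<beta> l i' k) > 0"
        using l \<beta> by (intro sum_pos) auto
      then have b0: "b0 > 0"
        using \<beta>[OF l, of k] pr by (simp add: b0_def add_pos_pos)
      have "C > 0"
        unfolding C_def
      proof (rule sum_pos)
        show "{..<L} - {l} \<noteq> {}"
        proof
          assume "{..<L} - {l} = {}"
          then have "{..<L} = {l}" using l by auto
          then have "card {..<L} = 1" by simp
          then show False using F by simp
        qed
        show "0 < (\<beta> l i k / \<beta> l l k)\<^sup>2" if "i \<in> {..<L} - {l}" for i
          using that \<beta>[of i k] \<beta>[OF l, of k] by simp
      qed simp
      have "\<alpha>\<^sup>2 * C * (b0 * (\<kappa> - 1)) \<le> \<alpha>\<^sup>2 * C * y m + U m" for m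
      proof -
        have "b0 \<le> v m k"
          unfolding b0_def v_def by (rule beta_hat_bounds(3)[where \<beta> = \<beta>, OF \<beta> l ptr(1) pr ptr(2)])
        then have "\<alpha>\<^sup>2 * C * (b0 * (\<kappa> - 1)) \<le> \<alpha>\<^sup>2 * C * y m"
          unfolding y_def using C0 \<kappa> by (intro mult_left_mono mult_right_mono) auto
        then show ?thesis using U0[of m] by linarith
      qed
      moreover have "\<alpha>\<^sup>2 * C * (b0 * (\<kappa> - 1)) > 0"
        using \<open>C > 0\<close> b0 \<kappa> F False by simp
      ultimately show ?thesis by blast
    qed
    then obtain \<delta> where \<delta>: "\<delta> > 0" "\<And>m. \<delta> \<le> \<alpha>\<^sup>2 * C * y m + U m" by blast
    have "(\<lambda>m. \<alpha>\<^sup>2 * x m / (\<alpha>\<^sup>2 * C * x m + T m + w m) - \<alpha>\<^sup>2 * y m / (\<alpha>\<^sup>2 * C * y m + U m)) \<longlonglongrightarrow> 0"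
    proof (rule quotient_tendsto_0[OF _ _ _ _ \<delta>])
      show "(\<lambda>m. x m - y m) \<longlonglongrightarrow> 0"
      proof -
        \<comment> \<open>Only \<open>K - 1\<close> columns are projected out, so \<open>x m\<close>
          is centred at v (N - (K - 1)) / K = v (\<kappa> - 1 + 1 / K), with v for
          \<open>v m k\<close>. The excess over \<open>y m\<close> is the last summand and tends to
          0.\<close>
        have "x m - y m = R1 m \<omega> / real (K m) - R2 m \<omega> / real (K m) + v m k * (1 / real (K m))" for m
        proof -
          have "real (K m - 1) = real (K m) - 1" using K0[of m] by (simp add: of_nat_diff)
          moreover have xK: "x m * real (K m) = (\<Sum>a<N m. (cmod (G m \<omega> (k, a)))\<^sup>2) - proj_norm (K m) (N m) (v m k) k (G m \<omega>)"
            using K0[of m] by (simp add: x_def)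
          ultimately have "R1 m \<omega> - R2 m \<omega> = x m * real (K m) - v m k * (\<kappa> * real (K m) - real (K m) + 1)"
            unfolding xK by (simp add: R1_def R2_def N\<kappa> algebra_simps)
          then have "(R1 m \<omega> - R2 m \<omega>) / real (K m) = x m - v m k * (\<kappa> - 1 + 1 / real (K m))"
            using K0[of m] by (simp add: field_simps)
          then show ?thesis
            by (simp add: y_def diff_divide_distrib algebra_simps)
        qed
        moreover have "(\<lambda>m. v m k * (1 / real (K m))) \<longlonglongrightarrow> 0"
        proof (rule Lim_null_comparison)
          show "eventually (\<lambda>m. norm (v m k * (1 / real (K m))) \<le> B * (1 / real (K m))) sequentially"
            using v by (intro always_eventually allI) (simp add: abs_mult divide_right_mono less_imp_le)
          show "(\<lambda>m. B * (1 / real (K m))) \<longlonglongrightarrow> 0"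
            using tendsto_mult_left[OF invK, of B] by simp
        qed
        ultimately show ?thesis
          using tendsto_add[OF tendsto_diff[OF elim(1,2)]] by simp
      qed
      have "T m - U m = (\<Sum>i<L. R3 i m \<omega> / real (K m))" for m
        by (simp add: T_def U_eq R3_def sum_subtractf diff_divide_distrib)
      moreover have "(\<lambda>m. \<Sum>i<L. R3 i m \<omega> / real (K m)) \<longlonglongrightarrow> (\<Sum>i<L. 0)"
        using elim(3) by (intro tendsto_sum) auto
      ultimately show "(\<lambda>m. T m - U m) \<longlonglongrightarrow> 0" by simp
      show "w \<longlonglongrightarrow> 0"
        using tendsto_mult_left[OF invK, of "1 / pr"] by (simp add: w_def[abs_def])
      show "\<bar>y m\<bar> \<le> B * (\<kappa> - 1)" for m
        using v[of m k] \<kappa> y0[of m] by (simp add: y_def mult_right_mono)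
    qed
    then show ?case
      by (simp only: sinr det ptr_def[symmetric])
  qed
qed

end
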